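(* A stabilized (energy stable) version of the BR1 type SAT is recovered if the coefficient matrices in the SBP-SAT discretization are set as $$T^{(1)}_{\gamma k}=T^{(1)}_{\gamma v}=\tfrac12B_\gamma\Big[\tfrac1{\alpha_{\gamma k}}\Upsilon_{\gamma\gamma k}+\tfrac1{\alpha_{\gamma v}}\Upsilon_{\gamma\gamma v}\Big]B_\gamma,\quad T^{(3)}_{\gamma k}=T^{(3)}_{\gamma v}=\tfrac12B_\gamma,\quad T^{(2)}_{\gamma k}=T^{(2)}_{\gamma v}=-\tfrac12B_\gamma,\quad T^{(4)}_{\gamma k}=T^{(4)}_{\gamma v}=0,$$ $$T^{(5)}_{\gamma\epsilon k}=-T^{(6)}_{\gamma\epsilon k}=\tfrac1{16}B_\gamma\Upsilon_{\gamma\epsilon k}B_\epsilon,\quad T^{(5)}_{\gamma\delta v}=-T^{(6)}_{\gamma\delta v}=\tfrac1{16}B_\gamma\Upsilon_{\gamma\delta v}B_\delta,\quad T^{(D)}_\gamma=\tfrac1{\alpha_{\gamma k}}B_\gamma\Upsilon_{\gamma\gamma k}B_\gamma.$$ Moreover, this BR1 SAT produces a consistent, conservative and adjoint consistent discretization.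
   Context: **Problem.** $\Omega\subset\mathbb R^2$ is compact with piecewise smooth boundary $\Gamma^D\cup\Gamma^N$ ($\Gamma^D\ne\emptyset$), $\lambda$ a symmetric positive definite (SPD) $2\times2$ tensor field. $\partial_t\mathcal U-\nabla\cdot(\lambda\nabla\mathcal U)=\mathcal F$ in $\Omega$, $\mathcal U=\mathcal U_D$ on $\Gamma^D$, $(\lambda\nabla\mathcal U)\cdot n=\mathcal U_N$ on $\Gamma^N$. Adjoint of the steady problem for $\mathcal I(\mathcal U)=\int_\Omega\mathcal G\mathcal U-\int_{\Gamma^D}\psi_D(\lambda\nabla\mathcal U)\cdot n+\int_{\Gamma^N}\psi_N\mathcal U$: $-\nabla\cdot(\lambda\nabla\psi)=\mathcal G$, $\psi=\psi_D$ on $\Gamma^D$, $(\lambda\nabla\psi)\cdot n=\psi_N$ on $\Gamma^N$. **Mesh.** Non-overlapping (possibly curved) triangles $\Omega_k$ of diameter $h$, images of the reference triangle under bijective polynomial maps of degree at most $p+1$ with exact metric terms. $\Gamma_k$: facets of $\Omega_k$; $\Gamma_k^I$: the interior ones. For an interior facet $\gamma$ of $\Omega_k$, $\Omega_v$ is the neighbour across $\gamma$; $\epsilon$ runs over the other interior facets of $\Omega_k$ (neighbour $\Omega_g$), $\delta$ over the other interior facets of $\Omega_v$ (neighbour $\Omega_q$). **Operators.** On $\Omega_k$ ($n_p$ volume nodes, $n_f$ nodes per facet, Legendre–Gauss facet quadrature of degree $2p+1$): $H_k$ diagonal SPD norm (quadrature) matrix; $B_\gamma$ diagonal matrix of positive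 facet quadrature weights (common to both sides); $N_{x\gamma k},N_{y\gamma k}$ diagonal matrices of outward unit normal components at facet nodes; $R_{\gamma k}\in\mathbb R^{n_f\times n_p}$ extrapolation to facet nodes, exact for degree $\le p$ polynomials on the reference element; $D_{xk},D_{yk}$ degree-$p$ SBP first-derivative matrices (order $p$ accurate at nodes, $D_{xk}\mathbf 1=D_{yk}\mathbf 1=0$) with $H_kD_{xk}+(H_kD_{xk})^T=\sum_{\gamma\subset\Gamma_k}R_{\gamma k}^TB_\gamma N_{x\gamma k}R_{\gamma k}$, similarly $y$. $\Lambda_k$: $2\times2$ block matrix with diagonal blocks holding $\lambda$ at the volume nodes. $N_{\gamma k}=\begin{bmatrix}N_{x\gamma k}\\ N_{y\gamma k}\end{bmatrix}$, $\bar R_{\gamma k}=\mathrm{diag}(R_{\gamma k},R_{\gamma k})$, $\bar H_k=\mathrm{diag}(H_k,H_k)$, $D^{(2)}_k=[D_{xk}\; D_{yk}]\Lambda_k\begin{bmatrix}D_{xk}\\ D_{yk}\end{bmatrix}$, $D_{\gamma k}=N_{\gamma k}^T\bar R_{\gamma k}\Lambda_k\begin{bmatrix}D_{xk}\\ D_{yk}\end{bmatrix}$, $\Upsilon_{abk}=N_{ak}^T\bar R_{ak}\bar H_k^{-1}\Lambda_k\bar R_{bk}^TN_{bk}$. Facet weights $\alpha_{\gamma k}>0$ with $\sum_{\gamma\subset\Gamma_k}\alpha_{\gamma k}=1$. **Discretization.** $\frac{du_{h,k}}{dt}=D^{(2)}_ku_{h,k}+f_k-H_k^{-1}s_k^I-H_k^{-1}s_k^B$,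 with $$s_k^I=\sum_{\gamma\subset\Gamma_k^I}[R_{\gamma k}^T\; D_{\gamma k}^T]\begin{bmatrix}T^{(1)}_{\gamma k}&T^{(3)}_{\gamma k}\\ T^{(2)}_{\gamma k}&T^{(4)}_{\gamma k}\end{bmatrix}\begin{bmatrix}R_{\gamma k}u_k-R_{\gamma v}u_v\\ D_{\gamma k}u_k+D_{\gamma v}u_v\end{bmatrix}+\sum_{\gamma\subset\Gamma_k^I}\Big\{\sum_{\epsilon}R_{\gamma k}^TT^{(5)}_{\gamma\epsilon k}[R_{\epsilon k}u_k-R_{\epsilon g}u_g]+\sum_{\delta}R_{\gamma k}^TT^{(6)}_{\gamma\delta v}[R_{\delta v}u_v-R_{\delta q}u_q]\Big\},$$ $$s_k^B=\sum_{\gamma\subset\Gamma^D\cap\Gamma_k}[R_{\gamma k}^T\; D_{\gamma k}^T]\begin{bmatrix}T_\gamma^{(D)}\\ -B_\gamma\end{bmatrix}(R_{\gamma k}u_k-u_{\gamma k})+\sum_{\gamma\subset\Gamma^N\cap\Gamma_k}R_{\gamma k}^TB_\gamma(D_{\gamma k}u_k-w_{\gamma k}),$$ $f_k$, $u_{\gamma k}$, $w_{\gamma k}$ the nodal values of $\mathcal F$, $\mathcal U$, $n\cdot(\lambda\nabla\mathcal U)$; set $L_{h,k}(u)=-D^{(2)}_ku_k+H_k^{-1}s^I_k+H_k^{-1}s^B_k$. **Definitions.** *Energy stable*: for $\mathcal F=\mathcal U_D=\mathcal U_N=0$, $\frac{d}{dt}\sum_ku_{h,k}^TH_ku_{h,k}\le0$.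 *Consistent*: $\lim_{h\to0}\sum_k\|L_{h,k}(u)-f_k\|_{H_k}=0$ for the exact steady solution in $\mathcal C^{p+1}$. *Conservative*: for $f_k=0$, $\sum_k\mathbf 1^TH_k\frac{du_{h,k}}{dt}$ reduces to boundary-facet terms only. *Adjoint consistent*: $\lim_{h\to0}\sum_k\|L^*_{h,k}(\psi)-g_k\|_{H_k}=0$ for the exact adjoint in $\mathcal C^{p+1}$, where $g_k$ are nodal values of $\mathcal G$ and $L^*_{h,k}(\psi)=-D_k^{(2)}\psi_k+H_k^{-1}(s_k^I)^*+H_k^{-1}(s_k^B)^*$, $(s_k^B)^*$ being $s_k^B$ with $(u_k,u_{\gamma k},w_{\gamma k})$ replaced by $\psi_k$ and the facet values of $\psi$, $n\cdot(\lambda\nabla\psi)$, and $$(s_k^I)^*=\sum_{\gamma\subset\Gamma_k^I}[R_{\gamma k}^T\; D_{\gamma k}^T]\begin{bmatrix}T^{(1)}_{\gamma k}&-T^{(1)}_{\gamma v}&T^{(2)}_{\gamma k}+B_\gamma&-T^{(2)}_{\gamma v}\\ T^{(3)}_{\gamma k}-B_\gamma&T^{(3)}_{\gamma v}&T^{(4)}_{\gamma k}&T^{(4)}_{\gamma v}\end{bmatrix}\begin{bmatrix}R_{\gamma k}\psi_k\\ R_{\gamma v}\psi_v\\ D_{\gamma k}\psi_k\\ D_{\gamma v}\psi_v\end{bmatrix}+\sum_{\gamma\subset\Gamma_k^I}\Big\{\sum_\epsilon R_{\gamma k}^T[T^{(5)}_{\gamma\epsilon k}R_{\epsilon k}\psi_k+T^{(6)}_{\gamma\epsilon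 k}R_{\epsilon g}\psi_g]-\sum_\delta R_{\gamma k}^T[T^{(5)}_{\gamma\delta v}R_{\delta v}\psi_v+T^{(6)}_{\gamma\delta v}R_{\delta q}\psi_q]\Big\}.$$ **BR1 type SAT.** The first method of Bassi and Rebay uses the numerical fluxes $\widehat{\mathcal U}=\{\mathcal U_h\}$, $\widehat{\mathcal W}=\{\mathcal W_h\}$ (averages) on interior facets; discretizing it with SBP operators (with lifting operators restricted to interior facets) gives the coefficients above except that, unmodified, $T^{(1)}_{\gamma k}=\frac14B_\gamma[\Upsilon_{\gamma\gamma k}+\Upsilon_{\gamma\gamma v}]B_\gamma$, $T^{(5)}_{\gamma\epsilon k}=\frac14B_\gamma\Upsilon_{\gamma\epsilon k}B_\epsilon$, $T^{(5)}_{\gamma\delta v}=\frac14B_\gamma\Upsilon_{\gamma\delta v}B_\delta$, $T^{(D)}_\gamma=B_\gamma\Upsilon_{\gamma\gamma k}B_\gamma$; "stabilized version" refers to changing these scalings so that energy stability holds.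
   Formalization: Consistency and adjoint consistency are stated for p ≥ 3 (the summed norm need not vanish for p = 1, 2), with λ of class C^p, shape-regular quasi-uniform meshes, derivative matrices of size O(1/h), and facet weights bounded below; stability and conservation hold for all p ≥ 1. *)

theory Defs
  imports "HOL-Analysis.Analysis"
begin

definition pd :: "2 \<Rightarrow> (real^2 \<Rightarrow> real) \<Rightarrow> real^2 \<Rightarrow> real" where
  "pd a f x = frechet_derivative f (at x) (axis a 1)"

text \<open>Meant for open sets.\<close>

primrec Ck_on :: "nat \<Rightarrow> (real^2 \<Rightarrow> real) \<Rightarrow> (real^2) set \<Rightarrow> bool" where
  "Ck_on 0 f S = continuous_on S f"
| "Ck_on (Suc m) f S = ((\<forall>x\<in>S. f differentiable (at x)) \<and> (\<forall>a. Ck_on m (pd a f) S))"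

text \<open>A function is of class \<open>C\<^sup>m\<close> on a compact set if it is so on an open neighbourhood of it.\<close>

definition Ck :: "nat \<Rightarrow> (real^2 \<Rightarrow> real) \<Rightarrow> (real^2) set \<Rightarrow> bool" where
  "Ck m f X \<longleftrightarrow> (\<exists>S. open S \<and> X \<subseteq> S \<and> Ck_on m f S)"

text \<open>
  \<open>\<nu>\<close> is the outward unit normal of \<open>S\<close> at \<open>x\<close>. Such a \<open>\<nu>\<close> is unique; it exists at smooth
  points of the boundary and does not exist at corners.
\<close>

definition outward_unit_normal :: "(real^2) set \<Rightarrow> real^2 \<Rightarrow> real^2 \<Rightarrow> bool" where
  "outward_unit_normal S x \<nu> \<longleftrightarrow> norm \<nu> = 1 \<and>
     (\<forall>v. v \<bullet> \<nu> < 0 \<longrightarrow> (\<forall>\<^sub>F t in at_right 0. x + t *\<^sub>R v \<in> interior S)) \<and>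
     (\<forall>v. v \<bullet> \<nu> > 0 \<longrightarrow> (\<forall>\<^sub>F t in at_right 0. x + t *\<^sub>R v \<notin> S))"

definition spd :: "real^'n^'n \<Rightarrow> bool" where
  "spd A \<longleftrightarrow> transpose A = A \<and> (\<forall>x. x \<noteq> 0 \<longrightarrow> x \<bullet> (A *v x) > 0)"

definition flux :: "(real^2 \<Rightarrow> real^2^2) \<Rightarrow> (real^2 \<Rightarrow> real) \<Rightarrow> real^2 \<Rightarrow> real^2" where
  "flux lam U x = lam x *v (\<chi> b. pd b U x)"

definition div_flux :: "(real^2 \<Rightarrow> real^2^2) \<Rightarrow> (real^2 \<Rightarrow> real) \<Rightarrow> real^2 \<Rightarrow> real" where
  "div_flux lam U x = (\<Sum>a\<in>UNIV. pd a (\<lambda>y. flux lam U y $ a) x)"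

definition diffusion_domain ::
  "(real^2) set \<Rightarrow> (real^2) set \<Rightarrow> (real^2) set \<Rightarrow> (real^2 \<Rightarrow> real^2^2) \<Rightarrow> bool" where
  "diffusion_domain \<Omega> \<Gamma>D \<Gamma>N lam \<longleftrightarrow>
     compact \<Omega> \<and> frontier \<Omega> = \<Gamma>D \<union> \<Gamma>N \<and> \<Gamma>D \<noteq> {} \<and> (\<forall>x\<in>\<Omega>. spd (lam x))"

text \<open>
  Since \<open>lam\<close> is symmetric, this is both the steady primal problem, with data \<open>(F, U\<^sub>D, U\<^sub>N)\<close>, and
  its adjoint problem, with data \<open>(G, \<psi>\<^sub>D, \<psi>\<^sub>N)\<close>.
\<close>

definition steady_solution ::
  "(real^2) set \<Rightarrow> (real^2) set \<Rightarrow> (real^2) set \<Rightarrow> (real^2 \<Rightarrow> real^2^2) \<Rightarrow>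
   (real^2 \<Rightarrow> real) \<Rightarrow> (real^2 \<Rightarrow> real) \<Rightarrow> (real^2 \<Rightarrow> real) \<Rightarrow> (real^2 \<Rightarrow> real) \<Rightarrow> bool" where
  "steady_solution \<Omega> \<Gamma>D \<Gamma>N lam F Udir Uneu U \<longleftrightarrow>
     (\<forall>x\<in>\<Omega>. - div_flux lam U x = F x) \<and>
     (\<forall>x\<in>\<Gamma>D. U x = Udir x) \<and>
     (\<forall>x\<in>\<Gamma>N. \<forall>\<nu>. outward_unit_normal \<Omega> x \<nu> \<longrightarrow> flux lam U x \<bullet> \<nu> = Uneu x)"

definition poly2 :: "nat \<Rightarrow> (nat \<Rightarrow> nat \<Rightarrow> 'v::real_vector) \<Rightarrow> real^2 \<Rightarrow> 'v" where
  "poly2 d c \<xi> = (\<Sum>a\<le>d. \<Sum>b\<le>d - a. ((\<xi> $ 1) ^ a * (\<xi> $ 2) ^ b) *\<^sub>R c a b)"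

text \<open>In the index type \<open>3\<close> arithmetic is modulo 3, so edge \<open>i\<close> joins vertex \<open>i\<close> to the next one.\<close>

definition ref_vertex :: "3 \<Rightarrow> real^2" where
  "ref_vertex i = (if i = 1 then 0 else if i = 2 then axis 1 1 else axis 2 1)"

definition ref_triangle :: "(real^2) set" where
  "ref_triangle = convex hull (range ref_vertex)"

definition ref_edge :: "3 \<Rightarrow> real \<Rightarrow> real^2" where
  "ref_edge i t = (1 - t) *\<^sub>R ref_vertex i + t *\<^sub>R ref_vertex (i + 1)"

text \<open>
  The type parameters index the volume nodes and the nodes of a facet. Facet nodes and weights live
  on the parameter interval from 0 to 1. An element may traverse a facet in either direction;
  \<open>rextrap i r\<close> is the extrapolation matrix to the nodes of edge \<open>i\<close>, traversed backwards iff \<open>r\<close>.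
\<close>

record ('np, 'nf) ref_element =
  pdeg :: nat
  rnode :: "'np::finite \<Rightarrow> real^2"
  rweight :: "'np \<Rightarrow> real"
  fnode :: "'nf::finite \<Rightarrow> real"
  fweight :: "'nf \<Rightarrow> real"
  rextrap :: "3 \<Rightarrow> bool \<Rightarrow> real^'np^'nf"

definition ref_facet_node :: "('np::finite, 'nf::finite) ref_element \<Rightarrow> 3 \<Rightarrow> bool \<Rightarrow> 'nf \<Rightarrow> real^2" where
  "ref_facet_node E i r j = ref_edge i (if r then 1 - fnode E j else fnode E j)"

text \<open>Exactness up to degree \<open>2p+1\<close> with \<open>p+1\<close> nodes characterizes the Legendre--Gauss rule.\<close>

definition valid_ref_element :: "('np::finite, 'nf::finite) ref_element \<Rightarrow> bool" where
  "valid_ref_element E \<longleftrightarrow>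
     1 \<le> pdeg E \<and>
     (\<forall>i. rnode E i \<in> ref_triangle \<and> rweight E i > 0) \<and>
     CARD('nf) = pdeg E + 1 \<and>
     (\<forall>j. 0 < fnode E j \<and> fnode E j < 1 \<and> fweight E j > 0) \<and>
     (\<forall>m \<le> 2 * pdeg E + 1. (\<Sum>j\<in>UNIV. fweight E j * fnode E j ^ m) = 1 / (real m + 1)) \<and>
     (\<forall>(c :: nat \<Rightarrow> nat \<Rightarrow> real) i r j.
        (rextrap E i r *v (\<chi> l. poly2 (pdeg E) c (rnode E l))) $ j
          = poly2 (pdeg E) c (ref_facet_node E i r j))"

text \<open>
  \<open>face k i\<close> is the (global) facet carried by edge \<open>i\<close> of element \<open>k\<close>; \<open>mcoef k\<close> are the
  coefficients of the polynomial element map; \<open>xfacet\<close>, \<open>bweight\<close> and \<open>normal\<close> are the facet nodes, the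
  diagonal of \<open>B\<^sub>\<gamma>\<close> and the normal vectors at facet nodes; \<open>dmat k a\<close> is the derivative matrix
  in direction \<open>a\<close>.
\<close>

record ('k, 'g, 'np, 'nf) sbp_mesh =
  refel :: "('np::finite, 'nf::finite) ref_element"
  elems :: "'k set"
  face :: "'k \<Rightarrow> 3 \<Rightarrow> 'g"
  backwards :: "'g \<Rightarrow> 'k \<Rightarrow> bool"
  mcoef :: "'k \<Rightarrow> nat \<Rightarrow> nat \<Rightarrow> real^2"
  dfacets :: "'g set"
  nfacets :: "'g set"
  xfacet :: "'g \<Rightarrow> 'nf \<Rightarrow> real^2"
  bweight :: "'g \<Rightarrow> 'nf \<Rightarrow> real"
  normal :: "'g \<Rightarrow> 'k \<Rightarrow> 'nf \<Rightarrow> real^2"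
  dmat :: "'k \<Rightarrow> 2 \<Rightarrow> real^'np^'np"
  alpha :: "'g \<Rightarrow> 'k \<Rightarrow> real"

definition emap :: "('k, 'g, 'np::finite, 'nf::finite) sbp_mesh \<Rightarrow> 'k \<Rightarrow> real^2 \<Rightarrow> real^2" where
  "emap M k = poly2 (pdeg (refel M) + 1) (mcoef M k)"

definition element :: "('k, 'g, 'np::finite, 'nf::finite) sbp_mesh \<Rightarrow> 'k \<Rightarrow> (real^2) set" where
  "element M k = emap M k ` ref_triangle"

definition jac_det :: "('k, 'g, 'np::finite, 'nf::finite) sbp_mesh \<Rightarrow> 'k \<Rightarrow> real^2 \<Rightarrow> real" where
  "jac_det M k \<xi> = det (matrix (frechet_derivative (emap M k) (at \<xi>)))"

definition mesh_size :: "('k, 'g, 'np::finite, 'nf::finite) sbp_mesh \<Rightarrow> real" where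
  "mesh_size M = Max ((\<lambda>k. diameter (element M k)) ` elems M)"

definition facets :: "('k, 'g, 'np::finite, 'nf::finite) sbp_mesh \<Rightarrow> 'k \<Rightarrow> 'g set" where
  "facets M k = range (face M k)"

definition sharing :: "('k, 'g, 'np::finite, 'nf::finite) sbp_mesh \<Rightarrow> 'g \<Rightarrow> 'k set" where
  "sharing M \<gamma> = {k \<in> elems M. \<gamma> \<in> facets M k}"

definition ifacets :: "('k, 'g, 'np::finite, 'nf::finite) sbp_mesh \<Rightarrow> 'k \<Rightarrow> 'g set" where
  "ifacets M k = {\<gamma> \<in> facets M k. \<exists>v\<in>sharing M \<gamma>. v \<noteq> k}"

definition nbr :: "('k, 'g, 'np::finite, 'nf::finite) sbp_mesh \<Rightarrow> 'g \<Rightarrow> 'k \<Rightarrow> 'k" where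
  "nbr M \<gamma> k = (THE v. v \<in> sharing M \<gamma> \<and> v \<noteq> k)"

definition local_edge :: "('k, 'g, 'np::finite, 'nf::finite) sbp_mesh \<Rightarrow> 'g \<Rightarrow> 'k \<Rightarrow> 3" where
  "local_edge M \<gamma> k = (THE i. face M k i = \<gamma>)"

definition facet_curve :: "('k, 'g, 'np::finite, 'nf::finite) sbp_mesh \<Rightarrow> 'g \<Rightarrow> 'k \<Rightarrow> (real^2) set" where
  "facet_curve M \<gamma> k = emap M k ` ref_edge (local_edge M \<gamma> k) ` {0..1}"

definition local_node :: "('k, 'g, 'np::finite, 'nf::finite) sbp_mesh \<Rightarrow> 'g \<Rightarrow> 'k \<Rightarrow> 'nf \<Rightarrow> real^2" where
  "local_node M \<gamma> k = ref_facet_node (refel M) (local_edge M \<gamma> k) (backwards M \<gamma> k)"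

definition xnode :: "('k, 'g, 'np::finite, 'nf::finite) sbp_mesh \<Rightarrow> 'k \<Rightarrow> 'np \<Rightarrow> real^2" where
  "xnode M k i = emap M k (rnode (refel M) i)"

text \<open>
  The condition on \<open>bweight\<close> is the exact arc length element; it holds from both sides of an interior
  facet. As the domain is the union of the elements, its boundary is a finite union of polynomial arcs.
\<close>

definition valid_mesh ::
  "(real^2) set \<Rightarrow> (real^2) set \<Rightarrow> (real^2) set \<Rightarrow> ('k, 'g, 'np::finite, 'nf::finite) sbp_mesh \<Rightarrow> bool" where
  "valid_mesh \<Omega> \<Gamma>D \<Gamma>N M \<longleftrightarrow>
     finite (elems M) \<and> (\<Union>k\<in>elems M. element M k) = \<Omega> \<and>
     (\<forall>k\<in>elems M. \<forall>v\<in>elems M. k \<noteq> v \<longrightarrow> interior (element M k) \<inter> interior (element M v) = {}) \<and>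
     (\<forall>k\<in>elems M. inj (face M k) \<and> inj_on (emap M k) ref_triangle \<and>
        (\<forall>\<xi>\<in>ref_triangle. jac_det M k \<xi> \<noteq> 0)) \<and>
     dfacets M \<inter> nfacets M = {} \<and>
     (\<forall>k\<in>elems M. \<forall>\<gamma>\<in>facets M k. card (sharing M \<gamma>) \<le> 2 \<and>
        (card (sharing M \<gamma>) = 1 \<longleftrightarrow> \<gamma> \<in> dfacets M \<union> nfacets M)) \<and>
     (\<Union>k\<in>elems M. \<Union>\<gamma>\<in>facets M k \<inter> dfacets M. facet_curve M \<gamma> k) = \<Gamma>D \<and>
     (\<Union>k\<in>elems M. \<Union>\<gamma>\<in>facets M k \<inter> nfacets M. facet_curve M \<gamma> k) = \<Gamma>N \<and>
     (\<forall>k\<in>elems M. \<forall>\<gamma>\<in>ifacets M k. facet_curve M \<gamma> (nbr M \<gamma> k) = facet_curve M \<gamma> k) \<and>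
     (\<forall>k\<in>elems M. \<forall>\<gamma>\<in>facets M k. \<forall>j.
        xfacet M \<gamma> j = emap M k (local_node M \<gamma> k j) \<and>
        bweight M \<gamma> j = fweight (refel M) j *
          norm (frechet_derivative (emap M k) (at (local_node M \<gamma> k j))
            (ref_vertex (local_edge M \<gamma> k + 1) - ref_vertex (local_edge M \<gamma> k))) \<and>
        outward_unit_normal (element M k) (xfacet M \<gamma> j) (normal M \<gamma> k j)) \<and>
     (\<forall>k\<in>elems M. (\<forall>\<gamma>\<in>facets M k. alpha M \<gamma> k > 0) \<and> (\<Sum>\<gamma>\<in>facets M k. alpha M \<gamma> k) = 1)"

definition diagm :: "('n \<Rightarrow> real) \<Rightarrow> real^'n^'n" where
  "diagm d = (\<chi> i j. if i = j then d i else 0)"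

definition Hm :: "('k, 'g, 'np::finite, 'nf::finite) sbp_mesh \<Rightarrow> 'k \<Rightarrow> real^'np^'np" where
  "Hm M k = diagm (\<lambda>i. rweight (refel M) i * \<bar>jac_det M k (rnode (refel M) i)\<bar>)"

definition Bm :: "('k, 'g, 'np::finite, 'nf::finite) sbp_mesh \<Rightarrow> 'g \<Rightarrow> real^'nf^'nf" where
  "Bm M \<gamma> = diagm (bweight M \<gamma>)"

definition Nm :: "('k, 'g, 'np::finite, 'nf::finite) sbp_mesh \<Rightarrow> 'g \<Rightarrow> 'k \<Rightarrow> 2 \<Rightarrow> real^'nf^'nf" where
  "Nm M \<gamma> k a = diagm (\<lambda>j. normal M \<gamma> k j $ a)"

definition Rm :: "('k, 'g, 'np::finite, 'nf::finite) sbp_mesh \<Rightarrow> 'g \<Rightarrow> 'k \<Rightarrow> real^'np^'nf" where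
  "Rm M \<gamma> k = rextrap (refel M) (local_edge M \<gamma> k) (backwards M \<gamma> k)"

definition sbp_operators :: "('k, 'g, 'np::finite, 'nf::finite) sbp_mesh \<Rightarrow> bool" where
  "sbp_operators M \<longleftrightarrow> (\<forall>k\<in>elems M. \<forall>a.
     dmat M k a *v 1 = 0 \<and>
     Hm M k ** dmat M k a + transpose (Hm M k ** dmat M k a)
       = (\<Sum>\<gamma>\<in>facets M k. transpose (Rm M \<gamma> k) ** Bm M \<gamma> ** Nm M \<gamma> k a ** Rm M \<gamma> k))"

text \<open>
  The sums over \<open>a\<close> and \<open>b\<close> below are the products of the \<open>2 \<times> 2\<close> block matrices, multiplied out.
\<close>

definition Lamm :: "(real^2 \<Rightarrow> real^2^2) \<Rightarrow> ('k, 'g, 'np::finite, 'nf::finite) sbp_mesh \<Rightarrow>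
    'k \<Rightarrow> 2 \<Rightarrow> 2 \<Rightarrow> real^'np^'np" where
  "Lamm lam M k a b = diagm (\<lambda>i. lam (xnode M k i) $ a $ b)"

definition D2m :: "(real^2 \<Rightarrow> real^2^2) \<Rightarrow> ('k, 'g, 'np::finite, 'nf::finite) sbp_mesh \<Rightarrow>
    'k \<Rightarrow> real^'np^'np" where
  "D2m lam M k = (\<Sum>a\<in>UNIV. \<Sum>b\<in>UNIV. dmat M k a ** Lamm lam M k a b ** dmat M k b)"

definition Dgm :: "(real^2 \<Rightarrow> real^2^2) \<Rightarrow> ('k, 'g, 'np::finite, 'nf::finite) sbp_mesh \<Rightarrow>
    'g \<Rightarrow> 'k \<Rightarrow> real^'np^'nf" where
  "Dgm lam M \<gamma> k =
     (\<Sum>a\<in>UNIV. \<Sum>b\<in>UNIV. Nm M \<gamma> k a ** Rm M \<gamma> k ** Lamm lam M k a b ** dmat M k b)"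

definition Upsm :: "(real^2 \<Rightarrow> real^2^2) \<Rightarrow> ('k, 'g, 'np::finite, 'nf::finite) sbp_mesh \<Rightarrow>
    'g \<Rightarrow> 'g \<Rightarrow> 'k \<Rightarrow> real^'nf^'nf" where
  "Upsm lam M \<gamma> \<epsilon> k =
     (\<Sum>a\<in>UNIV. \<Sum>b\<in>UNIV. Nm M \<gamma> k a ** Rm M \<gamma> k ** matrix_inv (Hm M k) **
        Lamm lam M k a b ** transpose (Rm M \<epsilon> k) ** Nm M \<epsilon> k b)"

record ('k, 'g, 'nf) sat =
  T1 :: "'g \<Rightarrow> 'k \<Rightarrow> real^'nf::finite^'nf"
  T2 :: "'g \<Rightarrow> 'k \<Rightarrow> real^'nf^'nf"
  T3 :: "'g \<Rightarrow> 'k \<Rightarrow> real^'nf^'nf"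
  T4 :: "'g \<Rightarrow> 'k \<Rightarrow> real^'nf^'nf"
  T5 :: "'g \<Rightarrow> 'g \<Rightarrow> 'k \<Rightarrow> real^'nf^'nf"
  T6 :: "'g \<Rightarrow> 'g \<Rightarrow> 'k \<Rightarrow> real^'nf^'nf"
  TD :: "'g \<Rightarrow> 'k \<Rightarrow> real^'nf^'nf"

definition jump :: "('k, 'g, 'np::finite, 'nf::finite) sbp_mesh \<Rightarrow> ('k \<Rightarrow> real^'np) \<Rightarrow>
    'g \<Rightarrow> 'k \<Rightarrow> real^'nf" where
  "jump M u \<gamma> k = Rm M \<gamma> k *v u k - Rm M \<gamma> (nbr M \<gamma> k) *v u (nbr M \<gamma> k)"

definition sI :: "(real^2 \<Rightarrow> real^2^2) \<Rightarrow> ('k, 'g, 'np::finite, 'nf::finite) sbp_mesh \<Rightarrow>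
    ('k, 'g, 'nf) sat \<Rightarrow> ('k \<Rightarrow> real^'np) \<Rightarrow> 'k \<Rightarrow> real^'np" where
  "sI lam M T u k = (\<Sum>\<gamma>\<in>ifacets M k.
     let v = nbr M \<gamma> k;
         J = jump M u \<gamma> k;
         W = Dgm lam M \<gamma> k *v u k + Dgm lam M \<gamma> v *v u v
     in transpose (Rm M \<gamma> k) *v (T1 T \<gamma> k *v J + T3 T \<gamma> k *v W) +
        transpose (Dgm lam M \<gamma> k) *v (T2 T \<gamma> k *v J + T4 T \<gamma> k *v W) +
        (\<Sum>\<epsilon>\<in>ifacets M k - {\<gamma>}. transpose (Rm M \<gamma> k) *v (T5 T \<gamma> \<epsilon> k *v jump M u \<epsilon> k)) +
        (\<Sum>\<delta>\<in>ifacets M v - {\<gamma>}. transpose (Rm M \<gamma> k) *v (T6 T \<gamma> \<delta> v *v jump M u \<delta> v)))"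

definition sB :: "(real^2 \<Rightarrow> real^2^2) \<Rightarrow> ('k, 'g, 'np::finite, 'nf::finite) sbp_mesh \<Rightarrow>
    ('k, 'g, 'nf) sat \<Rightarrow> ('g \<Rightarrow> 'k \<Rightarrow> real^'nf) \<Rightarrow> ('g \<Rightarrow> 'k \<Rightarrow> real^'nf) \<Rightarrow>
    ('k \<Rightarrow> real^'np) \<Rightarrow> 'k \<Rightarrow> real^'np" where
  "sB lam M T ub wb u k =
     (\<Sum>\<gamma>\<in>facets M k \<inter> dfacets M.
        let J = Rm M \<gamma> k *v u k - ub \<gamma> k
        in transpose (Rm M \<gamma> k) *v (TD T \<gamma> k *v J) +
           transpose (Dgm lam M \<gamma> k) *v ((- Bm M \<gamma>) *v J)) +
     (\<Sum>\<gamma>\<in>facets M k \<inter> nfacets M.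
        transpose (Rm M \<gamma> k) *v (Bm M \<gamma> *v (Dgm lam M \<gamma> k *v u k - wb \<gamma> k)))"

definition sI_adj :: "(real^2 \<Rightarrow> real^2^2) \<Rightarrow> ('k, 'g, 'np::finite, 'nf::finite) sbp_mesh \<Rightarrow>
    ('k, 'g, 'nf) sat \<Rightarrow> ('k \<Rightarrow> real^'np) \<Rightarrow> 'k \<Rightarrow> real^'np" where
  "sI_adj lam M T \<psi> k = (\<Sum>\<gamma>\<in>ifacets M k.
     let v = nbr M \<gamma> k;
         Rk = Rm M \<gamma> k *v \<psi> k; Rv = Rm M \<gamma> v *v \<psi> v;
         Wk = Dgm lam M \<gamma> k *v \<psi> k; Wv = Dgm lam M \<gamma> v *v \<psi> v
     in transpose (Rm M \<gamma> k) *v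
          (T1 T \<gamma> k *v Rk + (- T1 T \<gamma> v) *v Rv + (T2 T \<gamma> k + Bm M \<gamma>) *v Wk + (- T2 T \<gamma> v) *v Wv) +
        transpose (Dgm lam M \<gamma> k) *v
          ((T3 T \<gamma> k - Bm M \<gamma>) *v Rk + T3 T \<gamma> v *v Rv + T4 T \<gamma> k *v Wk + T4 T \<gamma> v *v Wv) +
        (\<Sum>\<epsilon>\<in>ifacets M k - {\<gamma>}.
           let g = nbr M \<epsilon> k
           in transpose (Rm M \<gamma> k) *v
                (T5 T \<gamma> \<epsilon> k *v (Rm M \<epsilon> k *v \<psi> k) + T6 T \<gamma> \<epsilon> k *v (Rm M \<epsilon> g *v \<psi> g))) -
        (\<Sum>\<delta>\<in>ifacets M v - {\<gamma>}.
           let q = nbr M \<delta> v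
           in transpose (Rm M \<gamma> k) *v
                (T5 T \<gamma> \<delta> v *v (Rm M \<delta> v *v \<psi> v) + T6 T \<gamma> \<delta> v *v (Rm M \<delta> q *v \<psi> q))))"

definition rhs :: "(real^2 \<Rightarrow> real^2^2) \<Rightarrow> ('k, 'g, 'np::finite, 'nf::finite) sbp_mesh \<Rightarrow>
    ('k, 'g, 'nf) sat \<Rightarrow> ('k \<Rightarrow> real^'np) \<Rightarrow> ('g \<Rightarrow> 'k \<Rightarrow> real^'nf) \<Rightarrow> ('g \<Rightarrow> 'k \<Rightarrow> real^'nf) \<Rightarrow>
    ('k \<Rightarrow> real^'np) \<Rightarrow> 'k \<Rightarrow> real^'np" where
  "rhs lam M T f ub wb u k = D2m lam M k *v u k + f k
     - matrix_inv (Hm M k) *v sI lam M T u k - matrix_inv (Hm M k) *v sB lam M T ub wb u k"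

definition Lh :: "(real^2 \<Rightarrow> real^2^2) \<Rightarrow> ('k, 'g, 'np::finite, 'nf::finite) sbp_mesh \<Rightarrow>
    ('k, 'g, 'nf) sat \<Rightarrow> ('g \<Rightarrow> 'k \<Rightarrow> real^'nf) \<Rightarrow> ('g \<Rightarrow> 'k \<Rightarrow> real^'nf) \<Rightarrow>
    ('k \<Rightarrow> real^'np) \<Rightarrow> 'k \<Rightarrow> real^'np" where
  "Lh lam M T ub wb u k = - (D2m lam M k *v u k)
     + matrix_inv (Hm M k) *v sI lam M T u k + matrix_inv (Hm M k) *v sB lam M T ub wb u k"

definition Lh_adj :: "(real^2 \<Rightarrow> real^2^2) \<Rightarrow> ('k, 'g, 'np::finite, 'nf::finite) sbp_mesh \<Rightarrow>
    ('k, 'g, 'nf) sat \<Rightarrow> ('g \<Rightarrow> 'k \<Rightarrow> real^'nf) \<Rightarrow> ('g \<Rightarrow> 'k \<Rightarrow> real^'nf) \<Rightarrow>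
    ('k \<Rightarrow> real^'np) \<Rightarrow> 'k \<Rightarrow> real^'np" where
  "Lh_adj lam M T \<psi>b \<phi>b \<psi> k = - (D2m lam M k *v \<psi> k)
     + matrix_inv (Hm M k) *v sI_adj lam M T \<psi> k + matrix_inv (Hm M k) *v sB lam M T \<psi>b \<phi>b \<psi> k"

definition Hnorm :: "('k, 'g, 'np::finite, 'nf::finite) sbp_mesh \<Rightarrow> 'k \<Rightarrow> real^'np \<Rightarrow> real" where
  "Hnorm M k v = sqrt (v \<bullet> (Hm M k *v v))"

definition nodal :: "('k, 'g, 'np::finite, 'nf::finite) sbp_mesh \<Rightarrow> (real^2 \<Rightarrow> real) \<Rightarrow> 'k \<Rightarrow> real^'np" where
  "nodal M V k = (\<chi> i. V (xnode M k i))"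

definition facet_nodal :: "('k, 'g, 'np::finite, 'nf::finite) sbp_mesh \<Rightarrow> (real^2 \<Rightarrow> real) \<Rightarrow>
    'g \<Rightarrow> 'k \<Rightarrow> real^'nf" where
  "facet_nodal M V \<gamma> k = (\<chi> j. V (xfacet M \<gamma> j))"

definition facet_flux :: "(real^2 \<Rightarrow> real^2^2) \<Rightarrow> ('k, 'g, 'np::finite, 'nf::finite) sbp_mesh \<Rightarrow>
    (real^2 \<Rightarrow> real) \<Rightarrow> 'g \<Rightarrow> 'k \<Rightarrow> real^'nf" where
  "facet_flux lam M V \<gamma> k = (\<chi> j. normal M \<gamma> k j \<bullet> flux lam V (xfacet M \<gamma> j))"

definition energy_stable :: "(real^2 \<Rightarrow> real^2^2) \<Rightarrow> ('k, 'g, 'np::finite, 'nf::finite) sbp_mesh \<Rightarrow>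
    ('k, 'g, 'nf) sat \<Rightarrow> bool" where
  "energy_stable lam M T \<longleftrightarrow> (\<forall>u :: real \<Rightarrow> 'k \<Rightarrow> real^'np.
     (\<forall>t\<ge>0. \<forall>k\<in>elems M.
        ((\<lambda>s. u s k) has_vector_derivative
           rhs lam M T (\<lambda>_. 0) (\<lambda>_ _. 0) (\<lambda>_ _. 0) (u t) k) (at t within {0..})) \<longrightarrow>
     (\<forall>t\<ge>0. \<exists>E'\<le>0.
        ((\<lambda>s. \<Sum>k\<in>elems M. u s k \<bullet> (Hm M k *v u s k)) has_real_derivative E') (at t within {0..})))"

text \<open>
  The boundary-facet terms that may remain are the fluxes through boundary facets produced by the
  divergence operator and the boundary penalty terms.
\<close>

definition conservative :: "(real^2 \<Rightarrow> real^2^2) \<Rightarrow> ('k, 'g, 'np::finite, 'nf::finite) sbp_mesh \<Rightarrow>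
    ('k, 'g, 'nf) sat \<Rightarrow> bool" where
  "conservative lam M T \<longleftrightarrow> (\<forall>u ub wb.
     (\<Sum>k\<in>elems M. 1 \<bullet> (Hm M k *v rhs lam M T (\<lambda>_. 0) ub wb u k)) =
     (\<Sum>k\<in>elems M. (\<Sum>\<gamma>\<in>facets M k \<inter> (dfacets M \<union> nfacets M). 1 \<bullet> (Bm M \<gamma> *v (Dgm lam M \<gamma> k *v u k)))
        - 1 \<bullet> sB lam M T ub wb u k))"

text \<open>
  The sum of elementwise norms (not of their squares) runs over about \<open>h\<^sup>-\<^sup>2\<close> elements, each
  norm carrying a factor \<open>h\<close>; a pointwise residual of order \<open>p - 1\<close> thus gives a sum of order \<open>p - 2\<close>.
\<close>

definition consistent :: "(real^2) set \<Rightarrow> (real^2) set \<Rightarrow> (real^2) set \<Rightarrow> (real^2 \<Rightarrow> real^2^2) \<Rightarrow> nat \<Rightarrow>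
    (nat \<Rightarrow> ('k, 'g, 'np::finite, 'nf::finite) sbp_mesh) \<Rightarrow> (nat \<Rightarrow> ('k, 'g, 'nf) sat) \<Rightarrow> bool" where
  "consistent \<Omega> \<Gamma>D \<Gamma>N lam p M T \<longleftrightarrow> (\<forall>F Udir Uneu U.
     steady_solution \<Omega> \<Gamma>D \<Gamma>N lam F Udir Uneu U \<and> Ck (p + 1) U \<Omega> \<longrightarrow>
     (\<lambda>n. \<Sum>k\<in>elems (M n). Hnorm (M n) k
        (Lh lam (M n) (T n) (facet_nodal (M n) U) (facet_flux lam (M n) U) (nodal (M n) U) k
         - nodal (M n) F k)) \<longlonglongrightarrow> 0)"

definition adjoint_consistent :: "(real^2) set \<Rightarrow> (real^2) set \<Rightarrow> (real^2) set \<Rightarrow> (real^2 \<Rightarrow> real^2^2) \<Rightarrow> nat \<Rightarrow>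
    (nat \<Rightarrow> ('k, 'g, 'np::finite, 'nf::finite) sbp_mesh) \<Rightarrow> (nat \<Rightarrow> ('k, 'g, 'nf) sat) \<Rightarrow> bool" where
  "adjoint_consistent \<Omega> \<Gamma>D \<Gamma>N lam p M T \<longleftrightarrow> (\<forall>G \<psi>D \<psi>N \<psi>.
     steady_solution \<Omega> \<Gamma>D \<Gamma>N lam G \<psi>D \<psi>N \<psi> \<and> Ck (p + 1) \<psi> \<Omega> \<longrightarrow>
     (\<lambda>n. \<Sum>k\<in>elems (M n). Hnorm (M n) k
        (Lh_adj lam (M n) (T n) (facet_nodal (M n) \<psi>) (facet_flux lam (M n) \<psi>) (nodal (M n) \<psi>) k
         - nodal (M n) G k)) \<longlonglongrightarrow> 0)"

text \<open>
  The scaling hypotheses behind the limit \<open>h \<rightarrow> 0\<close>. The first two conditions are shape regularity and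
  quasi-uniformity of the curved triangles, the third is the natural scaling of a derivative matrix.
\<close>

definition regular_family :: "(nat \<Rightarrow> ('k, 'g, 'np::finite, 'nf::finite) sbp_mesh) \<Rightarrow> bool" where
  "regular_family M \<longleftrightarrow> (\<exists>c>0. \<exists>C. \<forall>n. \<forall>k\<in>elems (M n).
     (\<forall>a b. 1 \<le> a + b \<and> a + b \<le> pdeg (refel (M n)) + 1 \<longrightarrow>
        norm (mcoef (M n) k a b) \<le> C * mesh_size (M n) ^ (a + b)) \<and>
     (\<forall>\<xi>\<in>ref_triangle. c * (mesh_size (M n))\<^sup>2 \<le> \<bar>jac_det (M n) k \<xi>\<bar>) \<and>
     (\<forall>a i j. \<bar>dmat (M n) k a $ i $ j\<bar> \<le> C / mesh_size (M n)) \<and>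
     (\<forall>\<gamma>\<in>facets (M n) k. c \<le> alpha (M n) \<gamma> k))"

definition order_accurate :: "(real^2) set \<Rightarrow> nat \<Rightarrow>
    (nat \<Rightarrow> ('k, 'g, 'np::finite, 'nf::finite) sbp_mesh) \<Rightarrow> bool" where
  "order_accurate \<Omega> p M \<longleftrightarrow> (\<forall>V. Ck (p + 1) V \<Omega> \<longrightarrow>
     (\<exists>C. \<forall>n. \<forall>k\<in>elems (M n). \<forall>a i.
        \<bar>(dmat (M n) k a *v nodal (M n) V k) $ i - pd a V (xnode (M n) k i)\<bar> \<le> C * mesh_size (M n) ^ p))"

text \<open>
  \<open>BR1_scaled\<close> with all factors equal to 1 is the SAT of the first method of Bassi and Rebay; the
  factors rescale its facet-local, facet-to-facet and Dirichlet lifting terms.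
\<close>

definition BR1_scaled :: "(real^2 \<Rightarrow> real^2^2) \<Rightarrow> ('k, 'g, 'np::finite, 'nf::finite) sbp_mesh \<Rightarrow>
    ('g \<Rightarrow> 'k \<Rightarrow> real) \<Rightarrow> real \<Rightarrow> ('g \<Rightarrow> 'k \<Rightarrow> real) \<Rightarrow> ('k, 'g, 'nf) sat" where
  "BR1_scaled lam M \<sigma> \<tau> \<sigma>D = \<lparr>
     T1 = (\<lambda>\<gamma> k. (1/4) *\<^sub>R (Bm M \<gamma> ** (\<sigma> \<gamma> k *\<^sub>R Upsm lam M \<gamma> \<gamma> k +
                     \<sigma> \<gamma> (nbr M \<gamma> k) *\<^sub>R Upsm lam M \<gamma> \<gamma> (nbr M \<gamma> k)) ** Bm M \<gamma>)),
     T2 = (\<lambda>\<gamma> k. - ((1/2) *\<^sub>R Bm M \<gamma>)),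
     T3 = (\<lambda>\<gamma> k. (1/2) *\<^sub>R Bm M \<gamma>),
     T4 = (\<lambda>\<gamma> k. 0),
     T5 = (\<lambda>\<gamma> \<epsilon> k. (\<tau>/4) *\<^sub>R (Bm M \<gamma> ** Upsm lam M \<gamma> \<epsilon> k ** Bm M \<epsilon>)),
     T6 = (\<lambda>\<gamma> \<epsilon> k. - ((\<tau>/4) *\<^sub>R (Bm M \<gamma> ** Upsm lam M \<gamma> \<epsilon> k ** Bm M \<epsilon>))),
     TD = (\<lambda>\<gamma> k. \<sigma>D \<gamma> k *\<^sub>R (Bm M \<gamma> ** Upsm lam M \<gamma> \<gamma> k ** Bm M \<gamma>)) \<rparr>"

definition stabilized_BR1 :: "(real^2 \<Rightarrow> real^2^2) \<Rightarrow> ('k, 'g, 'np::finite, 'nf::finite) sbp_mesh \<Rightarrow>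
    ('k, 'g, 'nf) sat \<Rightarrow> bool" where
  "stabilized_BR1 lam M T \<longleftrightarrow>
     (\<exists>\<sigma> \<tau> \<sigma>D. \<tau> > 0 \<and> (\<forall>k\<in>elems M. \<forall>\<gamma>\<in>facets M k. \<sigma> \<gamma> k > 0 \<and> \<sigma>D \<gamma> k > 0) \<and>
        T = BR1_scaled lam M \<sigma> \<tau> \<sigma>D) \<and>
     energy_stable lam M T"

definition BR1_sat :: "(real^2 \<Rightarrow> real^2^2) \<Rightarrow> ('k, 'g, 'np::finite, 'nf::finite) sbp_mesh \<Rightarrow>
    ('k, 'g, 'nf) sat" where
  "BR1_sat lam M = \<lparr>
     T1 = (\<lambda>\<gamma> k. (1/2) *\<^sub>R (Bm M \<gamma> ** ((1 / alpha M \<gamma> k) *\<^sub>R Upsm lam M \<gamma> \<gamma> k +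
                     (1 / alpha M \<gamma> (nbr M \<gamma> k)) *\<^sub>R Upsm lam M \<gamma> \<gamma> (nbr M \<gamma> k)) ** Bm M \<gamma>)),
     T2 = (\<lambda>\<gamma> k. - ((1/2) *\<^sub>R Bm M \<gamma>)),
     T3 = (\<lambda>\<gamma> k. (1/2) *\<^sub>R Bm M \<gamma>),
     T4 = (\<lambda>\<gamma> k. 0),
     T5 = (\<lambda>\<gamma> \<epsilon> k. (1/16) *\<^sub>R (Bm M \<gamma> ** Upsm lam M \<gamma> \<epsilon> k ** Bm M \<epsilon>)),
     T6 = (\<lambda>\<gamma> \<epsilon> k. - ((1/16) *\<^sub>R (Bm M \<gamma> ** Upsm lam M \<gamma> \<epsilon> k ** Bm M \<epsilon>))),
     TD = (\<lambda>\<gamma> k. (1 / alpha M \<gamma> k) *\<^sub>R (Bm M \<gamma> ** Upsm lam M \<gamma> \<gamma> k ** Bm M \<gamma>)) \<rparr>"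

end

theory Submission
  imports Defs
begin

text \<open>
  Energy. With \<open>z \<gamma>\<close> the lifting of the jump on \<open>\<gamma>\<close> into the element and \<open>g\<close> the discrete gradient,
  the SBP property and a summation over both sides of every interior facet write the energy rate as
  a sum over elements of
  \<open>- |g|\<^sup>2 + \<Sum> \<langle>z \<gamma>, g\<rangle> + 2 \<Sum>\<^sub>D \<langle>z \<gamma>, g\<rangle> - 1/2 \<Sum> |z \<gamma>|\<^sup>2 / \<alpha> \<gamma> - \<Sum>\<^sub>D |z \<gamma>|\<^sup>2 / \<alpha> \<gamma> - 1/16 \<Sum> \<langle>z \<gamma>, z \<epsilon>\<rangle>\<close>,
  where \<open>\<langle>_, _\<rangle>\<close> is weighted by norm matrix and diffusion tensor, \<open>\<Sum>\<^sub>D\<close> runs over the Dirichlet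
  facets, and the last sum over pairs of distinct interior facets; since the \<open>\<alpha> \<gamma>\<close> sum to 1,
  completing squares facet by facet shows that it is nonpositive. Testing with constants instead
  gives conservation.

  Consistency. The residual is \<open>O(h\<^sup>2)\<close> at each node: jumps of the interpolant are \<open>O(h\<^sup>4)\<close> and flux
  errors \<open>O(h\<^sup>3)\<close>, as a Taylor polynomial of the solution, pulled back to the reference element, has
  coefficients of size \<open>h\<close> to the degree and extrapolation is exact up to degree \<open>p\<close>. Each element
  contributes a norm \<open>O(h\<^sup>3)\<close>, and comparing areas there are \<open>O(h\<^sup>-\<^sup>2)\<close> elements. The coefficients make
  the scheme self-adjoint, so adjoint consistency is consistency for the adjoint data.
\<close>

section \<open>The energy estimate and conservation\<close>

text \<open>The bound \<open>3 \<le> p\<close> comes from counting powers of h. The penalties are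
  O(1) and get divided by a norm matrix of size h^2, so jumps of order h^(p+1) leave a residual of
  order h^(p-1); a sum of norms over about h^-2 elements, each norm carrying one factor h, is only
  controlled if this exponent is at least 2. Two obstacles shape the error analysis. The flux is
  merely of class C^p, whereas order accuracy speaks of functions of class C^(p+1); so the outer
  derivative of the second derivative operator is estimated by a quadratic Taylor expansion of the
  flux, and accuracy is used only for coordinates and their products. Moreover, pulling a Taylor
  polynomial back by a map of degree p + 1 produces degrees beyond the exactness of the
  extrapolation; the excess monomials are harmless because of the powers of h in their coefficients,
  hence the bookkeeping with weighted polynomials. In the energy estimate, the terms with
  \<open>T6\<close> refer to the lifts of the neighbour. Only after crossing the facet do they
  combine with those of \<open>T5\<close> into a Gram matrix belonging to a single element.\<close>

lemma diagm_mv [simp]: "(diagm d *v x) $ i = d i * x $ i"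
  by (simp add: diagm_def matrix_vector_mult_def if_distrib[of "\<lambda>z. z * _"] cong: if_cong)

lemma transpose_diagm [simp]: "transpose (diagm d) = diagm d"
  by (auto simp: diagm_def transpose_def vec_eq_iff)

lemma inner_diagm: "x \<bullet> (diagm d *v y) = (diagm d *v x) \<bullet> y"
  by (simp add: inner_vec_def algebra_simps)

lemma vm_diagm [simp]: "x v* diagm d = diagm d *v x"
  using transpose_matrix_vector[of "diagm d" x] by simp

text \<open>\<open>matrix_inv\<close> chooses some two-sided inverse, so one has to be exhibited
  before anything is known about it; associativity then identifies the two.\<close>

lemma matrix_inv_diagm:
  assumes "\<And>i. d i \<noteq> 0"
  shows "matrix_inv (diagm d) = diagm (\<lambda>i. inverse (d i))"
proof -
  have 1: "diagm d ** diagm (\<lambda>i. inverse (d i)) = mat 1"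
    "diagm (\<lambda>i. inverse (d i)) ** diagm d = mat 1"
    using assms by (auto simp: diagm_def matrix_matrix_mult_def mat_def vec_eq_iff
        if_distrib[of "\<lambda>z. z * _"] cong: if_cong)
  then have "invertible (diagm d)" by (auto simp: invertible_def)
  then have "matrix_inv (diagm d) ** diagm d = mat 1"
    unfolding invertible_def matrix_inv_def by (rule someI2_ex) blast
  then show ?thesis
    by (metis 1(1) matrix_mul_assoc matrix_mul_lid matrix_mul_rid)
qed

lemma mv_sum_left: "sum A S *v x = (\<Sum>i\<in>S. A i *v x)"
  by (induction S rule: infinite_finite_induct) (auto simp: matrix_vector_mult_add_rdistrib)

lemma mv_sum_right: "(A :: real^'n^'m) *v sum f S = (\<Sum>i\<in>S. A *v f i)"
  by (induction S rule: infinite_finite_induct) (auto simp: matrix_vector_right_distrib)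

lemma mv_scaleR_left: "(c *\<^sub>R A) *v (x :: real^'n) = c *\<^sub>R (A *v x)"
  by (simp add: scaleR_matrix_vector_assoc)

lemma mv_minus_left: "(- A) *v (x :: real^'n) = - (A *v x)"
  by (simp add: matrix_vector_mult_def vec_eq_iff sum_negf)

lemma mv_minus_right: "A *v (- x :: real^'n) = - (A *v x)"
  by (simp add: matrix_vector_mult_def vec_eq_iff sum_negf)

lemma inner_mv: "x \<bullet> (A *v y) = (transpose A *v x) \<bullet> (y :: real^'n)"
  by (simp add: dot_lmul_matrix)

lemma mv_2: "((A :: real^2^2) *v x) $ a = A $ a $ 1 * x $ 1 + A $ a $ 2 * x $ 2"
  by (simp add: matrix_vector_mult_def sum_2)

section \<open>A single mesh: facets, neighbours and sums over both sides\<close>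

locale sbp_discretization =
  fixes \<Omega> \<Gamma>D \<Gamma>N :: "(real^2) set"
    and lam :: "real^2 \<Rightarrow> real^2^2"
    and M :: "('k, 'g, 'np::finite, 'nf::finite) sbp_mesh"
  assumes dom: "diffusion_domain \<Omega> \<Gamma>D \<Gamma>N lam"
    and ref: "valid_ref_element (refel M)"
    and mesh: "valid_mesh \<Omega> \<Gamma>D \<Gamma>N M"
    and ops: "sbp_operators M"
begin

lemma finite_elems: "finite (elems M)"
  using mesh by (simp add: valid_mesh_def)

lemma finite_facets [simp]: "finite (facets M k)"
  by (simp add: facets_def)

lemma finite_ifacets [simp]: "finite (ifacets M k)"
  by (simp add: ifacets_def)

lemma finite_sharing [simp]: "finite (sharing M \<gamma>)"
  using finite_elems by (simp add: sharing_def)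

lemma card_sharing: "k \<in> elems M \<Longrightarrow> \<gamma> \<in> facets M k \<Longrightarrow> card (sharing M \<gamma>) \<le> 2"
  using mesh by (simp add: valid_mesh_def)

lemma nbr_unique:
  assumes "k \<in> elems M" "\<gamma> \<in> facets M k" "v \<in> sharing M \<gamma>" "v \<noteq> k"
  shows "nbr M \<gamma> k = v"
  unfolding nbr_def
proof (rule the_equality)
  fix w assume w: "w \<in> sharing M \<gamma> \<and> w \<noteq> k"
  show "w = v"
  proof (rule ccontr)
    assume "w \<noteq> v"
    then have "card {k, v, w} = 3" using assms w by auto
    moreover have "{k, v, w} \<subseteq> sharing M \<gamma>" using assms w by (auto simp: sharing_def)
    ultimately have "3 \<le> card (sharing M \<gamma>)" by (metis card_mono finite_sharing)
    then show False using card_sharing[OF assms(1,2)] by simp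
  qed
qed (use assms in auto)

lemma nbr:
  assumes "k \<in> elems M" "\<gamma> \<in> ifacets M k"
  shows "nbr M \<gamma> k \<in> elems M" "nbr M \<gamma> k \<noteq> k" "\<gamma> \<in> ifacets M (nbr M \<gamma> k)"
    "nbr M \<gamma> (nbr M \<gamma> k) = k"
proof -
  obtain v where v: "v \<in> sharing M \<gamma>" "v \<noteq> k" and f: "\<gamma> \<in> facets M k"
    using assms(2) by (auto simp: ifacets_def)
  have n: "nbr M \<gamma> k = v" using nbr_unique[OF assms(1) f v] .
  have k: "k \<in> sharing M \<gamma>" using assms(1) f by (simp add: sharing_def)
  show "nbr M \<gamma> k \<in> elems M" "nbr M \<gamma> k \<noteq> k" using v n by (auto simp: sharing_def)
  show "\<gamma> \<in> ifacets M (nbr M \<gamma> k)" using v n k by (auto simp: sharing_def ifacets_def)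
  show "nbr M \<gamma> (nbr M \<gamma> k) = k"
    unfolding n by (rule nbr_unique) (use v k in \<open>auto simp: sharing_def\<close>)
qed

lemma ifacets_subset: "\<gamma> \<in> ifacets M k \<Longrightarrow> \<gamma> \<in> facets M k"
  by (simp add: ifacets_def)

text \<open>Crossing the facet is an involution on the pairs of an element and one of its interior
  facets. Reindexing by it moves a term to the other side, so facets need neither an orientation nor
  a sum of their own.\<close>

lemma sum_ifacets_swap:
  fixes F :: "'g \<Rightarrow> 'k \<Rightarrow> 'a::comm_monoid_add"
  shows "(\<Sum>k\<in>elems M. \<Sum>\<gamma>\<in>ifacets M k. F \<gamma> (nbr M \<gamma> k)) = (\<Sum>k\<in>elems M. \<Sum>\<gamma>\<in>ifacets M k. F \<gamma> k)"
proof -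
  let ?S = "Sigma (elems M) (ifacets M)"
  let ?i = "\<lambda>(k, \<gamma>). (nbr M \<gamma> k, \<gamma>)"
  have "(\<Sum>(k, \<gamma>)\<in>?S. F \<gamma> (nbr M \<gamma> k)) = (\<Sum>(k, \<gamma>)\<in>?S. F \<gamma> k)"
    by (rule sum.reindex_bij_witness[of _ ?i ?i]) (auto simp: nbr)
  then show ?thesis by (simp add: sum.Sigma finite_elems)
qed

lemma facets_split:
  assumes "k \<in> elems M"
  shows "facets M k = ifacets M k \<union> (facets M k \<inter> (dfacets M \<union> nfacets M))"
    "ifacets M k \<inter> (dfacets M \<union> nfacets M) = {}"
proof -
  have 1: "\<gamma> \<in> ifacets M k \<longleftrightarrow> \<gamma> \<notin> dfacets M \<union> nfacets M" if "\<gamma> \<in> facets M k" for \<gamma>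
  proof -
    have k: "k \<in> sharing M \<gamma>" using assms that by (simp add: sharing_def)
    have "card (sharing M \<gamma>) = 1 \<longleftrightarrow> \<gamma> \<in> dfacets M \<union> nfacets M"
      using mesh assms that by (simp add: valid_mesh_def)
    moreover have "card (sharing M \<gamma>) = 1 \<longleftrightarrow> \<gamma> \<notin> ifacets M k"
      using k that by (auto simp: ifacets_def card_1_singleton_iff)
    ultimately show ?thesis by blast
  qed
  show "facets M k = ifacets M k \<union> (facets M k \<inter> (dfacets M \<union> nfacets M))"
    "ifacets M k \<inter> (dfacets M \<union> nfacets M) = {}"
    using 1 ifacets_subset by auto
qed

lemma dn_disjoint: "dfacets M \<inter> nfacets M = {}"
  using mesh by (simp add: valid_mesh_def)

lemma sum_facets_split:
  fixes F :: "'g \<Rightarrow> 'a::comm_monoid_add"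
  assumes "k \<in> elems M"
  shows "sum F (facets M k) = sum F (ifacets M k) + sum F (facets M k \<inter> dfacets M)
    + sum F (facets M k \<inter> nfacets M)"
proof -
  have "sum F (facets M k \<inter> dfacets M) + sum F (facets M k \<inter> nfacets M)
    = sum F (facets M k \<inter> (dfacets M \<union> nfacets M))"
    using dn_disjoint by (subst sum.union_disjoint[symmetric]) (auto simp: Int_Un_distrib)
  moreover have "sum F (facets M k)
      = sum F (ifacets M k) + sum F (facets M k \<inter> (dfacets M \<union> nfacets M))"
    using facets_split[OF assms] by (subst facets_split(1)[OF assms], subst sum.union_disjoint) auto
  ultimately show ?thesis by (simp add: add.assoc)
qed

lemma alpha_pos: "k \<in> elems M \<Longrightarrow> \<gamma> \<in> facets M k \<Longrightarrow> alpha M \<gamma> k > 0"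
  using mesh by (simp add: valid_mesh_def)

lemma alpha_sum: "k \<in> elems M \<Longrightarrow> (\<Sum>\<gamma>\<in>facets M k. alpha M \<gamma> k) = 1"
  using mesh by (simp add: valid_mesh_def)

lemma rnode_in: "rnode (refel M) i \<in> ref_triangle"
  using ref by (simp add: valid_ref_element_def)

lemma xnode_in_element: "xnode M k i \<in> element M k"
  using rnode_in by (simp add: xnode_def element_def)

lemma element_subset: "k \<in> elems M \<Longrightarrow> element M k \<subseteq> \<Omega>"
  using mesh by (auto simp: valid_mesh_def)

section \<open>Discrete inner products and summation by parts\<close>

definition hw :: "'k \<Rightarrow> 'np \<Rightarrow> real" where
  "hw k i = rweight (refel M) i * \<bar>jac_det M k (rnode (refel M) i)\<bar>"

lemma hw_pos: "k \<in> elems M \<Longrightarrow> hw k i > 0"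
  using ref mesh rnode_in by (simp add: hw_def valid_mesh_def valid_ref_element_def)

lemma Hm_eq: "Hm M k = diagm (hw k)"
  by (simp add: Hm_def hw_def[abs_def])

lemma Hinv_eq: "k \<in> elems M \<Longrightarrow> matrix_inv (Hm M k) = diagm (\<lambda>i. inverse (hw k i))"
  unfolding Hm_eq by (rule matrix_inv_diagm) (metis hw_pos less_irrefl)

lemma H_Hinv [simp]:
  assumes "k \<in> elems M"
  shows "Hm M k *v (matrix_inv (Hm M k) *v x) = x"
  unfolding Hinv_eq[OF assms] unfolding Hm_eq
  using hw_pos[OF assms] by (simp add: vec_eq_iff less_imp_neq[THEN not_sym])

lemma inner_H: "x \<bullet> (Hm M k *v y) = (Hm M k *v x) \<bullet> y"
  by (simp add: Hm_eq inner_diagm)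

text \<open>Testing the matrix identity with two vectors turns it into integration by parts; the
  last sum is the facet quadrature of \<open>x\<close> times \<open>y\<close> times a component of
  the outward normal.\<close>

lemma sbp:
  assumes "k \<in> elems M"
  shows "x \<bullet> (Hm M k *v (dmat M k a *v y)) = - ((dmat M k a *v x) \<bullet> (Hm M k *v y))
    + (\<Sum>\<gamma>\<in>facets M k. (Rm M \<gamma> k *v x) \<bullet> (Bm M \<gamma> *v (Nm M \<gamma> k a *v (Rm M \<gamma> k *v y))))"
proof -
  have "Hm M k ** dmat M k a + transpose (Hm M k ** dmat M k a)
       = (\<Sum>\<gamma>\<in>facets M k. transpose (Rm M \<gamma> k) ** Bm M \<gamma> ** Nm M \<gamma> k a ** Rm M \<gamma> k)"
    using ops assms by (simp add: sbp_operators_def)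
  then have "x \<bullet> ((Hm M k ** dmat M k a + transpose (Hm M k ** dmat M k a)) *v y)
     = x \<bullet> ((\<Sum>\<gamma>\<in>facets M k. transpose (Rm M \<gamma> k) ** Bm M \<gamma> ** Nm M \<gamma> k a ** Rm M \<gamma> k) *v y)"
    by simp
  moreover have "x \<bullet> (transpose (Hm M k ** dmat M k a) *v y) = (dmat M k a *v x) \<bullet> (Hm M k *v y)"
    by (metis inner_H inner_mv matrix_vector_mul_assoc transpose_transpose)
  moreover have "x \<bullet> ((\<Sum>\<gamma>\<in>facets M k. transpose (Rm M \<gamma> k) ** Bm M \<gamma> ** Nm M \<gamma> k a ** Rm M \<gamma> k) *v y)
    = (\<Sum>\<gamma>\<in>facets M k. (Rm M \<gamma> k *v x) \<bullet> (Bm M \<gamma> *v (Nm M \<gamma> k a *v (Rm M \<gamma> k *v y))))"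
    by (simp add: mv_sum_left inner_sum_right matrix_vector_mul_assoc[symmetric] inner_mv[of x "transpose _"]
        del: transpose_matrix_vector)
  ultimately show ?thesis
    by (simp add: matrix_vector_mult_add_rdistrib inner_add_right matrix_vector_mul_assoc[symmetric]
        del: transpose_matrix_vector)
qed

text \<open>
  The inner product of discrete vector fields weighted by the norm matrix and the diffusion tensor;
  the matrices \<open>\<Upsilon>\<close> are Gram matrices for it (lemma \<open>ip_lift_lift\<close>).
\<close>

definition ip :: "'k \<Rightarrow> (2 \<Rightarrow> real^'np) \<Rightarrow> (2 \<Rightarrow> real^'np) \<Rightarrow> real" where
  "ip k x y = (\<Sum>a\<in>UNIV. \<Sum>b\<in>UNIV. (Hm M k *v x a) \<bullet> (Lamm lam M k a b *v y b))"

text \<open>Norm matrix and tensor blocks are diagonal, so the form decouples into one 2 by 2 form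
  per node; nonnegativity and symmetry of \<open>ip\<close> are then inherited from
  \<open>lam\<close> at the nodes.\<close>

lemma ip_nodewise:
  "ip k x y = (\<Sum>i\<in>UNIV. hw k i * ((\<chi> a. x a $ i) \<bullet> (lam (xnode M k i) *v (\<chi> b. y b $ i))))"
  by (simp add: ip_def Lamm_def Hm_eq inner_vec_def mv_2 sum_2 sum.distrib
      sum_distrib_left sum_distrib_right algebra_simps)

lemma lam_spd: "k \<in> elems M \<Longrightarrow> spd (lam (xnode M k i))"
  using dom element_subset[of k] xnode_in_element[of k i] by (auto simp: diffusion_domain_def)

lemma ip_nonneg:
  assumes "k \<in> elems M"
  shows "ip k x x \<ge> 0"
  unfolding ip_nodewise
proof (intro sum_nonneg mult_nonneg_nonneg)
  fix i
  show "0 \<le> hw k i" using hw_pos[OF assms] by (simp add: less_imp_le)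
  show "0 \<le> (\<chi> a. x a $ i) \<bullet> (lam (xnode M k i) *v (\<chi> b. x b $ i))"
    using lam_spd[OF assms, of i] by (cases "(\<chi> a. x a $ i) = 0") (auto simp: spd_def less_imp_le)
qed

lemma ip_commute:
  assumes "k \<in> elems M"
  shows "ip k x y = ip k y x"
  unfolding ip_nodewise
proof (intro sum.cong refl arg_cong2[of _ _ _ _ "(*)"])
  fix i
  have "transpose (lam (xnode M k i)) = lam (xnode M k i)" using lam_spd[OF assms] by (simp add: spd_def)
  then show "(\<chi> a. x a $ i) \<bullet> (lam (xnode M k i) *v (\<chi> b. y b $ i)) =
      (\<chi> a. y a $ i) \<bullet> (lam (xnode M k i) *v (\<chi> b. x b $ i))"
    by (metis inner_mv inner_commute)
qed

lemma ip_add_left: "ip k (\<lambda>a. x a + x' a) y = ip k x y + ip k x' y"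
  by (simp add: ip_def matrix_vector_right_distrib inner_add_left sum.distrib)

lemma ip_zero_left: "ip k (\<lambda>a. 0) y = 0"
  by (simp add: ip_def)

lemma ip_scale_left: "ip k (\<lambda>a. c *\<^sub>R x a) y = c * ip k x y"
  by (simp add: ip_def matrix_vector_mult_scaleR sum_distrib_left)

lemma ip_sum_left: "ip k (\<lambda>a. \<Sum>i\<in>S. f i a) y = (\<Sum>i\<in>S. ip k (f i) y)"
  by (induction S rule: infinite_finite_induct) (auto simp: ip_zero_left ip_add_left)

text \<open>Expand the square of \<open>z - c a g\<close> and divide by \<open>a\<close>. With the
  facet weight for \<open>a\<close>, each facet consumes a share of \<open>ip k g g\<close>
  proportional to its weight, and the weights of an element sum to 1.\<close>

lemma ip_Young:
  assumes k: "k \<in> elems M" and a: "a > 0"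
  shows "2 * c * ip k z g - ip k z z / a \<le> c\<^sup>2 * a * ip k g g"
proof -
  have "0 \<le> ip k (\<lambda>b. z b + (- (c * a)) *\<^sub>R g b) (\<lambda>b. z b + (- (c * a)) *\<^sub>R g b)"
    by (rule ip_nonneg[OF k])
  also have "\<dots> = ip k z z - 2 * c * a * ip k z g + (c * a)\<^sup>2 * ip k g g"
    unfolding ip_add_left ip_scale_left ip_commute[OF k, of _ "\<lambda>b. z b + _ b"]
    by (simp add: ip_add_left ip_scale_left ip_commute[OF k, of g z] power2_eq_square algebra_simps)
  finally have "0 \<le> (ip k z z - 2 * c * a * ip k z g + (c * a)\<^sup>2 * ip k g g) / a"
    using a by simp
  also have "\<dots> = ip k z z / a - 2 * c * ip k z g + c\<^sup>2 * a * ip k g g"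
    using a by (simp add: field_simps power2_eq_square)
  finally show ?thesis by simp
qed

text \<open>
  The scaling \<open>1/16\<close> of the facet-to-facet terms works since the off-diagonal part of the Gram
  matrix of the \<open>z \<gamma>\<close> is bounded below by minus its diagonal, and \<open>\<alpha> \<le> 1\<close>.
\<close>

lemma ip_dissipation:
  assumes k: "k \<in> elems M"
  shows "- ip k g g + (\<Sum>\<gamma>\<in>ifacets M k. ip k (z \<gamma>) g) + 2 * (\<Sum>\<gamma>\<in>facets M k \<inter> dfacets M. ip k (z \<gamma>) g)
    - 1/2 * (\<Sum>\<gamma>\<in>ifacets M k. ip k (z \<gamma>) (z \<gamma>) / alpha M \<gamma> k)
    - (\<Sum>\<gamma>\<in>facets M k \<inter> dfacets M. ip k (z \<gamma>) (z \<gamma>) / alpha M \<gamma> k)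
    - 1/16 * (\<Sum>\<gamma>\<in>ifacets M k. \<Sum>\<epsilon>\<in>ifacets M k - {\<gamma>}. ip k (z \<gamma>) (z \<epsilon>)) \<le> 0"
proof -
  let ?I = "ifacets M k" and ?D = "facets M k \<inter> dfacets M" and ?A = "\<lambda>\<gamma>. alpha M \<gamma> k"
  let ?zz = "\<lambda>\<gamma>. ip k (z \<gamma>) (z \<gamma>)" and ?zg = "\<lambda>\<gamma>. ip k (z \<gamma>) g" and ?gg = "ip k g g"
  have gg: "?gg \<ge> 0" and zz: "?zz \<gamma> \<ge> 0" for \<gamma> using ip_nonneg[OF k] by auto
  have pos: "?A \<gamma> > 0" if "\<gamma> \<in> facets M k" for \<gamma> using alpha_pos[OF k that] .
  have le1: "?A \<gamma> \<le> 1" if "\<gamma> \<in> facets M k" for \<gamma>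
    using member_le_sum[OF that, of ?A] pos alpha_sum[OF k] by (simp add: less_imp_le)
  \<comment> \<open>Half of the interior dissipation, 1/4 out of 1/2, is spent on the gradient; the
    other half is kept for the cross terms.\<close>
  have "(\<Sum>\<gamma>\<in>?I. ?zg \<gamma> - 1/4 * (?zz \<gamma> / ?A \<gamma>)) \<le> (\<Sum>\<gamma>\<in>?I. ?A \<gamma> * ?gg)"
  proof (rule sum_mono)
    fix \<gamma> assume "\<gamma> \<in> ?I"
    then have "?A \<gamma> > 0" using pos ifacets_subset by auto
    from ip_Young[OF k this, of 2 "z \<gamma>" g] show "?zg \<gamma> - 1/4 * (?zz \<gamma> / ?A \<gamma>) \<le> ?A \<gamma> * ?gg"
      by simp
  qed
  then have 1: "(\<Sum>\<gamma>\<in>?I. ?zg \<gamma>) - 1/4 * (\<Sum>\<gamma>\<in>?I. ?zz \<gamma> / ?A \<gamma>) \<le> (\<Sum>\<gamma>\<in>?I. ?A \<gamma>) * ?gg"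
    by (simp add: sum_subtractf sum_distrib_left sum_distrib_right)
  \<comment> \<open>On a Dirichlet facet the mixed term comes twice, and the undivided dissipation
    \<open>?zz \<gamma> / ?A \<gamma>\<close> is just enough for it.\<close>
  have "(\<Sum>\<gamma>\<in>?D. 2 * ?zg \<gamma> - ?zz \<gamma> / ?A \<gamma>) \<le> (\<Sum>\<gamma>\<in>?D. ?A \<gamma> * ?gg)"
  proof (rule sum_mono)
    fix \<gamma> assume "\<gamma> \<in> ?D"
    then have "?A \<gamma> > 0" using pos by auto
    from ip_Young[OF k this, of 1 "z \<gamma>" g] show "2 * ?zg \<gamma> - ?zz \<gamma> / ?A \<gamma> \<le> ?A \<gamma> * ?gg"
      by simp
  qed
  then have 2: "2 * (\<Sum>\<gamma>\<in>?D. ?zg \<gamma>) - (\<Sum>\<gamma>\<in>?D. ?zz \<gamma> / ?A \<gamma>) \<le> (\<Sum>\<gamma>\<in>?D. ?A \<gamma>) * ?gg"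
    by (simp add: sum_subtractf sum_distrib_left sum_distrib_right)
  have "sum ?A (facets M k \<inter> nfacets M) \<ge> 0"
    by (rule sum_nonneg) (use pos in \<open>auto simp: less_imp_le\<close>)
  then have "sum ?A ?I + sum ?A ?D \<le> 1"
    using sum_facets_split[OF k, of ?A] alpha_sum[OF k] by simp
  then have 3: "sum ?A ?I * ?gg + sum ?A ?D * ?gg \<le> ?gg"
    using mult_right_mono[OF _ gg, of _ 1] by (simp flip: distrib_right)
  have "0 \<le> ip k (\<lambda>a. \<Sum>\<gamma>\<in>?I. z \<gamma> a) (\<lambda>a. \<Sum>\<gamma>\<in>?I. z \<gamma> a)" by (rule ip_nonneg[OF k])
  also have "\<dots> = (\<Sum>\<gamma>\<in>?I. \<Sum>\<epsilon>\<in>?I. ip k (z \<gamma>) (z \<epsilon>))"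
    unfolding ip_sum_left
    by (subst (1 2) ip_commute[OF k]) (simp add: ip_sum_left)
  also have "\<dots> = (\<Sum>\<gamma>\<in>?I. ?zz \<gamma> + (\<Sum>\<epsilon>\<in>?I - {\<gamma>}. ip k (z \<gamma>) (z \<epsilon>)))"
    by (rule sum.cong) (auto intro: sum.remove)
  finally have 4: "0 \<le> (\<Sum>\<gamma>\<in>?I. ?zz \<gamma>) + (\<Sum>\<gamma>\<in>?I. \<Sum>\<epsilon>\<in>?I - {\<gamma>}. ip k (z \<gamma>) (z \<epsilon>))"
    by (simp add: sum.distrib)
  have "(\<Sum>\<gamma>\<in>?I. ?zz \<gamma>) \<le> (\<Sum>\<gamma>\<in>?I. ?zz \<gamma> / ?A \<gamma>)"
  proof (rule sum_mono)
    fix \<gamma> assume "\<gamma> \<in> ?I"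
    then have "\<gamma> \<in> facets M k" by (rule ifacets_subset)
    then show "?zz \<gamma> \<le> ?zz \<gamma> / ?A \<gamma>"
      using le1 pos zz[of \<gamma>] by (simp add: pos_le_divide_eq mult_left_le)
  qed
  moreover have "0 \<le> (\<Sum>\<gamma>\<in>?I. ?zz \<gamma>)" by (rule sum_nonneg) (rule zz)
  \<comment> \<open>The 1/4 kept back only has to cover 1/16 of the diagonal, so there is room to
    spare.\<close>
  ultimately show ?thesis using 1 2 3 4 by linarith
qed

section \<open>Lifting of facet data and the discrete Green identity\<close>

definition lift :: "'k \<Rightarrow> 'g \<Rightarrow> real^'nf \<Rightarrow> 2 \<Rightarrow> real^'np" where
  "lift k \<gamma> w b = matrix_inv (Hm M k) *v (transpose (Rm M \<gamma> k) *v (Nm M \<gamma> k b *v (Bm M \<gamma> *v w)))"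

lemma inner_N: "x \<bullet> (Nm M \<gamma> k a *v y) = (Nm M \<gamma> k a *v x) \<bullet> y"
  by (simp add: Nm_def inner_diagm)

lemma inner_B: "x \<bullet> (Bm M \<gamma> *v y) = (Bm M \<gamma> *v x) \<bullet> y"
  by (simp add: Bm_def inner_diagm)

text \<open>\<open>lift\<close> is the lifting operator of the Bassi-Rebay method: the inner product
  of its component \<open>b\<close> with a nodal vector under \<open>Hm\<close> is the facet
  quadrature of \<open>w\<close> times that vector times a normal component. Paired with the
  discrete gradient it yields the discrete normal flux, so facet terms of the energy become inner
  products on the element.\<close>

lemma ip_lift_grad:
  assumes "k \<in> elems M"
  shows "ip k (lift k \<gamma> w) (\<lambda>b. dmat M k b *v u) = (Bm M \<gamma> *v w) \<bullet> (Dgm lam M \<gamma> k *v u)"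
  unfolding ip_def lift_def Dgm_def H_Hinv[OF assms] mv_sum_left inner_sum_right
  by (simp add: matrix_vector_mul_assoc[symmetric] inner_N dot_lmul_matrix)

lemma ip_lift_lift:
  assumes "k \<in> elems M"
  shows "ip k (lift k \<gamma> w) (lift k \<epsilon> w') = w \<bullet> ((Bm M \<gamma> ** Upsm lam M \<gamma> \<epsilon> k ** Bm M \<epsilon>) *v w')"
proof -
  \<comment> \<open>Diagonal matrices commute; this brings the inverse norm matrix to the place it
    has in \<open>Upsm\<close>.\<close>
  have c: "Lamm lam M k a b *v (matrix_inv (Hm M k) *v x) = matrix_inv (Hm M k) *v (Lamm lam M k a b *v x)"
    for a b x unfolding Hinv_eq[OF assms] by (simp add: Lamm_def vec_eq_iff)
  show ?thesis
    unfolding ip_def lift_def Upsm_def H_Hinv[OF assms] matrix_vector_mul_assoc[symmetric] mv_sum_left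
      inner_B[of w] inner_sum_right c
    by (simp add: matrix_vector_mul_assoc[symmetric] inner_N dot_lmul_matrix)
qed

text \<open>Discrete Green identity: summation by parts applies to the outer derivative alone, with
  the discrete flux \<open>?y\<close> as its argument, and the normal components then assemble
  \<open>Dgm\<close>.\<close>

lemma inner_D2m:
  assumes k: "k \<in> elems M"
  shows "x \<bullet> (Hm M k *v (D2m lam M k *v u)) = - ip k (\<lambda>a. dmat M k a *v x) (\<lambda>b. dmat M k b *v u)
    + (\<Sum>\<gamma>\<in>facets M k. (Rm M \<gamma> k *v x) \<bullet> (Bm M \<gamma> *v (Dgm lam M \<gamma> k *v u)))"
proof -
  let ?y = "\<lambda>a. \<Sum>b\<in>UNIV. Lamm lam M k a b *v (dmat M k b *v u)"
  have "x \<bullet> (Hm M k *v (D2m lam M k *v u)) = (\<Sum>a\<in>UNIV. x \<bullet> (Hm M k *v (dmat M k a *v ?y a)))"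
    by (simp add: D2m_def mv_sum_left mv_sum_right inner_sum_right matrix_vector_mul_assoc[symmetric])
  also have "\<dots> = (\<Sum>a\<in>UNIV. - ((dmat M k a *v x) \<bullet> (Hm M k *v ?y a)))
     + (\<Sum>a\<in>UNIV. \<Sum>\<gamma>\<in>facets M k. (Rm M \<gamma> k *v x) \<bullet> (Bm M \<gamma> *v (Nm M \<gamma> k a *v (Rm M \<gamma> k *v ?y a))))"
    by (simp only: sbp[OF k] sum.distrib)
  also have "(\<Sum>a\<in>UNIV. - ((dmat M k a *v x) \<bullet> (Hm M k *v ?y a)))
      = - ip k (\<lambda>a. dmat M k a *v x) (\<lambda>b. dmat M k b *v u)"
    by (simp add: ip_def inner_H inner_sum_right sum_negf)
  also have "(\<Sum>a\<in>UNIV. \<Sum>\<gamma>\<in>facets M k. (Rm M \<gamma> k *v x) \<bullet> (Bm M \<gamma> *v (Nm M \<gamma> k a *v (Rm M \<gamma> k *v ?y a))))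
    = (\<Sum>\<gamma>\<in>facets M k. (Rm M \<gamma> k *v x) \<bullet> (Bm M \<gamma> *v (Dgm lam M \<gamma> k *v u)))"
    by (subst sum.swap)
      (simp add: Dgm_def mv_sum_left mv_sum_right inner_sum_right matrix_vector_mul_assoc[symmetric])
  finally show ?thesis .
qed

section \<open>Interior penalty terms as two-sided sums\<close>

definition cross_mat :: "'g \<Rightarrow> 'g \<Rightarrow> 'k \<Rightarrow> real^'nf^'nf" where
  "cross_mat \<gamma> \<epsilon> k = (1/16) *\<^sub>R (Bm M \<gamma> ** Upsm lam M \<gamma> \<epsilon> k ** Bm M \<epsilon>)"

lemma T_simps [simp]:
  "T2 (BR1_sat lam M) \<gamma> k = - ((1/2) *\<^sub>R Bm M \<gamma>)"
  "T3 (BR1_sat lam M) \<gamma> k = (1/2) *\<^sub>R Bm M \<gamma>"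
  "T4 (BR1_sat lam M) \<gamma> k = 0"
  "T5 (BR1_sat lam M) \<gamma> \<epsilon> k = cross_mat \<gamma> \<epsilon> k"
  "T6 (BR1_sat lam M) \<gamma> \<epsilon> k = - cross_mat \<gamma> \<epsilon> k"
  "TD (BR1_sat lam M) \<gamma> k = (1 / alpha M \<gamma> k) *\<^sub>R (Bm M \<gamma> ** Upsm lam M \<gamma> \<gamma> k ** Bm M \<gamma>)"
  by (simp_all add: BR1_sat_def cross_mat_def)

lemma T1_nbr:
  assumes "k \<in> elems M" "\<gamma> \<in> ifacets M k"
  shows "T1 (BR1_sat lam M) \<gamma> (nbr M \<gamma> k) = T1 (BR1_sat lam M) \<gamma> k"
  using nbr[OF assms] by (simp add: BR1_sat_def add.commute)

lemma jump_nbr: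
  assumes "k \<in> elems M" "\<gamma> \<in> ifacets M k"
  shows "jump M u \<gamma> (nbr M \<gamma> k) = - jump M u \<gamma> k"
  using nbr[OF assms] by (simp add: jump_def)

lemma sI_BR1:
  "sI lam M (BR1_sat lam M) u k = (\<Sum>\<gamma>\<in>ifacets M k.
     let v = nbr M \<gamma> k in
     transpose (Rm M \<gamma> k) *v (T1 (BR1_sat lam M) \<gamma> k *v jump M u \<gamma> k
       + (1/2) *\<^sub>R (Bm M \<gamma> *v (Dgm lam M \<gamma> k *v u k + Dgm lam M \<gamma> v *v u v)))
     - (1/2) *\<^sub>R (transpose (Dgm lam M \<gamma> k) *v (Bm M \<gamma> *v jump M u \<gamma> k))
     + (\<Sum>\<epsilon>\<in>ifacets M k - {\<gamma>}. transpose (Rm M \<gamma> k) *v (cross_mat \<gamma> \<epsilon> k *v jump M u \<epsilon> k))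
     - (\<Sum>\<delta>\<in>ifacets M v - {\<gamma>}. transpose (Rm M \<gamma> k) *v (cross_mat \<gamma> \<delta> v *v jump M u \<delta> v)))"
  unfolding sI_def Let_def
  by (intro sum.cong refl)
    (simp add: mv_scaleR_left mv_minus_left mv_minus_right sum_negf matrix_vector_mult_scaleR
      del: transpose_matrix_vector)

text \<open>Every interior facet is counted from both of its sides, so symmetrizing a summand by
  \<open>isum_swap\<close> costs a factor 1/2.\<close>

definition isum :: "('g \<Rightarrow> 'k \<Rightarrow> real) \<Rightarrow> real" where
  "isum F = (\<Sum>k\<in>elems M. \<Sum>\<gamma>\<in>ifacets M k. F \<gamma> k)"

lemma isum_add: "isum (\<lambda>\<gamma> k. F \<gamma> k + G \<gamma> k) = isum F + isum G"
  by (simp add: isum_def sum.distrib)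

lemma isum_diff: "isum (\<lambda>\<gamma> k. F \<gamma> k - G \<gamma> k) = isum F - isum G"
  by (simp add: isum_def sum_subtractf)

lemma isum_scale: "isum (\<lambda>\<gamma> k. c * F \<gamma> k) = c * isum F"
  by (simp add: isum_def sum_distrib_left)

lemma isum_swap: "isum (\<lambda>\<gamma> k. F \<gamma> (nbr M \<gamma> k)) = isum F"
  unfolding isum_def by (rule sum_ifacets_swap)

lemma isum_cong: "(\<And>\<gamma> k. k \<in> elems M \<Longrightarrow> \<gamma> \<in> ifacets M k \<Longrightarrow> F \<gamma> k = G \<gamma> k) \<Longrightarrow> isum F = isum G"
  by (simp add: isum_def)

lemma inner_sI_BR1:
  "(\<Sum>k\<in>elems M. x k \<bullet> sI lam M (BR1_sat lam M) u k) =
     1/2 * isum (\<lambda>\<gamma> k. jump M x \<gamma> k \<bullet> (T1 (BR1_sat lam M) \<gamma> k *v jump M u \<gamma> k))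
     + 1/2 * isum (\<lambda>\<gamma> k. (Rm M \<gamma> k *v x k) \<bullet>
         (Bm M \<gamma> *v (Dgm lam M \<gamma> k *v u k + Dgm lam M \<gamma> (nbr M \<gamma> k) *v u (nbr M \<gamma> k))))
     - 1/2 * isum (\<lambda>\<gamma> k. (Dgm lam M \<gamma> k *v x k) \<bullet> (Bm M \<gamma> *v jump M u \<gamma> k))
     + isum (\<lambda>\<gamma> k. \<Sum>\<epsilon>\<in>ifacets M k - {\<gamma>}. jump M x \<gamma> k \<bullet> (cross_mat \<gamma> \<epsilon> k *v jump M u \<epsilon> k))"
    (is "_ = 1/2 * isum ?T + 1/2 * isum ?W - 1/2 * isum ?V + isum ?P")
proof -
  define T where "T = T1 (BR1_sat lam M)"
  define F where "F \<gamma> k = (Rm M \<gamma> k *v x k) \<bullet> (T \<gamma> k *v jump M u \<gamma> k)" for \<gamma> k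
  define P where "P \<gamma> k = (\<Sum>\<epsilon>\<in>ifacets M k - {\<gamma>}.
      (Rm M \<gamma> k *v x k) \<bullet> (cross_mat \<gamma> \<epsilon> k *v jump M u \<epsilon> k))" for \<gamma> k
  \<comment> \<open>Indexed by the element whose matrix \<open>Upsm\<close> occurs in it, so that
    crossing the facet brings it next to \<open>P\<close>.\<close>
  define Q where "Q \<gamma> v = (\<Sum>\<delta>\<in>ifacets M v - {\<gamma>}.
      (Rm M \<gamma> (nbr M \<gamma> v) *v x (nbr M \<gamma> v)) \<bullet> (cross_mat \<gamma> \<delta> v *v jump M u \<delta> v))" for \<gamma> v
  have "(\<Sum>k\<in>elems M. x k \<bullet> sI lam M (BR1_sat lam M) u k)
     = isum (\<lambda>\<gamma> k. F \<gamma> k + 1/2 * ?W \<gamma> k - 1/2 * ?V \<gamma> k + P \<gamma> k - Q \<gamma> (nbr M \<gamma> k))"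
    unfolding isum_def sI_BR1 inner_sum_right
    by (intro sum.cong refl)
      (simp add: inner_sum_right Let_def F_def P_def Q_def T_def nbr inner_add_right
        inner_diff_right inner_mv[of _ "transpose _"] del: transpose_matrix_vector)
  also have "\<dots> = isum F + 1/2 * isum ?W - 1/2 * isum ?V + (isum P - isum Q)"
    unfolding isum_add isum_diff isum_scale isum_swap[of Q] by simp
  also have "isum F = 1/2 * isum (\<lambda>\<gamma> k. F \<gamma> k + F \<gamma> (nbr M \<gamma> k))"
    unfolding isum_add isum_swap[of F] by simp
  also have "isum (\<lambda>\<gamma> k. F \<gamma> k + F \<gamma> (nbr M \<gamma> k)) = isum ?T"
    by (rule isum_cong)
      (simp add: F_def jump_nbr T_def T1_nbr jump_def[of M x] mv_minus_right inner_diff_left)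
  also have "isum P - isum Q = isum ?P"
    unfolding isum_diff[symmetric]
    by (rule isum_cong)
      (simp add: P_def Q_def jump_def[of M x] inner_diff_left flip: sum_subtractf)
  finally show ?thesis .
qed

text \<open>The Green identity gives the own-side products \<open>A\<close>, the \<open>T3\<close>
  terms average \<open>A\<close> with the mixed products \<open>G\<close>, and the \<open>T2\<close>
  terms give half of \<open>A - G\<close> after crossing. What remains is \<open>A - G\<close>, that
  is, the jump paired with the flux of its own side, the form in which \<open>ip_lift_grad\<close>
  applies.\<close>

lemma facet_flux_exchange:
  "isum (\<lambda>\<gamma> k. (Rm M \<gamma> k *v u k) \<bullet> (Bm M \<gamma> *v (Dgm lam M \<gamma> k *v u k)))
     - 1/2 * isum (\<lambda>\<gamma> k. (Rm M \<gamma> k *v u k) \<bullet>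
         (Bm M \<gamma> *v (Dgm lam M \<gamma> k *v u k + Dgm lam M \<gamma> (nbr M \<gamma> k) *v u (nbr M \<gamma> k))))
     + 1/2 * isum (\<lambda>\<gamma> k. (Dgm lam M \<gamma> k *v u k) \<bullet> (Bm M \<gamma> *v jump M u \<gamma> k))
   = isum (\<lambda>\<gamma> k. (Bm M \<gamma> *v jump M u \<gamma> k) \<bullet> (Dgm lam M \<gamma> k *v u k))"
    (is "isum ?A - 1/2 * isum ?W + 1/2 * isum ?V = isum ?X")
proof -
  define G where "G \<gamma> k = (Rm M \<gamma> k *v u k) \<bullet>
    (Bm M \<gamma> *v (Dgm lam M \<gamma> (nbr M \<gamma> k) *v u (nbr M \<gamma> k)))" for \<gamma> k
  have "isum ?W = isum ?A + isum G"
    unfolding isum_add[symmetric]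
    by (rule isum_cong) (simp add: G_def matrix_vector_right_distrib inner_add_right)
  moreover have V: "?V \<gamma> k = ?X \<gamma> k" for \<gamma> k by (metis inner_B inner_commute)
  moreover have "isum ?X = isum (\<lambda>\<gamma> k. ?A \<gamma> k - G \<gamma> (nbr M \<gamma> k))"
    by (rule isum_cong)
      (simp add: G_def nbr jump_def matrix_vector_mult_diff_distrib inner_diff_left inner_B)
  ultimately show ?thesis unfolding V isum_diff isum_swap[of G] by (simp add: field_simps)
qed

section \<open>Energy stability\<close>

lemma energy_rate_le_0:
  "(\<Sum>k\<in>elems M. u k \<bullet> (Hm M k *v rhs lam M (BR1_sat lam M) (\<lambda>_. 0) (\<lambda>_ _. 0) (\<lambda>_ _. 0) u k)) \<le> 0"
proof -
  let ?T = "BR1_sat lam M"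
  define J where "J = jump M u"
  define g where "g k a = dmat M k a *v u k" for k a
  \<comment> \<open>With zero Dirichlet data the trace itself takes the role of the jump on a
    boundary facet.\<close>
  define z where "z k \<gamma> = lift k \<gamma> (if \<gamma> \<in> ifacets M k then J \<gamma> k else Rm M \<gamma> k *v u k)" for k \<gamma>
  define Y where "Y \<gamma> k = ip k (lift k \<gamma> (J \<gamma> k)) (lift k \<gamma> (J \<gamma> k)) / alpha M \<gamma> k" for \<gamma> k
  define A where "A \<gamma> k = (Rm M \<gamma> k *v u k) \<bullet> (Bm M \<gamma> *v (Dgm lam M \<gamma> k *v u k))" for \<gamma> k
  define X where "X \<gamma> k = (Bm M \<gamma> *v J \<gamma> k) \<bullet> (Dgm lam M \<gamma> k *v u k)" for \<gamma> k
  define P where "P \<gamma> k = (\<Sum>\<epsilon>\<in>ifacets M k - {\<gamma>}. J \<gamma> k \<bullet> (cross_mat \<gamma> \<epsilon> k *v J \<epsilon> k))" for \<gamma> k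
  have T1: "J \<gamma> k \<bullet> (T1 ?T \<gamma> k *v J \<gamma> k) = 1/2 * (Y \<gamma> k + Y \<gamma> (nbr M \<gamma> k))"
    if "k \<in> elems M" "\<gamma> \<in> ifacets M k" for k \<gamma>
    using nbr[OF that] that
    by (simp add: BR1_sat_def Y_def ip_lift_lift J_def jump_nbr mv_scaleR_left mv_minus_right
        matrix_vector_mult_scaleR matrix_vector_right_distrib matrix_vector_mult_add_rdistrib inner_add_right
        matrix_vector_mul_assoc[symmetric] add_divide_distrib)
  have "isum (\<lambda>\<gamma> k. J \<gamma> k \<bullet> (T1 ?T \<gamma> k *v J \<gamma> k)) = isum (\<lambda>\<gamma> k. 1/2 * (Y \<gamma> k + Y \<gamma> (nbr M \<gamma> k)))"
    by (rule isum_cong) (rule T1)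
  also have "\<dots> = isum Y" unfolding isum_scale isum_add isum_swap[of Y] by simp
  finally have sI: "(\<Sum>k\<in>elems M. u k \<bullet> sI lam M ?T u k) = 1/2 * isum Y + isum A - isum X + isum P"
    using facet_flux_exchange[of u] unfolding inner_sI_BR1 J_def A_def X_def P_def by linarith
  \<comment> \<open>The right-hand side is chosen so that its sum over all elements is exactly
    \<open>sI\<close>; the energy estimate thereby becomes local to an element.\<close>
  have k: "u k \<bullet> (Hm M k *v (D2m lam M k *v u k)) - u k \<bullet> sB lam M ?T (\<lambda>_ _. 0) (\<lambda>_ _. 0) u k
    \<le> (\<Sum>\<gamma>\<in>ifacets M k. 1/2 * Y \<gamma> k + A \<gamma> k - X \<gamma> k + P \<gamma> k)"
    if k: "k \<in> elems M" for k
  proof -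
    let ?D = "facets M k \<inter> dfacets M" and ?N = "facets M k \<inter> nfacets M"
    have zI: "z k \<gamma> = lift k \<gamma> (J \<gamma> k)" if "\<gamma> \<in> ifacets M k" for \<gamma> using that by (simp add: z_def)
    have zD: "z k \<gamma> = lift k \<gamma> (Rm M \<gamma> k *v u k)" if "\<gamma> \<in> dfacets M" for \<gamma>
      using that facets_split(2)[OF k] by (auto simp: z_def)
    have g: "g k = (\<lambda>b. dmat M k b *v u k)" by (simp add: g_def fun_eq_iff)
    have 1: "(\<Sum>\<gamma>\<in>ifacets M k. ip k (z k \<gamma>) (g k)) = (\<Sum>\<gamma>\<in>ifacets M k. X \<gamma> k)"
      unfolding g by (intro sum.cong refl) (simp add: zI ip_lift_grad[OF k] X_def)
    have 2: "(\<Sum>\<gamma>\<in>?D. ip k (z k \<gamma>) (g k)) = (\<Sum>\<gamma>\<in>?D. A \<gamma> k)"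
      unfolding g by (intro sum.cong refl) (simp add: zD ip_lift_grad[OF k] inner_B A_def)
    have 3: "1/2 * (\<Sum>\<gamma>\<in>ifacets M k. ip k (z k \<gamma>) (z k \<gamma>) / alpha M \<gamma> k) = (\<Sum>\<gamma>\<in>ifacets M k. 1/2 * Y \<gamma> k)"
      unfolding sum_distrib_left by (intro sum.cong refl) (simp add: zI Y_def)
    have 4: "1/16 * (\<Sum>\<gamma>\<in>ifacets M k. \<Sum>\<epsilon>\<in>ifacets M k - {\<gamma>}. ip k (z k \<gamma>) (z k \<epsilon>)) = (\<Sum>\<gamma>\<in>ifacets M k. P \<gamma> k)"
      unfolding sum_distrib_left P_def
      by (intro sum.cong refl) (simp add: zI ip_lift_lift[OF k] cross_mat_def mv_scaleR_left)
    have Asym: "A \<gamma> k = (Dgm lam M \<gamma> k *v u k) \<bullet> (Bm M \<gamma> *v (Rm M \<gamma> k *v u k))" for \<gamma>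
      unfolding A_def by (metis inner_B inner_commute)
    have D: "u k \<bullet> (transpose (Rm M \<gamma> k) *v (TD ?T \<gamma> k *v (Rm M \<gamma> k *v u k))
        + transpose (Dgm lam M \<gamma> k) *v (- Bm M \<gamma> *v (Rm M \<gamma> k *v u k)))
      = ip k (z k \<gamma>) (z k \<gamma>) / alpha M \<gamma> k - A \<gamma> k" if "\<gamma> \<in> ?D" for \<gamma>
      using that by (simp add: zD ip_lift_lift[OF k] mv_scaleR_left mv_minus_left mv_minus_right Asym
          inner_diff_right matrix_vector_mult_scaleR inner_mv[of _ "transpose _"] del: transpose_matrix_vector)
    \<comment> \<open>The Dirichlet terms double the boundary flux of the Green identity, whereas
      the Neumann terms cancel it.\<close>
    have 5: "u k \<bullet> sB lam M ?T (\<lambda>_ _. 0) (\<lambda>_ _. 0) u k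
      = (\<Sum>\<gamma>\<in>?D. ip k (z k \<gamma>) (z k \<gamma>) / alpha M \<gamma> k - A \<gamma> k) + (\<Sum>\<gamma>\<in>?N. A \<gamma> k)"
      unfolding sB_def Let_def diff_zero inner_add_right[of "u k" "sum _ _"] inner_sum_right
      by (intro arg_cong2[of _ _ _ _ "(+)"] sum.cong refl)
        (simp_all only: D, simp add: A_def inner_mv[of _ "transpose _"] del: transpose_matrix_vector)
    have 6: "u k \<bullet> (Hm M k *v (D2m lam M k *v u k))
      = - ip k (g k) (g k) + ((\<Sum>\<gamma>\<in>ifacets M k. A \<gamma> k) + (\<Sum>\<gamma>\<in>?D. A \<gamma> k) + (\<Sum>\<gamma>\<in>?N. A \<gamma> k))"
      unfolding inner_D2m[OF k] g A_def[symmetric] sum_facets_split[OF k] by simp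
    show ?thesis
      using ip_dissipation[OF k, of "g k" "z k"]
      unfolding 1 2 3 4 5 6 sum_subtractf sum.distrib by linarith
  qed
  have "(\<Sum>k\<in>elems M. u k \<bullet> (Hm M k *v rhs lam M ?T (\<lambda>_. 0) (\<lambda>_ _. 0) (\<lambda>_ _. 0) u k))
    = (\<Sum>k\<in>elems M. u k \<bullet> (Hm M k *v (D2m lam M k *v u k)) - u k \<bullet> sB lam M ?T (\<lambda>_ _. 0) (\<lambda>_ _. 0) u k)
      - (\<Sum>k\<in>elems M. u k \<bullet> sI lam M ?T u k)"
    unfolding sum_subtractf[symmetric]
    by (intro sum.cong refl)
      (simp add: rhs_def matrix_vector_mult_diff_distrib inner_diff_right)
  also have "\<dots> \<le> isum (\<lambda>\<gamma> k. 1/2 * Y \<gamma> k + A \<gamma> k - X \<gamma> k + P \<gamma> k) - (\<Sum>k\<in>elems M. u k \<bullet> sI lam M ?T u k)"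
    unfolding isum_def using sum_mono[OF k] by (rule diff_right_mono)
  also have "\<dots> = 0" unfolding sI isum_add isum_diff isum_scale by simp
  finally show ?thesis .
qed

lemma energy_stable_BR1: "energy_stable lam M (BR1_sat lam M)"
  unfolding energy_stable_def
proof (intro allI impI)
  let ?R = "rhs lam M (BR1_sat lam M) (\<lambda>_. 0) (\<lambda>_ _. 0) (\<lambda>_ _. 0)"
  fix u :: "real \<Rightarrow> 'k \<Rightarrow> real^'np" and t :: real
  assume u: "\<forall>t\<ge>0. \<forall>k\<in>elems M. ((\<lambda>s. u s k) has_vector_derivative ?R (u t) k) (at t within {0..})"
    and t: "t \<ge> 0"
  have "((\<lambda>s. \<Sum>k\<in>elems M. u s k \<bullet> (Hm M k *v u s k)) has_real_derivative
     (\<Sum>k\<in>elems M. 2 * (u t k \<bullet> (Hm M k *v ?R (u t) k)))) (at t within {0..})"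
  proof (rule DERIV_sum)
    fix k assume "k \<in> elems M"
    then have d: "((\<lambda>s. u s k) has_vector_derivative ?R (u t) k) (at t within {0..})"
      using u t by blast
    have "((\<lambda>s. Hm M k *v u s k) has_vector_derivative Hm M k *v ?R (u t) k) (at t within {0..})"
      by (rule bounded_linear.has_vector_derivative[OF _ d]) simp
    from bounded_bilinear.has_vector_derivative[OF bounded_bilinear_inner d this]
    have "((\<lambda>s. u s k \<bullet> (Hm M k *v u s k)) has_vector_derivative
       (u t k \<bullet> (Hm M k *v ?R (u t) k) + ?R (u t) k \<bullet> (Hm M k *v u t k))) (at t within {0..})" .
    moreover have "?R (u t) k \<bullet> (Hm M k *v u t k) = u t k \<bullet> (Hm M k *v ?R (u t) k)"
      by (metis inner_H inner_commute)
    ultimately show "((\<lambda>s. u s k \<bullet> (Hm M k *v u s k)) has_real_derivative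
       2 * (u t k \<bullet> (Hm M k *v ?R (u t) k))) (at t within {0..})"
      by (simp add: has_real_derivative_iff_has_vector_derivative)
  qed
  moreover have "(\<Sum>k\<in>elems M. 2 * (u t k \<bullet> (Hm M k *v ?R (u t) k))) \<le> 0"
    using energy_rate_le_0[of "u t"] by (simp flip: sum_distrib_left)
  ultimately show "\<exists>E'\<le>0. ((\<lambda>s. \<Sum>k\<in>elems M. u s k \<bullet> (Hm M k *v u s k)) has_real_derivative E')
     (at t within {0..})" by blast
qed

lemma stabilized_BR1_sat: "stabilized_BR1 lam M (BR1_sat lam M)"
  unfolding stabilized_BR1_def
proof (intro conjI exI)
  \<comment> \<open>The unscaled factors are 1/4, 1/4 and 1; reaching 1/2 with weight
    \<open>1 / \<alpha>\<close>, then 1/16, then \<open>1 / \<alpha>\<close>, determines the three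
    scalings.\<close>
  show "BR1_sat lam M = BR1_scaled lam M (\<lambda>\<gamma> k. 2 / alpha M \<gamma> k) (1/4) (\<lambda>\<gamma> k. 1 / alpha M \<gamma> k)"
  proof -
    have "(1/2) *\<^sub>R (A ** ((1 / a) *\<^sub>R X + (1 / b) *\<^sub>R Y) ** A)
        = (1/4) *\<^sub>R (A ** ((2 / a) *\<^sub>R X + (2 / b) *\<^sub>R Y) ** A)"
      for A X Y :: "real^'nf^'nf" and a b :: real
      by (simp add: vec_eq_iff matrix_matrix_mult_def sum_distrib_left sum_distrib_right
          algebra_simps)
    then show ?thesis by (simp add: BR1_sat_def BR1_scaled_def)
  qed
qed (use alpha_pos energy_stable_BR1 in auto)

section \<open>Exactness on monomials, and conservation\<close>

lemma poly2_indicator: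
  assumes "a + b \<le> d"
  shows "poly2 d (\<lambda>a' b'. if a' = a \<and> b' = b then 1 else 0) \<xi> = (\<xi> $ 1) ^ a * (\<xi> $ 2) ^ b"
proof -
  have "poly2 d (\<lambda>a' b'. if a' = a \<and> b' = b then 1 else 0) \<xi>
     = (\<Sum>a'\<le>d. if a' = a then (\<Sum>b'\<le>d - a. if b' = b then (\<xi> $ 1) ^ a * (\<xi> $ 2) ^ b else 0) else 0)"
    unfolding poly2_def
    by (intro sum.cong refl) (simp add: if_distrib[of "\<lambda>z. _ * z"] cong: if_cong)
  also have "\<dots> = (\<xi> $ 1) ^ a * (\<xi> $ 2) ^ b" using assms by simp
  finally show ?thesis .
qed

lemma Rm_monomial:
  assumes "a + b \<le> pdeg (refel M)"
  shows "(Rm M \<gamma> k *v (\<chi> l. (rnode (refel M) l $ 1) ^ a * (rnode (refel M) l $ 2) ^ b)) $ j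
    = (local_node M \<gamma> k j $ 1) ^ a * (local_node M \<gamma> k j $ 2) ^ b"
proof -
  have "(rextrap (refel M) i r *v (\<chi> l. poly2 (pdeg (refel M)) c (rnode (refel M) l))) $ j
          = poly2 (pdeg (refel M)) c (ref_facet_node (refel M) i r j)" for c :: "nat \<Rightarrow> nat \<Rightarrow> real" and i r
    using ref by (simp add: valid_ref_element_def)
  from this[where c = "\<lambda>a' b'. if a' = a \<and> b' = b then 1 else 0"] show ?thesis
    by (simp add: Rm_def local_node_def poly2_indicator[OF assms])
qed

lemma Rm_one: "Rm M \<gamma> k *v 1 = 1"
  using Rm_monomial[of 0 0 \<gamma> k] by (simp add: vec_eq_iff one_vec_def)

lemma dmat_one: "k \<in> elems M \<Longrightarrow> dmat M k a *v 1 = 0"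
  using ops by (simp add: sbp_operators_def)

text \<open>A constant has no jumps and no discrete flux, so of all interior terms only the averaged
  flux with \<open>T3\<close> is left. Summed over both sides it equals the interior facet part of
  the Green identity and cancels it.\<close>

lemma conservative_BR1: "conservative lam M (BR1_sat lam M)"
  unfolding conservative_def
proof (intro allI)
  let ?T = "BR1_sat lam M"
  fix u :: "'k \<Rightarrow> real^'np" and ub wb :: "'g \<Rightarrow> 'k \<Rightarrow> real^'nf"
  define G where "G \<gamma> k = 1 \<bullet> (Bm M \<gamma> *v (Dgm lam M \<gamma> k *v u k))" for \<gamma> k
  have D1: "Dgm lam M \<gamma> k *v 1 = 0" if "k \<in> elems M" for \<gamma> k
    using that by (simp add: Dgm_def mv_sum_left matrix_vector_mul_assoc[symmetric] dmat_one)
  have J1: "jump M (\<lambda>_. 1) \<gamma> k = 0" for \<gamma> k by (simp add: jump_def Rm_one)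
  have "(\<Sum>k\<in>elems M. 1 \<bullet> sI lam M ?T u k) = 1/2 * isum (\<lambda>\<gamma> k. G \<gamma> k + G \<gamma> (nbr M \<gamma> k))
      - 1/2 * isum (\<lambda>\<gamma> k. (Dgm lam M \<gamma> k *v 1) \<bullet> (Bm M \<gamma> *v jump M u \<gamma> k))"
    unfolding inner_sI_BR1[of "\<lambda>_. 1"] J1 Rm_one
    by (simp add: G_def matrix_vector_right_distrib inner_add_right) (simp add: isum_def)
  also have "isum (\<lambda>\<gamma> k. (Dgm lam M \<gamma> k *v 1) \<bullet> (Bm M \<gamma> *v jump M u \<gamma> k)) = 0"
    by (simp add: isum_def D1)
  finally have sI: "(\<Sum>k\<in>elems M. 1 \<bullet> sI lam M ?T u k) = isum G"
    unfolding isum_add isum_swap[of G] by simp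
  have k: "1 \<bullet> (Hm M k *v (D2m lam M k *v u k))
     = (\<Sum>\<gamma>\<in>ifacets M k. G \<gamma> k) + (\<Sum>\<gamma>\<in>facets M k \<inter> (dfacets M \<union> nfacets M). G \<gamma> k)"
    if k: "k \<in> elems M" for k
  proof -
    have "1 \<bullet> (Hm M k *v (D2m lam M k *v u k)) = (\<Sum>\<gamma>\<in>facets M k. G \<gamma> k)"
      by (simp add: inner_D2m[OF k] dmat_one[OF k] ip_zero_left Rm_one G_def)
    also have "\<dots> = (\<Sum>\<gamma>\<in>ifacets M k \<union> facets M k \<inter> (dfacets M \<union> nfacets M). G \<gamma> k)"
      using facets_split(1)[OF k] by simp
    also have "\<dots> = (\<Sum>\<gamma>\<in>ifacets M k. G \<gamma> k) + (\<Sum>\<gamma>\<in>facets M k \<inter> (dfacets M \<union> nfacets M). G \<gamma> k)"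
      using facets_split(2)[OF k] by (intro sum.union_disjoint) auto
    finally show ?thesis .
  qed
  have "(\<Sum>k\<in>elems M. 1 \<bullet> (Hm M k *v rhs lam M ?T (\<lambda>_. 0) ub wb u k))
    = (\<Sum>k\<in>elems M. 1 \<bullet> (Hm M k *v (D2m lam M k *v u k)) - 1 \<bullet> sB lam M ?T ub wb u k)
      - (\<Sum>k\<in>elems M. 1 \<bullet> sI lam M ?T u k)"
    unfolding sum_subtractf[symmetric]
    by (intro sum.cong refl)
      (simp add: rhs_def matrix_vector_mult_diff_distrib inner_diff_right)
  also have "\<dots> = (\<Sum>k\<in>elems M. (\<Sum>\<gamma>\<in>facets M k \<inter> (dfacets M \<union> nfacets M). G \<gamma> k) - 1 \<bullet> sB lam M ?T ub wb u k)"
    unfolding sI by (simp add: k isum_def sum.distrib sum_subtractf)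
  finally show "(\<Sum>k\<in>elems M. 1 \<bullet> (Hm M k *v rhs lam M ?T (\<lambda>_. 0) ub wb u k))
    = (\<Sum>k\<in>elems M. (\<Sum>\<gamma>\<in>facets M k \<inter> (dfacets M \<union> nfacets M). 1 \<bullet> (Bm M \<gamma> *v (Dgm lam M \<gamma> k *v u k)))
       - 1 \<bullet> sB lam M ?T ub wb u k)"
    by (simp add: G_def)
qed

end

section \<open>Taylor polynomials on the reference element\<close>

lemma Ck_on_cong:
  assumes "open S" "\<And>x. x \<in> S \<Longrightarrow> f x = g x" "Ck_on m f S"
  shows "Ck_on m g S"
  using assms(2,3)
proof (induction m arbitrary: f g)
  case 0
  then show ?case by (auto cong: continuous_on_cong)
next
  case (Suc m)
  have d: "g differentiable (at x)" if "x \<in> S" for x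
  proof -
    have "f differentiable (at x)" using Suc.prems that by simp
    then obtain f' where "(f has_derivative f') (at x)" by (auto simp: differentiable_def)
    \<comment> \<open>Openness enters here: a derivative at \<open>x\<close> depends on the values
      all around \<open>x\<close>, not only on those in \<open>S\<close>.\<close>
    then have "(g has_derivative f') (at x)"
      by (rule has_derivative_transform_within_open[OF _ assms(1) that]) (rule Suc.prems(1))
    then show ?thesis by (rule differentiableI)
  qed
  have e: "pd a f x = pd a g x" if "x \<in> S" for x a
    unfolding pd_def
    by (subst frechet_derivative_transform_within_open[OF _ assms(1) that]) (use Suc.prems that in auto)
  show ?case using Suc.prems d Suc.IH[OF e] by auto
qed

lemma Ck_on_SucD: "Ck_on (Suc m) f S \<Longrightarrow> Ck_on m f S"
proof (induction m arbitrary: f)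
  case 0
  then show ?case
    by (auto intro!: continuous_at_imp_continuous_on differentiable_imp_continuous_within)
next
  case (Suc m)
  then show ?case by simp
qed

lemma Ck_on_le: "Ck_on n f S \<Longrightarrow> m \<le> n \<Longrightarrow> Ck_on m f S"
  by (induction n) (metis le_SucE Ck_on_SucD le_0_eq)+

lemma Ck_on_subset: "Ck_on m f S \<Longrightarrow> S' \<subseteq> S \<Longrightarrow> Ck_on m f S'"
  by (induction m arbitrary: f) (auto intro: continuous_on_subset)

lemma pd_unique: "(f has_derivative f') (at x) \<Longrightarrow> pd a f x = f' (axis a 1)"
  unfolding pd_def by (metis frechet_derivative_at)

lemma pd_mult:
  assumes "f differentiable (at x)" "g differentiable (at x)"
  shows "pd a (\<lambda>x. f x * g x) x = f x * pd a g x + pd a f x * g x"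
  by (subst pd_unique[OF has_derivative_mult[OF assms[unfolded frechet_derivative_works]]])
    (simp add: pd_def)

lemma pd_add:
  assumes "f differentiable (at x)" "g differentiable (at x)"
  shows "pd a (\<lambda>x. f x + g x) x = pd a f x + pd a g x"
  by (subst pd_unique[OF has_derivative_add[OF assms[unfolded frechet_derivative_works]]])
    (simp add: pd_def)

lemma pd_const: "pd a (\<lambda>x. c) = (\<lambda>x. 0)"
  using pd_unique[OF has_derivative_const] by fastforce

lemma pd_coord: "pd a (\<lambda>x. x $ b) = (\<lambda>x. if a = b then 1 else 0)"
proof
  fix x :: "real^2"
  have "((\<lambda>x. x $ b) has_derivative (\<lambda>x. x $ b)) (at x)"
    by (rule bounded_linear.has_derivative[OF bounded_linear_vec_nth has_derivative_ident])
  from pd_unique[OF this, of a] show "pd a (\<lambda>x. x $ b) x = (if a = b then 1 else 0)"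
    by (auto simp: axis_def)
qed

lemma Ck_on_add:
  assumes "open S" "Ck_on m f S" "Ck_on m g S"
  shows "Ck_on m (\<lambda>x. f x + g x) S"
  using assms(2,3)
proof (induction m arbitrary: f g)
  case 0
  then show ?case by (simp add: continuous_on_add)
next
  case (Suc m)
  have "Ck_on m (pd a (\<lambda>x. f x + g x)) S" for a
    by (rule Ck_on_cong[OF assms(1), where f = "\<lambda>x. pd a f x + pd a g x"])
      (use Suc in \<open>simp_all add: pd_add\<close>)
  then show ?case using Suc.prems by simp
qed

lemma Ck_on_mult:
  assumes "open S" "Ck_on m f S" "Ck_on m g S"
  shows "Ck_on m (\<lambda>x. f x * g x) S"
  using assms(2,3)
proof (induction m arbitrary: f g)
  case 0
  then show ?case by (simp add: continuous_on_mult)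
next
  case (Suc m)
  have "Ck_on m (pd a (\<lambda>x. f x * g x)) S" for a
  proof (rule Ck_on_cong[OF assms(1)])
    show "Ck_on m (\<lambda>x. f x * pd a g x + pd a f x * g x) S"
      by (intro Ck_on_add[OF assms(1)] Suc.IH) (use Suc.prems Ck_on_SucD in auto)
  qed (use Suc.prems in \<open>simp add: pd_mult\<close>)
  then show ?case using Suc.prems by simp
qed

lemma Ck_on_const: "Ck_on m (\<lambda>x. c) S"
  by (induction m arbitrary: c) (simp_all add: pd_const)

lemma Ck_on_coord: "Ck_on m (\<lambda>x. x $ b) S"
  by (cases m) (auto simp: pd_coord Ck_on_const intro!: continuous_intros linear_imp_differentiable
      bounded_linear.linear[OF bounded_linear_vec_nth])

section \<open>Taylor's formula along segments\<close>

primrec dird :: "nat \<Rightarrow> real^2 \<Rightarrow> (real^2 \<Rightarrow> real) \<Rightarrow> real^2 \<Rightarrow> real" where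
  "dird 0 w V x = V x"
| "dird (Suc m) w V x = (\<Sum>a\<in>UNIV. w $ a * dird m w (pd a V) x)"

text \<open>\<open>dird m w V\<close> is the form (w . grad)^m V, written with partial derivatives
  so that it is visibly a polynomial in \<open>w\<close>. The recursion differentiates
  \<open>V\<close> first, hence an induction over all \<open>V\<close>.\<close>

lemma dird_has_derivative:
  assumes "Ck_on (Suc m) V S" "x0 + t *\<^sub>R w \<in> S"
  shows "((\<lambda>t. dird m w V (x0 + t *\<^sub>R w)) has_real_derivative dird (Suc m) w V (x0 + t *\<^sub>R w)) (at t)"
  using assms(1)
proof (induction m arbitrary: V)
  case 0
  let ?y = "x0 + t *\<^sub>R w"
  have d: "(V has_derivative frechet_derivative V (at ?y)) (at ?y)"
    using 0 assms(2) by (simp flip: frechet_derivative_works)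
  have "((\<lambda>t. x0 + t *\<^sub>R w) has_vector_derivative w) (at t)"
    by (auto intro!: derivative_eq_intros)
  from vector_derivative_diff_chain_within[OF this has_derivative_at_withinI[OF d]]
  have "((\<lambda>t. V (x0 + t *\<^sub>R w)) has_vector_derivative frechet_derivative V (at ?y) w) (at t)"
    by (simp add: o_def)
  moreover have "frechet_derivative V (at ?y) w = (\<Sum>a\<in>UNIV. w $ a * pd a V ?y)"
  proof -
    have l: "linear (frechet_derivative V (at ?y))"
      using d by (rule has_derivative_linear)
    have "frechet_derivative V (at ?y) w = frechet_derivative V (at ?y) (\<Sum>a\<in>UNIV. w $ a *\<^sub>R axis a 1)"
      using basis_expansion[of w] by (simp add: scalar_mult_eq_scaleR)
    then show ?thesis by (simp add: linear_sum[OF l] linear_scale[OF l] pd_def)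
  qed
  ultimately show ?case by (simp add: has_real_derivative_iff_has_vector_derivative)
next
  case (Suc m)
  have "((\<lambda>t. dird m w (pd a V) (x0 + t *\<^sub>R w)) has_real_derivative
      dird (Suc m) w (pd a V) (x0 + t *\<^sub>R w)) (at t)" for a
    using Suc by simp
  then have "((\<lambda>t. \<Sum>a\<in>UNIV. w $ a * dird m w (pd a V) (x0 + t *\<^sub>R w)) has_real_derivative
      (\<Sum>a\<in>UNIV. w $ a * dird (Suc m) w (pd a V) (x0 + t *\<^sub>R w))) (at t)"
    by (intro DERIV_sum DERIV_cmult)
  then show ?case by (simp only: dird.simps(2)[of "Suc m"] dird.simps(2)[of m])
qed

lemma dird_bounded:
  assumes "compact K" "Ck_on m V S" "K \<subseteq> S"
  shows "\<exists>B\<ge>0. \<forall>x\<in>K. \<forall>w. \<bar>dird m w V x\<bar> \<le> B * norm w ^ m"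
  using assms(2)
proof (induction m arbitrary: V)
  case 0
  then have "compact (V ` K)"
    using assms by (auto intro: compact_continuous_image continuous_on_subset)
  then obtain B where "\<forall>x\<in>K. \<bar>V x\<bar> \<le> B"
    by (force dest: compact_imp_bounded simp: bounded_iff)
  then show ?case by (intro exI[of _ "max B 0"]) auto
next
  case (Suc m)
  then have "\<forall>a. \<exists>B\<ge>0. \<forall>x\<in>K. \<forall>w. \<bar>dird m w (pd a V) x\<bar> \<le> B * norm w ^ m" by simp
  then obtain B where B: "\<And>a. B a \<ge> 0" "\<And>a x w. x \<in> K \<Longrightarrow> \<bar>dird m w (pd a V) x\<bar> \<le> B a * norm w ^ m"
    by metis
  have "\<bar>dird (Suc m) w V x\<bar> \<le> (\<Sum>a\<in>UNIV. B a) * norm w ^ Suc m" if x: "x \<in> K" for x w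
  proof -
    have "\<bar>dird (Suc m) w V x\<bar> \<le> (\<Sum>a\<in>UNIV. \<bar>w $ a * dird m w (pd a V) x\<bar>)"
      by simp
    also have "\<dots> \<le> (\<Sum>a\<in>UNIV. norm w * (B a * norm w ^ m))"
      unfolding abs_mult
      by (intro sum_mono mult_mono B(2)[OF x] component_le_norm_cart norm_ge_zero abs_ge_zero)
    also have "\<dots> = (\<Sum>a\<in>UNIV. B a) * norm w ^ Suc m"
      by (simp add: sum_distrib_left sum_distrib_right mult_ac)
    finally show ?thesis .
  qed
  then show ?case using B(1) by (intro exI[of _ "\<Sum>a\<in>UNIV. B a"]) (auto simp: sum_nonneg simp del: dird.simps)
qed

text \<open>Maclaurin's formula for \<open>V\<close> along the segment, with parameter from 0 to 1.
  The top derivative is bounded on a compact set, so the constant depends neither on the base point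
  nor on the direction.\<close>

lemma Taylor_bound:
  assumes "compact K" "K \<subseteq> S" "Ck_on q V S" "q > 0"
  shows "\<exists>B\<ge>0. \<forall>x0 w. (\<forall>t\<in>{0..1}. x0 + t *\<^sub>R w \<in> K) \<longrightarrow>
    \<bar>V (x0 + w) - (\<Sum>m<q. dird m w V x0 / fact m)\<bar> \<le> B * norm w ^ q"
proof -
  obtain B where B: "B \<ge> 0" "\<And>x w. x \<in> K \<Longrightarrow> \<bar>dird q w V x\<bar> \<le> B * norm w ^ q"
    using dird_bounded[OF assms(1,3,2)] by blast
  have "\<bar>V (x0 + w) - (\<Sum>m<q. dird m w V x0 / fact m)\<bar> \<le> B * norm w ^ q"
    if K: "\<And>t. t \<in> {0..1} \<Longrightarrow> x0 + t *\<^sub>R w \<in> K" for x0 w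
  proof -
    let ?d = "\<lambda>m t. dird m w V (x0 + t *\<^sub>R w)"
    have "\<forall>m t. m < q \<and> 0 \<le> t \<and> t \<le> 1 \<longrightarrow> DERIV (?d m) t :> ?d (Suc m) t"
    proof (intro allI impI)
      fix m t assume a: "m < q \<and> 0 \<le> t \<and> t \<le> (1::real)"
      show "DERIV (?d m) t :> ?d (Suc m) t"
        by (rule dird_has_derivative[where S = S])
          (use a K[of t] assms Ck_on_le[OF assms(3), of "Suc m"] in auto)
    qed
    from Maclaurin[OF zero_less_one assms(4) refl this] obtain t where t: "0 < t" "t < 1"
      "?d 0 1 = (\<Sum>m<q. ?d m 0 / fact m * 1 ^ m) + ?d q t / fact q * 1 ^ q"
      by blast
    then have "V (x0 + w) - (\<Sum>m<q. dird m w V x0 / fact m) = ?d q t / fact q" by simp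
    also have "\<bar>\<dots>\<bar> \<le> \<bar>?d q t\<bar>" by (simp add: divide_le_eq fact_ge_1 mult_left_le_one_le mult_le_cancel_left1)
    also have "\<dots> \<le> B * norm w ^ q" using B(2)[OF K[of t]] t by simp
    finally show ?thesis .
  qed
  then show ?thesis using B(1) by (intro exI[of _ B]) auto
qed

text \<open>The domain need not be convex and elements are curved, so a segment between two points
  of an element may leave the domain; for short segments it stays in this larger compact
  set.\<close>

lemma compact_neighbourhood:
  fixes X S :: "(real^2) set"
  assumes "compact X" "open S" "X \<subseteq> S"
  shows "\<exists>\<rho>>0. \<exists>K. compact K \<and> K \<subseteq> S \<and> (\<forall>x\<in>X. cball x \<rho> \<subseteq> K)"
proof -
  obtain e where e: "e > 0" "(\<Union>x\<in>X. ball x e) \<subseteq> S"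
    using compact_subset_open_imp_ball_epsilon_subset[OF assms] by blast
  let ?K = "{x + y |x y. x \<in> X \<and> y \<in> cball 0 (e/2)}"
  have "compact ?K" using assms(1) by (intro compact_sums) auto
  moreover have "?K \<subseteq> S"
  proof
    fix z assume "z \<in> ?K"
    then obtain x y where "z = x + y" "x \<in> X" "norm y \<le> e/2" by auto
    then have "z \<in> ball x e" "x \<in> X" using e(1) by (auto simp: dist_norm)
    then show "z \<in> S" using e(2) by blast
  qed
  moreover have "cball x (e/2) \<subseteq> ?K" if "x \<in> X" for x
  proof
    fix z assume z: "z \<in> cball x (e/2)"
    have "z = x + (z - x)" "z - x \<in> cball 0 (e/2)" using z by (auto simp: dist_norm norm_minus_commute)
    then show "z \<in> ?K" using that by blast
  qed
  ultimately have "compact ?K \<and> ?K \<subseteq> S \<and> (\<forall>x\<in>X. cball x (e/2) \<subseteq> ?K)" by blast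
  then show ?thesis using e(1) half_gt_zero by blast
qed

text \<open>
  Polynomials as lists of monomials. In the weighted norm \<open>wt h\<close> a monomial of degree \<open>m\<close> counts
  \<open>h\<^sup>-\<^sup>m\<close>; the norm is submultiplicative, and it is bounded uniformly in \<open>h\<close> for a Taylor polynomial
  composed with an element map of a regular family.
\<close>

definition ev :: "(real \<times> nat \<times> nat) list \<Rightarrow> real^2 \<Rightarrow> real" where
  "ev ps \<xi> = (\<Sum>(c, a, b)\<leftarrow>ps. c * ((\<xi> $ 1) ^ a * (\<xi> $ 2) ^ b))"

definition wt :: "real \<Rightarrow> (real \<times> nat \<times> nat) list \<Rightarrow> real" where
  "wt h ps = (\<Sum>(c, a, b)\<leftarrow>ps. \<bar>c\<bar> / h ^ (a + b))"

text \<open>The weight belongs to a list, and a list may repeat monomials; asking for some list of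
  small weight reduces sums and products to plain list operations.\<close>

definition wpoly :: "real \<Rightarrow> real \<Rightarrow> (real^2 \<Rightarrow> real) \<Rightarrow> bool" where
  "wpoly h B f \<longleftrightarrow> (\<exists>ps. f = ev ps \<and> wt h ps \<le> B)"

lemma ev_Nil: "ev [] \<xi> = 0"
  and ev_Cons: "ev ((c, a, b) # ps) \<xi> = c * ((\<xi> $ 1) ^ a * (\<xi> $ 2) ^ b) + ev ps \<xi>"
  and ev_append: "ev (ps @ qs) \<xi> = ev ps \<xi> + ev qs \<xi>"
  by (simp_all add: ev_def)

lemma wt_Nil: "wt h [] = 0"
  and wt_Cons: "wt h ((c, a, b) # ps) = \<bar>c\<bar> / h ^ (a + b) + wt h ps"
  and wt_append: "wt h (ps @ qs) = wt h ps + wt h qs"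
  by (simp_all add: wt_def)

lemma wt_nonneg: "h > 0 \<Longrightarrow> wt h ps \<ge> 0"
  by (induction ps) (auto simp: wt_Nil wt_Cons)

lemma wpoly_mono: "wpoly h B f \<Longrightarrow> B \<le> B' \<Longrightarrow> wpoly h B' f"
  unfolding wpoly_def by force

lemma wpoly_nonneg: "h > 0 \<Longrightarrow> wpoly h B f \<Longrightarrow> B \<ge> 0"
  unfolding wpoly_def using wt_nonneg order_trans by blast

lemma wpoly_monomial: "wpoly h (\<bar>c\<bar> / h ^ (a + b)) (\<lambda>\<xi>. c * ((\<xi> $ 1) ^ a * (\<xi> $ 2) ^ b))"
  unfolding wpoly_def
  by (rule exI[of _ "[(c, a, b)]"]) (auto simp: ev_Nil ev_Cons wt_Nil wt_Cons)

lemma wpoly_const: "wpoly h \<bar>c\<bar> (\<lambda>\<xi>. c)"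
  using wpoly_monomial[of h c 0 0] by simp

lemma wpoly_add:
  assumes "wpoly h B f" "wpoly h B' g"
  shows "wpoly h (B + B') (\<lambda>\<xi>. f \<xi> + g \<xi>)"
proof -
  obtain ps qs where "f = ev ps" "wt h ps \<le> B" "g = ev qs" "wt h qs \<le> B'"
    using assms by (auto simp: wpoly_def)
  then show ?thesis
    unfolding wpoly_def by (intro exI[of _ "ps @ qs"]) (auto simp: ev_append wt_append)
qed

lemma wpoly_sum:
  assumes "finite I" "\<And>i. i \<in> I \<Longrightarrow> wpoly h (B i) (f i)"
  shows "wpoly h (\<Sum>i\<in>I. B i) (\<lambda>\<xi>. \<Sum>i\<in>I. f i \<xi>)"
  using assms
proof (induction I)
  case empty
  show ?case using wpoly_const[of h 0] by simp
next
  case (insert i I)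
  then show ?case using wpoly_add[of h "B i" "f i"] by simp
qed

lemma wpoly_monomial_mult:
  assumes "h > 0" "wpoly h B f"
  shows "wpoly h (\<bar>c\<bar> / h ^ (a + b) * B) (\<lambda>\<xi>. (c * ((\<xi> $ 1) ^ a * (\<xi> $ 2) ^ b)) * f \<xi>)"
proof -
  obtain ps where ps: "f = ev ps" "wt h ps \<le> B" using assms by (auto simp: wpoly_def)
  let ?qs = "map (\<lambda>(c', a', b'). (c * c', a + a', b + b')) ps"
  have 1: "ev ?qs \<xi> = (c * ((\<xi> $ 1) ^ a * (\<xi> $ 2) ^ b)) * ev ps \<xi>" for \<xi>
    by (induction ps) (auto simp: ev_Nil ev_Cons power_add algebra_simps)
  have 2: "wt h ?qs = \<bar>c\<bar> / h ^ (a + b) * wt h ps"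
    by (induction ps) (auto simp: wt_Nil wt_Cons power_add abs_mult distrib_left add_divide_distrib mult_ac)
  show ?thesis
    unfolding wpoly_def using 1 2 ps assms(1)
    by (intro exI[of _ ?qs] conjI) (auto intro!: mult_left_mono divide_right_mono simp: fun_eq_iff)
qed

lemma wpoly_mult:
  assumes "h > 0" "wpoly h B f" "wpoly h B' g"
  shows "wpoly h (B * B') (\<lambda>\<xi>. f \<xi> * g \<xi>)"
proof -
  obtain ps where ps: "f = ev ps" "wt h ps \<le> B" using assms by (auto simp: wpoly_def)
  have "wpoly h (wt h ps * B') (\<lambda>\<xi>. ev ps \<xi> * g \<xi>)"
  proof (induction ps)
    case Nil
    show ?case using wpoly_const[of h 0] by (simp add: ev_Nil wt_Nil)
  next
    case (Cons p ps)
    obtain c a b where p: "p = (c, a, b)" by (cases p)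
    show ?case
      using wpoly_add[OF wpoly_monomial_mult[OF assms(1,3), of c a b] Cons]
      by (simp add: p ev_Cons wt_Cons distrib_right)
  qed
  then show ?thesis
    unfolding ps(1) by (rule wpoly_mono) (use ps(2) wpoly_nonneg[OF assms(1,3)] in \<open>simp add: mult_right_mono\<close>)
qed

text \<open>A form of degree \<open>m\<close> in \<open>w\<close>: inserting polynomials of weight
  \<open>W\<close> gives weight of order \<open>W ^ m\<close> by submultiplicativity. The constant
  only contains suprema of derivatives of \<open>V\<close>, so it is uniform in the base point and
  in \<open>h\<close>.\<close>

lemma wpoly_dird:
  assumes "compact K" "Ck_on m V S" "K \<subseteq> S"
  shows "\<exists>B\<ge>0. \<forall>x0\<in>K. \<forall>h>0. \<forall>W w. (\<forall>a. wpoly h W (\<lambda>\<xi>. w \<xi> $ a)) \<longrightarrow>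
    wpoly h (B * W ^ m) (\<lambda>\<xi>. dird m (w \<xi>) V x0)"
  using assms(2)
proof (induction m arbitrary: V)
  case 0
  then obtain B where B: "B \<ge> 0" "\<And>x. x \<in> K \<Longrightarrow> \<bar>V x\<bar> \<le> B"
    using dird_bounded[OF assms(1) 0 assms(3)] by auto
  then show ?case using wpoly_mono[OF wpoly_const] by (intro exI[of _ B]) auto
next
  case (Suc m)
  then have "\<forall>a. \<exists>B\<ge>0. \<forall>x0\<in>K. \<forall>h>0. \<forall>W w. (\<forall>a. wpoly h W (\<lambda>\<xi>. w \<xi> $ a)) \<longrightarrow>
    wpoly h (B * W ^ m) (\<lambda>\<xi>. dird m (w \<xi>) (pd a V) x0)" by simp
  then obtain B where B: "\<And>a. B a \<ge> 0" "\<And>a x0 h W w. x0 \<in> K \<Longrightarrow> h > 0 \<Longrightarrow> (\<And>a. wpoly h W (\<lambda>\<xi>. w \<xi> $ a)) \<Longrightarrow>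
    wpoly h (B a * W ^ m) (\<lambda>\<xi>. dird m (w \<xi>) (pd a V) x0)" by metis
  have "wpoly h ((\<Sum>a\<in>UNIV. B a) * W ^ Suc m) (\<lambda>\<xi>. dird (Suc m) (w \<xi>) V x0)"
    if "x0 \<in> K" "h > 0" and w: "\<And>a. wpoly h W (\<lambda>\<xi>. w \<xi> $ a)" for x0 h W w
  proof -
    have "wpoly h (\<Sum>a\<in>UNIV. W * (B a * W ^ m)) (\<lambda>\<xi>. \<Sum>a\<in>UNIV. w \<xi> $ a * dird m (w \<xi>) (pd a V) x0)"
      by (intro wpoly_sum wpoly_mult B(2) that) simp
    moreover have "(\<Sum>a\<in>UNIV. W * (B a * W ^ m)) = (\<Sum>a\<in>UNIV. B a) * W ^ Suc m"
      by (simp add: sum_distrib_left sum_distrib_right mult_ac)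
    ultimately show ?thesis by simp
  qed
  then show ?case using B(1) by (intro exI[of _ "\<Sum>a\<in>UNIV. B a"]) (auto simp: sum_nonneg simp del: dird.simps)
qed

text \<open>Monomials of degree below \<open>q\<close> are reproduced exactly. Any other monomial is
  bounded by 1 at the points in question, and its coefficient is at most its weight times
  \<open>h ^ q\<close>, because \<open>h \<le> 1\<close>. Thus the order is \<open>q\<close> however
  large the degree of \<open>f\<close> is.\<close>

lemma extrapolation_wpoly:
  fixes r :: "'n::finite \<Rightarrow> real"
  assumes h: "0 < h" "h \<le> 1" and f: "wpoly h B f"
    and exact: "\<And>a b. a + b < q \<Longrightarrow> (\<Sum>l\<in>UNIV. r l * ((x l $ 1) ^ a * (x l $ 2) ^ b)) = (y $ 1) ^ a * (y $ 2) ^ b"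
    and x: "\<And>l i. \<bar>x l $ i\<bar> \<le> 1" and y: "\<And>i. \<bar>y $ i\<bar> \<le> 1"
  shows "\<bar>(\<Sum>l\<in>UNIV. r l * f (x l)) - f y\<bar> \<le> ((\<Sum>l\<in>UNIV. \<bar>r l\<bar>) + 1) * B * h ^ q"
proof -
  obtain ps where ps: "f = ev ps" "wt h ps \<le> B" using f by (auto simp: wpoly_def)
  let ?R = "(\<Sum>l\<in>UNIV. \<bar>r l\<bar>) + 1"
  have R: "?R \<ge> 0" by (simp add: sum_nonneg)
  have "\<bar>(\<Sum>l\<in>UNIV. r l * ev ps (x l)) - ev ps y\<bar> \<le> ?R * wt h ps * h ^ q"
  proof (induction ps)
    case Nil
    show ?case by (simp add: ev_Nil wt_Nil)
  next
    case (Cons p ps)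
    obtain c a b where p: "p = (c, a, b)" by (cases p)
    let ?m = "\<lambda>\<xi> :: real^2. (\<xi> $ 1) ^ a * (\<xi> $ 2) ^ b"
    have m: "\<bar>?m \<xi>\<bar> \<le> 1" if "\<And>i. \<bar>\<xi> $ i\<bar> \<le> 1" for \<xi>
      using that by (simp add: abs_mult power_abs mult_le_one power_le_one)
    have "\<bar>(\<Sum>l\<in>UNIV. r l * ?m (x l)) - ?m y\<bar> \<le> ?R * (h ^ q / h ^ (a + b))"
    proof (cases "a + b < q")
      case True
      then show ?thesis using exact[OF True] R h by simp
    next
      case False
      have "\<bar>(\<Sum>l\<in>UNIV. r l * ?m (x l)) - ?m y\<bar> \<le> \<bar>\<Sum>l\<in>UNIV. r l * ?m (x l)\<bar> + \<bar>?m y\<bar>"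
        by (rule abs_triangle_ineq4)
      also have "\<dots> \<le> (\<Sum>l\<in>UNIV. \<bar>r l\<bar> * 1) + 1"
        by (intro add_mono m y order.trans[OF sum_abs] sum_mono) (simp only: abs_mult[of "r _"] mult_left_mono m x abs_ge_zero)
      also have "\<dots> \<le> ?R * (h ^ q / h ^ (a + b))"
      proof -
        have "h ^ (a + b) \<le> h ^ q" using False h by (intro power_decreasing) auto
        then have "1 \<le> h ^ q / h ^ (a + b)" using h by simp
        from mult_left_mono[OF this R] show ?thesis by simp
      qed
      finally show ?thesis .
    qed
    from mult_left_mono[OF this abs_ge_zero[of c]]
    have 1: "\<bar>c * ((\<Sum>l\<in>UNIV. r l * ?m (x l)) - ?m y)\<bar> \<le> ?R * (\<bar>c\<bar> / h ^ (a + b)) * h ^ q"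
      by (simp add: abs_mult mult_ac)
    have "(\<Sum>l\<in>UNIV. r l * ev (p # ps) (x l)) - ev (p # ps) y
      = c * ((\<Sum>l\<in>UNIV. r l * ?m (x l)) - ?m y) + ((\<Sum>l\<in>UNIV. r l * ev ps (x l)) - ev ps y)"
      by (simp add: p ev_Cons sum.distrib sum_distrib_left algebra_simps)
    then have "\<bar>(\<Sum>l\<in>UNIV. r l * ev (p # ps) (x l)) - ev (p # ps) y\<bar>
      \<le> ?R * (\<bar>c\<bar> / h ^ (a + b)) * h ^ q + ?R * wt h ps * h ^ q"
      using 1 Cons by linarith
    also have "\<dots> = ?R * wt h (p # ps) * h ^ q" by (simp add: p wt_Cons algebra_simps)
    finally show ?case .
  qed
  also have "\<dots> \<le> ?R * B * h ^ q"
    using ps(2) R h by (intro mult_right_mono mult_left_mono) auto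
  finally show ?thesis by (simp add: ps(1))
qed

section \<open>Self-adjointness and the nodal residual\<close>

text \<open>If \<open>1 + \<mu> \<bullet> \<nu>\<close> were positive, then
  \<open>- (\<mu> + \<nu>)\<close> would have a negative product with both vectors. Otherwise the
  square of \<open>\<mu> + \<nu>\<close> is at most 0.\<close>

lemma unit_vectors_opposite:
  fixes \<mu> \<nu> :: "'a::real_inner"
  assumes "norm \<mu> = 1" "norm \<nu> = 1" and no: "\<And>w. w \<bullet> \<mu> < 0 \<Longrightarrow> w \<bullet> \<nu> < 0 \<Longrightarrow> False"
  shows "\<nu> = - \<mu>"
proof -
  have 1: "\<mu> \<bullet> \<mu> = 1" "\<nu> \<bullet> \<nu> = 1" using assms(1,2) by (simp_all add: norm_eq_1)
  have "\<not> 1 + \<mu> \<bullet> \<nu> > 0"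
    using no[of "- (\<mu> + \<nu>)"] 1 by (auto simp: inner_diff_right inner_diff_left inner_commute)
  then have "(\<mu> + \<nu>) \<bullet> (\<mu> + \<nu>) \<le> 0"
    using 1 by (simp add: inner_add_left inner_add_right inner_commute)
  then have "\<mu> + \<nu> = 0" by (metis inner_ge_zero inner_eq_zero_iff order_antisym)
  then show ?thesis by (simp add: eq_neg_iff_add_eq_0 add.commute)
qed

context sbp_discretization
begin

lemma facet_data:
  assumes "k \<in> elems M" "\<gamma> \<in> facets M k"
  shows "xfacet M \<gamma> j = emap M k (local_node M \<gamma> k j)"
    "bweight M \<gamma> j = fweight (refel M) j * norm (frechet_derivative (emap M k) (at (local_node M \<gamma> k j))
            (ref_vertex (local_edge M \<gamma> k + 1) - ref_vertex (local_edge M \<gamma> k)))"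
    "outward_unit_normal (element M k) (xfacet M \<gamma> j) (normal M \<gamma> k j)"
  using mesh assms unfolding valid_mesh_def by blast+

lemma norm_normal: "k \<in> elems M \<Longrightarrow> \<gamma> \<in> facets M k \<Longrightarrow> norm (normal M \<gamma> k j) = 1"
  using facet_data(3) by (auto simp: outward_unit_normal_def)

text \<open>Otherwise some direction would point into both elements, whose interiors are disjoint.\<close>

lemma normal_nbr:
  assumes k: "k \<in> elems M" "\<gamma> \<in> ifacets M k"
  shows "normal M \<gamma> (nbr M \<gamma> k) j = - normal M \<gamma> k j"
proof (rule unit_vectors_opposite)
  let ?v = "nbr M \<gamma> k" and ?x = "xfacet M \<gamma> j"
  note v = nbr[OF k]
  have f: "\<gamma> \<in> facets M k" "\<gamma> \<in> facets M ?v" using k v(3) ifacets_subset by auto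
  show "norm (normal M \<gamma> k j) = 1" "norm (normal M \<gamma> ?v j) = 1"
    using norm_normal k v f by auto
  fix w assume w: "w \<bullet> normal M \<gamma> k j < 0" "w \<bullet> normal M \<gamma> ?v j < 0"
  have 1: "\<forall>\<^sub>F t in at_right 0. ?x + t *\<^sub>R w \<in> interior (element M k)"
    using facet_data(3)[OF k(1) f(1)] w(1) by (auto simp: outward_unit_normal_def)
  have 2: "\<forall>\<^sub>F t in at_right 0. ?x + t *\<^sub>R w \<in> interior (element M ?v)"
    using facet_data(3)[OF v(1) f(2)] w(2) by (auto simp: outward_unit_normal_def)
  have "interior (element M k) \<inter> interior (element M ?v) = {}"
    using mesh k(1) v unfolding valid_mesh_def by metis
  moreover obtain t where "?x + t *\<^sub>R w \<in> interior (element M k)" "?x + t *\<^sub>R w \<in> interior (element M ?v)"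
    using eventually_happens'[OF trivial_limit_at_right_real eventually_conj[OF 1 2]] by blast
  ultimately show False by blast
qed

lemma facet_flux_nbr:
  "k \<in> elems M \<Longrightarrow> \<gamma> \<in> ifacets M k \<Longrightarrow> facet_flux lam M V \<gamma> (nbr M \<gamma> k) = - facet_flux lam M V \<gamma> k"
  by (simp add: facet_flux_def normal_nbr vec_eq_iff)

text \<open>The choice of coefficients is self-dual: \<open>T2\<close> plus \<open>Bm\<close> is
  \<open>T3\<close>, \<open>T3\<close> minus \<open>Bm\<close> is \<open>T2\<close>,
  \<open>T6\<close> is minus \<open>T5\<close>, and \<open>T1\<close> to \<open>T4\<close> agree on
  both sides of a facet. Inserted into the adjoint formula these identities restore the jumps and
  flux sums of the primal one.\<close>

lemma sI_adj_BR1: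
  assumes k: "k \<in> elems M"
  shows "sI_adj lam M (BR1_sat lam M) \<psi> k = sI lam M (BR1_sat lam M) \<psi> k"
  unfolding sI_adj_def sI_def Let_def
proof (rule sum.cong[OF refl])
  fix \<gamma> assume g: "\<gamma> \<in> ifacets M k"
  let ?v = "nbr M \<gamma> k"
  let ?T = "BR1_sat lam M"
  have half: "B - (1/2) *\<^sub>R B = (1/2) *\<^sub>R B" "(1/2) *\<^sub>R B - B = - ((1/2) *\<^sub>R B)"
    for B :: "real^'nf^'nf" by (simp_all add: vec_eq_iff)
  have 1: "T1 ?T \<gamma> k *v (Rm M \<gamma> k *v \<psi> k) + - T1 ?T \<gamma> ?v *v (Rm M \<gamma> ?v *v \<psi> ?v)
       + (T2 ?T \<gamma> k + Bm M \<gamma>) *v (Dgm lam M \<gamma> k *v \<psi> k) + - T2 ?T \<gamma> ?v *v (Dgm lam M \<gamma> ?v *v \<psi> ?v)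
     = T1 ?T \<gamma> k *v jump M \<psi> \<gamma> k + T3 ?T \<gamma> k *v (Dgm lam M \<gamma> k *v \<psi> k + Dgm lam M \<gamma> ?v *v \<psi> ?v)"
    by (simp add: T1_nbr[OF k g] half jump_def mv_minus_left matrix_vector_mult_diff_distrib
        matrix_vector_right_distrib)
  have 2: "(T3 ?T \<gamma> k - Bm M \<gamma>) *v (Rm M \<gamma> k *v \<psi> k) + T3 ?T \<gamma> ?v *v (Rm M \<gamma> ?v *v \<psi> ?v)
       + T4 ?T \<gamma> k *v (Dgm lam M \<gamma> k *v \<psi> k) + T4 ?T \<gamma> ?v *v (Dgm lam M \<gamma> ?v *v \<psi> ?v)
     = T2 ?T \<gamma> k *v jump M \<psi> \<gamma> k + T4 ?T \<gamma> k *v (Dgm lam M \<gamma> k *v \<psi> k + Dgm lam M \<gamma> ?v *v \<psi> ?v)"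
    by (simp add: half jump_def mv_minus_left matrix_vector_mult_diff_distrib)
  have 3: "T5 ?T \<gamma> \<epsilon> l *v (Rm M \<epsilon> l *v \<psi> l) + T6 ?T \<gamma> \<epsilon> l *v (Rm M \<epsilon> (nbr M \<epsilon> l) *v \<psi> (nbr M \<epsilon> l))
      = T5 ?T \<gamma> \<epsilon> l *v jump M \<psi> \<epsilon> l" for \<epsilon> l
    by (simp add: jump_def mv_minus_left matrix_vector_mult_diff_distrib)
  have 4: "(\<Sum>\<delta>\<in>ifacets M ?v - {\<gamma>}. transpose (Rm M \<gamma> k) *v (T6 ?T \<gamma> \<delta> ?v *v jump M \<psi> \<delta> ?v))
      = - (\<Sum>\<delta>\<in>ifacets M ?v - {\<gamma>}. transpose (Rm M \<gamma> k) *v (T5 ?T \<gamma> \<delta> ?v *v jump M \<psi> \<delta> ?v))"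
    by (simp add: mv_minus_left mv_minus_right sum_negf del: transpose_matrix_vector)
  show "transpose (Rm M \<gamma> k) *v
          (T1 ?T \<gamma> k *v (Rm M \<gamma> k *v \<psi> k) + - T1 ?T \<gamma> ?v *v (Rm M \<gamma> ?v *v \<psi> ?v)
             + (T2 ?T \<gamma> k + Bm M \<gamma>) *v (Dgm lam M \<gamma> k *v \<psi> k) + - T2 ?T \<gamma> ?v *v (Dgm lam M \<gamma> ?v *v \<psi> ?v)) +
        transpose (Dgm lam M \<gamma> k) *v
          ((T3 ?T \<gamma> k - Bm M \<gamma>) *v (Rm M \<gamma> k *v \<psi> k) + T3 ?T \<gamma> ?v *v (Rm M \<gamma> ?v *v \<psi> ?v)
             + T4 ?T \<gamma> k *v (Dgm lam M \<gamma> k *v \<psi> k) + T4 ?T \<gamma> ?v *v (Dgm lam M \<gamma> ?v *v \<psi> ?v)) +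
        (\<Sum>\<epsilon>\<in>ifacets M k - {\<gamma>}. transpose (Rm M \<gamma> k) *v
                (T5 ?T \<gamma> \<epsilon> k *v (Rm M \<epsilon> k *v \<psi> k) + T6 ?T \<gamma> \<epsilon> k *v (Rm M \<epsilon> (nbr M \<epsilon> k) *v \<psi> (nbr M \<epsilon> k)))) -
        (\<Sum>\<delta>\<in>ifacets M ?v - {\<gamma>}. transpose (Rm M \<gamma> k) *v
                (T5 ?T \<gamma> \<delta> ?v *v (Rm M \<delta> ?v *v \<psi> ?v) + T6 ?T \<gamma> \<delta> ?v *v (Rm M \<delta> (nbr M \<delta> ?v) *v \<psi> (nbr M \<delta> ?v))))
     = transpose (Rm M \<gamma> k) *v (T1 ?T \<gamma> k *v jump M \<psi> \<gamma> k
           + T3 ?T \<gamma> k *v (Dgm lam M \<gamma> k *v \<psi> k + Dgm lam M \<gamma> ?v *v \<psi> ?v)) +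
        transpose (Dgm lam M \<gamma> k) *v (T2 ?T \<gamma> k *v jump M \<psi> \<gamma> k
           + T4 ?T \<gamma> k *v (Dgm lam M \<gamma> k *v \<psi> k + Dgm lam M \<gamma> ?v *v \<psi> ?v)) +
        (\<Sum>\<epsilon>\<in>ifacets M k - {\<gamma>}. transpose (Rm M \<gamma> k) *v (T5 ?T \<gamma> \<epsilon> k *v jump M \<psi> \<epsilon> k)) +
        (\<Sum>\<delta>\<in>ifacets M ?v - {\<gamma>}. transpose (Rm M \<gamma> k) *v (T6 ?T \<gamma> \<delta> ?v *v jump M \<psi> \<delta> ?v))"
    unfolding 1 2 3 4 by (rule diff_conv_add_uminus)
qed

lemma Lh_adj_BR1:
  "k \<in> elems M \<Longrightarrow> Lh_adj lam M (BR1_sat lam M) \<psi>b \<phi>b \<psi> k = Lh lam M (BR1_sat lam M) \<psi>b \<phi>b \<psi> k"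
  by (simp add: Lh_adj_def Lh_def sI_adj_BR1)

end

text \<open>On matrices, \<open>norm\<close> is the Frobenius norm.\<close>

lemma norm_mv: "norm (A *v x) \<le> norm A * norm (x :: real^'n)"
proof -
  have "norm (A *v x) = L2_set (\<lambda>i. \<bar>A $ i \<bullet> x\<bar>) UNIV"
    by (simp add: norm_vec_def matrix_vector_mul_component)
  also have "\<dots> \<le> L2_set (\<lambda>i. norm (A $ i) * norm x) UNIV"
    by (rule L2_set_mono) (auto simp: Cauchy_Schwarz_ineq2)
  also have "\<dots> = norm A * norm x"
    by (simp add: norm_vec_def L2_set_left_distrib)
  finally show ?thesis .
qed

lemma norm_transpose: "norm (transpose A) = norm (A :: real^'n^'m)"
proof -
  have "(\<Sum>i\<in>UNIV. \<Sum>j\<in>UNIV. (A $ j $ i)\<^sup>2) = (\<Sum>i\<in>UNIV. \<Sum>j\<in>UNIV. (A $ i $ j)\<^sup>2)"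
    by (rule sum.swap)
  then show ?thesis by (simp add: norm_vec_def L2_set_def transpose_def sum_nonneg)
qed

lemma norm_mm: "norm (A ** B) \<le> norm (A :: real^'n^'m) * norm (B :: real^'l^'n)"
proof -
  have "(A ** B) $ i = transpose B *v A $ i" for i
    by (simp add: vec_eq_iff matrix_matrix_mult_def matrix_vector_mult_def transpose_def mult.commute
        del: transpose_matrix_vector)
  then have "norm (A ** B) = L2_set (\<lambda>i. norm (transpose B *v A $ i)) UNIV"
    by (simp add: norm_vec_def[of "A ** B"] del: transpose_matrix_vector)
  also have "\<dots> \<le> L2_set (\<lambda>i. norm (A $ i) * norm B) UNIV"
    by (rule L2_set_mono)
      (auto simp: mult.commute norm_transpose simp del: transpose_matrix_vector intro!: order.trans[OF norm_mv])
  also have "\<dots> = norm A * norm B"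
    by (simp add: norm_vec_def[of A] L2_set_left_distrib)
  finally show ?thesis .
qed

lemma norm_le_mv: "norm A \<le> a \<Longrightarrow> norm x \<le> b \<Longrightarrow> norm (A *v x) \<le> a * b" for x :: "real^'n"
  by (rule order.trans[OF norm_mv]) (meson mult_mono norm_ge_zero order_trans)

lemma norm_le_mm: "norm A \<le> a \<Longrightarrow> norm B \<le> b \<Longrightarrow> norm (A ** B) \<le> a * b"
  for A :: "real^'n^'m" and B :: "real^'l^'n"
  by (rule order.trans[OF norm_mm]) (meson mult_mono norm_ge_zero order_trans)

lemma norm_le_scaleR: "norm x \<le> b \<Longrightarrow> \<bar>c\<bar> \<le> a \<Longrightarrow> norm (c *\<^sub>R x) \<le> a * b"
  by (simp add: mult_mono)

lemma norm_sum_le_card: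
  assumes "card S \<le> n" "\<And>i. i \<in> S \<Longrightarrow> norm (f i) \<le> B" "0 \<le> B"
  shows "norm (sum f S) \<le> real n * B"
proof -
  have "norm (sum f S) \<le> real (card S) * B" using assms(2) by (rule sum_norm_bound)
  also have "\<dots> \<le> real n * B" using assms(1,3) by (simp add: mult_right_mono)
  finally show ?thesis .
qed

lemma norm_sum_2: "(\<And>a. norm (f a) \<le> B) \<Longrightarrow> norm (\<Sum>a\<in>(UNIV::2 set). f a) \<le> 2 * B"
  by (simp add: sum_2) (smt (verit) norm_triangle_ineq)

text \<open>The exponents of \<open>h\<close> are those of a derivative, an area and an arc length.
  One constant serves for everything, and \<open>1 \<le> K\<close> lets lower powers of it be
  absorbed by higher ones.\<close>

locale bounded_mesh = sbp_discretization +
  fixes h K :: real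
  assumes h: "0 < h" and K: "1 \<le> K"
    and bD: "k \<in> elems M \<Longrightarrow> norm (dmat M k a) \<le> K / h"
    and bR: "norm (Rm M \<gamma> k) \<le> K"
    and bHi: "k \<in> elems M \<Longrightarrow> norm (matrix_inv (Hm M k)) \<le> K / h\<^sup>2"
    and bB: "k \<in> elems M \<Longrightarrow> \<gamma> \<in> facets M k \<Longrightarrow> norm (Bm M \<gamma>) \<le> K * h"
    and bN: "k \<in> elems M \<Longrightarrow> \<gamma> \<in> facets M k \<Longrightarrow> norm (Nm M \<gamma> k a) \<le> K"
    and bL: "k \<in> elems M \<Longrightarrow> norm (Lamm lam M k a b) \<le> K"
    and bal: "k \<in> elems M \<Longrightarrow> \<gamma> \<in> facets M k \<Longrightarrow> 1 / alpha M \<gamma> k \<le> K"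
begin

lemma K0: "0 \<le> K" using K by simp

lemma card_facets: "card (facets M k) \<le> 3"
  unfolding facets_def using card_image_le[of UNIV "face M k"] by simp

lemma bound_Dgm:
  assumes "k \<in> elems M" "\<gamma> \<in> facets M k"
  shows "norm (Dgm lam M \<gamma> k) \<le> 4 * K ^ 4 / h"
proof -
  have "norm (Dgm lam M \<gamma> k) \<le> 2 * (2 * (K * K * K * (K / h)))"
    unfolding Dgm_def
    by (intro norm_sum_2 norm_le_mm bD bN bR bL assms)
  then show ?thesis by (simp add: eval_nat_numeral mult_ac)
qed

text \<open>The facet weights supply one factor \<open>h\<close> each, which cancels the inverse
  square in the inverse norm matrix: all penalties built from \<open>Upsm\<close> are O(1).\<close>

lemma bound_BUB:
  assumes "k \<in> elems M" "\<gamma> \<in> facets M k" "\<epsilon> \<in> facets M k"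
  shows "norm (Bm M \<gamma> ** Upsm lam M \<gamma> \<epsilon> k ** Bm M \<epsilon>) \<le> 4 * K ^ 8"
proof -
  have "norm (Upsm lam M \<gamma> \<epsilon> k) \<le> 2 * (2 * (K * K * (K / h\<^sup>2) * K * K * K))"
    unfolding Upsm_def
    by (intro norm_sum_2 norm_le_mm bHi bN bR bL assms) (simp add: norm_transpose bR)
  then have "norm (Bm M \<gamma> ** Upsm lam M \<gamma> \<epsilon> k ** Bm M \<epsilon>)
     \<le> (K * h) * (2 * (2 * (K * K * (K / h\<^sup>2) * K * K * K))) * (K * h)"
    by (intro norm_le_mm bB[OF assms(1)] assms)
  also have "\<dots> = 4 * K ^ 8" using h by (simp add: eval_nat_numeral field_simps)
  finally show ?thesis .
qed

lemma bound_T1: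
  assumes "k \<in> elems M" "\<gamma> \<in> ifacets M k"
  shows "norm (T1 (BR1_sat lam M) \<gamma> k) \<le> 4 * K ^ 9"
proof -
  let ?v = "nbr M \<gamma> k"
  let ?X = "\<lambda>k. Bm M \<gamma> ** Upsm lam M \<gamma> \<gamma> k ** Bm M \<gamma>"
  note v = nbr[OF assms]
  have f: "\<gamma> \<in> facets M k" "\<gamma> \<in> facets M ?v" using assms v(3) ifacets_subset by auto
  have "T1 (BR1_sat lam M) \<gamma> k = (1/2) *\<^sub>R ((1 / alpha M \<gamma> k) *\<^sub>R ?X k + (1 / alpha M \<gamma> ?v) *\<^sub>R ?X ?v)"
    by (simp add: BR1_sat_def vec_eq_iff matrix_matrix_mult_def sum_distrib_left sum_distrib_right
        sum.distrib algebra_simps add_divide_distrib sum_divide_distrib)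
  also have "norm \<dots> \<le> (1/2) * (K * (4 * K ^ 8) + K * (4 * K ^ 8))"
  proof (intro norm_le_scaleR norm_triangle_le add_mono)
    show "\<bar>1 / alpha M \<gamma> k\<bar> \<le> K" "\<bar>1 / alpha M \<gamma> ?v\<bar> \<le> K"
      using bal[OF assms(1) f(1)] bal[OF v(1) f(2)] alpha_pos[OF assms(1) f(1)] alpha_pos[OF v(1) f(2)]
      by simp_all
  qed (use bound_BUB assms v f in auto)
  finally show ?thesis by (simp add: eval_nat_numeral)
qed

lemma bound_cross:
  assumes "k \<in> elems M" "\<gamma> \<in> facets M k" "\<epsilon> \<in> facets M k"
  shows "norm (cross_mat \<gamma> \<epsilon> k) \<le> K ^ 8"
proof -
  have "norm (cross_mat \<gamma> \<epsilon> k) \<le> (1/16) * (4 * K ^ 8)"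
    unfolding cross_mat_def by (rule norm_le_scaleR) (use bound_BUB assms in auto)
  then show ?thesis using zero_le_power[OF K0, of 8] by linarith
qed

text \<open>
  Both penalty vectors are \<open>O(h\<^sup>4)\<close>, and the inverse norm matrix costs two powers of \<open>h\<close>; of the
  constant it only matters that it does not depend on \<open>h\<close>.
\<close>

lemma bound_residual:
  assumes sol: "steady_solution \<Omega> \<Gamma>D \<Gamma>N lam F Udir Uneu U"
    and eJ: "\<And>\<gamma> k. k \<in> elems M \<Longrightarrow> \<gamma> \<in> facets M k \<Longrightarrow>
      norm (Rm M \<gamma> k *v nodal M U k - facet_nodal M U \<gamma> k) \<le> K * h ^ 4"
    and eF: "\<And>\<gamma> k a. k \<in> elems M \<Longrightarrow> \<gamma> \<in> facets M k \<Longrightarrow>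
      norm (Rm M \<gamma> k *v nodal M (\<lambda>x. flux lam U x $ a) k - facet_nodal M (\<lambda>x. flux lam U x $ a) \<gamma> k) \<le> K * h ^ 3"
    and eD: "\<And>k a. k \<in> elems M \<Longrightarrow> norm (dmat M k a *v nodal M U k - nodal M (pd a U) k) \<le> K * h ^ 3"
    and eDF: "\<And>k a. k \<in> elems M \<Longrightarrow> norm (dmat M k a *v nodal M (\<lambda>x. flux lam U x $ a) k
      - nodal M (pd a (\<lambda>x. flux lam U x $ a)) k) \<le> K * h\<^sup>2"
    and k: "k \<in> elems M"
  shows "norm (Lh lam M (BR1_sat lam M) (facet_nodal M U) (facet_flux lam M U) (nodal M U) k - nodal M F k)
    \<le> 150 * K ^ 12 * h\<^sup>2"
proof -
  let ?T = "BR1_sat lam M" and ?u = "nodal M U" and ?f = "\<lambda>a x. flux lam U x $ a"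
  \<comment> \<open>The discrete flux at the volume nodes, to be compared with the exact flux
    \<open>?f a\<close>.\<close>
  define G where "G k a = (\<Sum>b\<in>UNIV. Lamm lam M k a b *v (dmat M k b *v ?u k))" for k a
  have Kp: "K ^ i \<le> K ^ j" if "i \<le> j" for i j using K that by (rule power_increasing[rotated])
  have eG: "norm (G k a - nodal M (?f a) k) \<le> 2 * K\<^sup>2 * h ^ 3" if k: "k \<in> elems M" for k a
  proof -
    have "nodal M (?f a) k = (\<Sum>b\<in>UNIV. Lamm lam M k a b *v nodal M (pd b U) k)"
      by (simp add: vec_eq_iff nodal_def flux_def Lamm_def mv_2 sum_2)
    then have "G k a - nodal M (?f a) k
      = (\<Sum>b\<in>UNIV. Lamm lam M k a b *v (dmat M k b *v ?u k - nodal M (pd b U) k))"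
      by (simp add: G_def sum_subtractf matrix_vector_mult_diff_distrib)
    also have "norm \<dots> \<le> 2 * (K * (K * h ^ 3))"
      by (intro norm_sum_2 norm_le_mv bL eD k)
    finally show ?thesis by (simp add: power2_eq_square mult_ac)
  qed
  \<comment> \<open>Two errors of order h^3 add up: the extrapolated nodal error of the discrete
    flux, and the extrapolation error of the exact flux.\<close>
  have eW: "norm (Dgm lam M \<gamma> k *v ?u k - facet_flux lam M U \<gamma> k) \<le> 6 * K ^ 4 * h ^ 3"
    if k: "k \<in> elems M" and g: "\<gamma> \<in> facets M k" for k \<gamma>
  proof -
    have "facet_flux lam M U \<gamma> k = (\<Sum>a\<in>UNIV. Nm M \<gamma> k a *v facet_nodal M (?f a) \<gamma> k)"
      by (simp add: vec_eq_iff facet_flux_def facet_nodal_def Nm_def inner_vec_def)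
    moreover have "Dgm lam M \<gamma> k *v ?u k = (\<Sum>a\<in>UNIV. Nm M \<gamma> k a *v (Rm M \<gamma> k *v G k a))"
      by (simp add: Dgm_def G_def mv_sum_left mv_sum_right matrix_vector_mul_assoc[symmetric])
    ultimately have "Dgm lam M \<gamma> k *v ?u k - facet_flux lam M U \<gamma> k
      = (\<Sum>a\<in>UNIV. Nm M \<gamma> k a *v (Rm M \<gamma> k *v (G k a - nodal M (?f a) k)
          + (Rm M \<gamma> k *v nodal M (?f a) k - facet_nodal M (?f a) \<gamma> k)))"
      by (simp add: sum_subtractf matrix_vector_mult_diff_distrib matrix_vector_right_distrib)
    also have "norm \<dots> \<le> 2 * (K * (K * (2 * K\<^sup>2 * h ^ 3) + K * h ^ 3))"
      by (intro norm_sum_2 norm_le_mv bN bR k g norm_triangle_le add_mono eG eF)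
    also have "\<dots> = (4 * K ^ 4 + 2 * K\<^sup>2) * h ^ 3" by (simp add: eval_nat_numeral algebra_simps)
    also have "\<dots> \<le> 6 * K ^ 4 * h ^ 3"
      using Kp[of 2 4] h by (intro mult_right_mono) auto
    finally show ?thesis .
  qed
  \<comment> \<open>Both sides use the same facet nodes, so the exact traces agree and the jump is a
    difference of two extrapolation errors.\<close>
  have bJ: "norm (jump M ?u \<gamma> k) \<le> 2 * K * h ^ 4" if k: "k \<in> elems M" and g: "\<gamma> \<in> ifacets M k" for k \<gamma>
  proof -
    let ?v = "nbr M \<gamma> k"
    note v = nbr[OF k g]
    have "facet_nodal M U \<gamma> ?v = facet_nodal M U \<gamma> k" by (simp add: facet_nodal_def)
    then have "jump M ?u \<gamma> k = (Rm M \<gamma> k *v ?u k - facet_nodal M U \<gamma> k)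
        - (Rm M \<gamma> ?v *v ?u ?v - facet_nodal M U \<gamma> ?v)" by (simp add: jump_def)
    also have "norm \<dots> \<le> K * h ^ 4 + K * h ^ 4"
      by (intro order.trans[OF norm_triangle_ineq4] add_mono eJ k v(1) ifacets_subset g v(3))
    finally show ?thesis by simp
  qed
  \<comment> \<open>The normals of the two sides are opposite, so the exact fluxes cancel and only
    their errors remain.\<close>
  have bW: "norm (Dgm lam M \<gamma> k *v ?u k + Dgm lam M \<gamma> (nbr M \<gamma> k) *v ?u (nbr M \<gamma> k)) \<le> 12 * K ^ 4 * h ^ 3"
    if k: "k \<in> elems M" and g: "\<gamma> \<in> ifacets M k" for k \<gamma>
  proof -
    let ?v = "nbr M \<gamma> k"
    note v = nbr[OF k g]
    have "Dgm lam M \<gamma> k *v ?u k + Dgm lam M \<gamma> ?v *v ?u ?v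
      = (Dgm lam M \<gamma> k *v ?u k - facet_flux lam M U \<gamma> k) + (Dgm lam M \<gamma> ?v *v ?u ?v - facet_flux lam M U \<gamma> ?v)"
      by (simp add: facet_flux_nbr[OF k g])
    also have "norm \<dots> \<le> 6 * K ^ 4 * h ^ 3 + 6 * K ^ 4 * h ^ 3"
      by (intro norm_triangle_le add_mono eW k v(1) ifacets_subset g v(3))
    finally show ?thesis by (simp add: field_simps)
  qed
  have card_if: "card (ifacets M k) \<le> 3" for k
    using card_mono[OF finite_facets, of "ifacets M k" k] card_facets[of k] by (auto simp: ifacets_def)
  have card_if': "card (ifacets M k - {\<gamma>}) \<le> 3" for k \<gamma>
    using card_if[of k] card_Diff1_le[of "ifacets M k" \<gamma>] by linarith
  have card_fi: "card (facets M k \<inter> X) \<le> 3" for k X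
    using card_mono[OF finite_facets, of "facets M k \<inter> X" k] card_facets[of k] by auto
  have bRT: "norm (transpose (Rm M \<gamma> k)) \<le> K" for \<gamma> k by (simp add: norm_transpose bR)
  have bDT: "norm (transpose (Dgm lam M \<gamma> k)) \<le> 4 * K ^ 4 / h" if "k \<in> elems M" "\<gamma> \<in> facets M k" for \<gamma> k
    using that by (simp add: norm_transpose bound_Dgm)
  have bX: "norm (transpose (Rm M \<gamma> k) *v (cross_mat \<gamma> \<epsilon> l *v jump M ?u \<epsilon> l)) \<le> 2 * K ^ 10 * h ^ 4"
    if "l \<in> elems M" "\<gamma> \<in> ifacets M l" "\<epsilon> \<in> ifacets M l" for k l \<gamma> \<epsilon>
  proof -
    have "norm (transpose (Rm M \<gamma> k) *v (cross_mat \<gamma> \<epsilon> l *v jump M ?u \<epsilon> l)) \<le> K * (K ^ 8 * (2 * K * h ^ 4))"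
      by (intro norm_le_mv bRT bound_cross bJ that ifacets_subset)
    then show ?thesis by (simp add: eval_nat_numeral mult_ac)
  qed
  have sI: "norm (sI lam M ?T ?u k) \<le> 3 * ((8 * K ^ 11 + 22 * K ^ 10) * h ^ 4)"
  proof -
    \<comment> \<open>Each factor \<open>real 3\<close> bounds a number of facets; every summand is
      of order h^4, either from a jump with an O(1) factor or from a facet weight times a flux
      error.\<close>
    have "norm (sI lam M ?T ?u k) \<le> real 3 * (K * (4 * K ^ 9 * (2 * K * h ^ 4) + 1/2 * (K * h * (12 * K ^ 4 * h ^ 3)))
       + 1/2 * (4 * K ^ 4 / h * (K * h * (2 * K * h ^ 4))) + real 3 * (2 * K ^ 10 * h ^ 4) + real 3 * (2 * K ^ 10 * h ^ 4))"
      unfolding sI_BR1 Let_def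
    proof (rule norm_sum_le_card[OF card_if])
      fix \<gamma> assume g: "\<gamma> \<in> ifacets M k"
      note v = nbr[OF k g]
      have gf: "\<gamma> \<in> facets M k" using g by (rule ifacets_subset)
      show "norm (transpose (Rm M \<gamma> k) *v (T1 ?T \<gamma> k *v jump M ?u \<gamma> k
       + (1/2) *\<^sub>R (Bm M \<gamma> *v (Dgm lam M \<gamma> k *v ?u k + Dgm lam M \<gamma> (nbr M \<gamma> k) *v ?u (nbr M \<gamma> k))))
     - (1/2) *\<^sub>R (transpose (Dgm lam M \<gamma> k) *v (Bm M \<gamma> *v jump M ?u \<gamma> k))
     + (\<Sum>\<epsilon>\<in>ifacets M k - {\<gamma>}. transpose (Rm M \<gamma> k) *v (cross_mat \<gamma> \<epsilon> k *v jump M ?u \<epsilon> k))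
     - (\<Sum>\<delta>\<in>ifacets M (nbr M \<gamma> k) - {\<gamma>}. transpose (Rm M \<gamma> k) *v (cross_mat \<gamma> \<delta> (nbr M \<gamma> k) *v jump M ?u \<delta> (nbr M \<gamma> k))))
      \<le> K * (4 * K ^ 9 * (2 * K * h ^ 4) + 1/2 * (K * h * (12 * K ^ 4 * h ^ 3)))
       + 1/2 * (4 * K ^ 4 / h * (K * h * (2 * K * h ^ 4))) + real 3 * (2 * K ^ 10 * h ^ 4) + real 3 * (2 * K ^ 10 * h ^ 4)"
        by (intro order.trans[OF norm_triangle_ineq4] norm_triangle_le add_mono norm_le_mv norm_le_scaleR
            bRT bound_T1 bJ bB[OF k gf] bW bDT[OF k gf] norm_sum_le_card[OF card_if'] bX k g v(1) v(3))
          (use K0 h in auto)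
    qed (use K0 h in auto)
    also have "\<dots> = 3 * ((8 * K ^ 11 + 12 * K ^ 10 + 6 * K ^ 6 + 4 * K ^ 6) * h ^ 4)"
      using h by (simp add: eval_nat_numeral field_simps)
    also have "\<dots> \<le> 3 * ((8 * K ^ 11 + 22 * K ^ 10) * h ^ 4)"
      using Kp[of 6 10] h by (intro mult_left_mono mult_right_mono) auto
    finally show ?thesis .
  qed
  have sB: "norm (sB lam M ?T (facet_nodal M U) (facet_flux lam M U) ?u k)
    \<le> 3 * ((4 * K ^ 11 + 10 * K ^ 10) * h ^ 4)"
  proof -
    have "norm (sB lam M ?T (facet_nodal M U) (facet_flux lam M U) ?u k)
      \<le> real 3 * (K * ((K * (4 * K ^ 8)) * (K * h ^ 4)) + 4 * K ^ 4 / h * (K * h * (K * h ^ 4)))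
       + real 3 * (K * (K * h * (6 * K ^ 4 * h ^ 3)))"
      unfolding sB_def Let_def
    proof (rule norm_triangle_le, rule add_mono; rule norm_sum_le_card[OF card_fi])
      fix \<gamma> assume "\<gamma> \<in> facets M k \<inter> dfacets M"
      then have g: "\<gamma> \<in> facets M k" by simp
      have "norm (TD ?T \<gamma> k) \<le> K * (4 * K ^ 8)"
        unfolding T_simps
        by (rule norm_le_scaleR[OF bound_BUB[OF k g g]]) (use bal[OF k g] alpha_pos[OF k g] in auto)
      then show "norm (transpose (Rm M \<gamma> k) *v (TD ?T \<gamma> k *v (Rm M \<gamma> k *v ?u k - facet_nodal M U \<gamma> k))
          + transpose (Dgm lam M \<gamma> k) *v (- Bm M \<gamma> *v (Rm M \<gamma> k *v ?u k - facet_nodal M U \<gamma> k)))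
        \<le> K * ((K * (4 * K ^ 8)) * (K * h ^ 4)) + 4 * K ^ 4 / h * (K * h * (K * h ^ 4))"
        by (intro norm_triangle_le add_mono norm_le_mv bRT bDT k g eJ) (use bB[OF k g] in auto)
    next
      fix \<gamma> assume "\<gamma> \<in> facets M k \<inter> nfacets M"
      then have g: "\<gamma> \<in> facets M k" by simp
      show "norm (transpose (Rm M \<gamma> k) *v (Bm M \<gamma> *v (Dgm lam M \<gamma> k *v ?u k - facet_flux lam M U \<gamma> k)))
        \<le> K * (K * h * (6 * K ^ 4 * h ^ 3))"
        by (intro norm_le_mv bRT bB[OF k] g eW k)
    qed (use K0 h in auto)
    also have "\<dots> = 3 * ((4 * K ^ 11 + 4 * K ^ 6 + 6 * K ^ 6) * h ^ 4)"
      using h by (simp add: eval_nat_numeral field_simps)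
    also have "\<dots> \<le> 3 * ((4 * K ^ 11 + 10 * K ^ 10) * h ^ 4)"
      using Kp[of 6 10] h by (intro mult_left_mono mult_right_mono) auto
    finally show ?thesis .
  qed
  have "nodal M F k = - (\<Sum>a\<in>UNIV. nodal M (pd a (?f a)) k)"
  proof -
    have "F (xnode M k i) = - div_flux lam U (xnode M k i)" for i
    proof -
      have "xnode M k i \<in> \<Omega>" using element_subset[OF k] xnode_in_element by blast
      then show ?thesis using sol by (simp add: steady_solution_def)
    qed
    then show ?thesis by (simp add: vec_eq_iff nodal_def div_flux_def)
  qed
  moreover have "D2m lam M k *v ?u k = (\<Sum>a\<in>UNIV. dmat M k a *v G k a)"
    by (simp add: D2m_def G_def mv_sum_left mv_sum_right matrix_vector_mul_assoc[symmetric])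
  \<comment> \<open>The outer derivative matrix costs one power of \<open>h\<close> on the flux
    error and has an error of its own on the exact flux; both are of order h^2.\<close>
  ultimately have "D2m lam M k *v ?u k + nodal M F k
    = (\<Sum>a\<in>UNIV. dmat M k a *v (G k a - nodal M (?f a) k) + (dmat M k a *v nodal M (?f a) k - nodal M (pd a (?f a)) k))"
    by (simp add: sum.distrib sum_subtractf matrix_vector_mult_diff_distrib)
  also have "norm \<dots> \<le> 2 * (K / h * (2 * K\<^sup>2 * h ^ 3) + K * h\<^sup>2)"
    by (intro norm_sum_2 norm_triangle_le add_mono norm_le_mv bD eG eDF k)
  also have "\<dots> = (4 * K ^ 3 + 2 * K) * h\<^sup>2" using h by (simp add: eval_nat_numeral field_simps)
  finally have D2: "norm (D2m lam M k *v ?u k + nodal M F k) \<le> (4 * K ^ 3 + 2 * K) * h\<^sup>2" .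
  have "Lh lam M ?T (facet_nodal M U) (facet_flux lam M U) ?u k - nodal M F k
    = matrix_inv (Hm M k) *v sI lam M ?T ?u k + matrix_inv (Hm M k) *v sB lam M ?T (facet_nodal M U) (facet_flux lam M U) ?u k
      - (D2m lam M k *v ?u k + nodal M F k)" by (simp add: Lh_def)
  also have "norm \<dots> \<le> K / h\<^sup>2 * (3 * ((8 * K ^ 11 + 22 * K ^ 10) * h ^ 4)) + K / h\<^sup>2 * (3 * ((4 * K ^ 11 + 10 * K ^ 10) * h ^ 4))
     + (4 * K ^ 3 + 2 * K) * h\<^sup>2"
    by (intro order.trans[OF norm_triangle_ineq4] norm_triangle_le add_mono norm_le_mv bHi k sI sB D2)
  also have "\<dots> = (36 * K ^ 12 + 96 * K ^ 11 + 4 * K ^ 3 + 2 * K) * h\<^sup>2"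
    using h by (simp add: eval_nat_numeral field_simps)
  \<comment> \<open>The coefficients add up to 138.\<close>
  also have "\<dots> \<le> 150 * K ^ 12 * h\<^sup>2"
    using Kp[of 11 12] Kp[of 3 12] Kp[of 1 12, simplified] zero_le_power[OF K0, of 12]
    by (intro mult_right_mono) (linarith, simp)
  finally show ?thesis .
qed

end

section \<open>Geometry of the elements\<close>

text \<open>Shaped exactly as the product and power rules deliver it. For exponent 0 the truncated
  \<open>a - 1\<close> or \<open>b - 1\<close> does no harm, as the factor in front
  vanishes.\<close>

definition poly2_deriv :: "nat \<Rightarrow> (nat \<Rightarrow> nat \<Rightarrow> 'v::real_normed_vector) \<Rightarrow> real^2 \<Rightarrow> real^2 \<Rightarrow> 'v" where
  "poly2_deriv d c \<xi> v = (\<Sum>a\<le>d. \<Sum>b\<le>d - a.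
     ((\<xi> $ 1) ^ a * (real b * v $ 2 * (\<xi> $ 2) ^ (b - 1)) + real a * v $ 1 * (\<xi> $ 1) ^ (a - 1) * (\<xi> $ 2) ^ b) *\<^sub>R c a b)"

lemma has_derivative_nth: "((\<lambda>x. x $ i) has_derivative (\<lambda>v. v $ i)) F"
  by (rule bounded_linear.has_derivative[OF bounded_linear_vec_nth has_derivative_ident])

lemma poly2_has_derivative: "(poly2 d c has_derivative poly2_deriv d c \<xi>) (at \<xi>)"
  unfolding poly2_def[abs_def] poly2_deriv_def[abs_def]
  by (intro has_derivative_sum has_derivative_scaleR_left has_derivative_mult has_derivative_power has_derivative_nth)

lemma continuous_poly2: "continuous_on S (poly2 d (c :: nat \<Rightarrow> nat \<Rightarrow> 'v::real_normed_vector))"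
  by (intro continuous_at_imp_continuous_on ballI has_derivative_continuous[OF poly2_has_derivative])

text \<open>The constant coefficient drops out. This matters for element maps, where it gives the
  position of the element and is not small.\<close>

lemma norm_poly2_deriv_le:
  assumes "\<And>i. \<bar>\<xi> $ i\<bar> \<le> 1" "\<And>i. \<bar>v $ i\<bar> \<le> 1" "0 \<le> B"
    and c: "\<And>a b. 1 \<le> a + b \<Longrightarrow> a + b \<le> d \<Longrightarrow> norm (c a b) \<le> B"
  shows "norm (poly2_deriv d c \<xi> v) \<le> real (Suc d) * (real (Suc d) * (real d * B))"
  unfolding poly2_deriv_def
proof (intro norm_sum_le_card)
  fix a b assume ab: "a \<in> {..d}" "b \<in> {..d - a}"
  have p: "\<bar>(\<xi> $ i) ^ m\<bar> \<le> 1" for i m using assms(1) by (simp add: power_abs power_le_one)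
  have "\<bar>(\<xi> $ 1) ^ a * (real b * v $ 2 * (\<xi> $ 2) ^ (b - 1))\<bar> \<le> 1 * (real b * 1 * 1)"
    unfolding abs_mult abs_of_nat by (intro mult_mono p assms(2)) auto
  moreover have "\<bar>real a * v $ 1 * (\<xi> $ 1) ^ (a - 1) * (\<xi> $ 2) ^ b\<bar> \<le> real a * 1 * 1 * 1"
    unfolding abs_mult abs_of_nat by (intro mult_mono p assms(2)) auto
  ultimately have 1: "\<bar>(\<xi> $ 1) ^ a * (real b * v $ 2 * (\<xi> $ 2) ^ (b - 1))
      + real a * v $ 1 * (\<xi> $ 1) ^ (a - 1) * (\<xi> $ 2) ^ b\<bar> \<le> real (a + b)" by simp
  show "norm (((\<xi> $ 1) ^ a * (real b * v $ 2 * (\<xi> $ 2) ^ (b - 1))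
      + real a * v $ 1 * (\<xi> $ 1) ^ (a - 1) * (\<xi> $ 2) ^ b) *\<^sub>R c a b) \<le> real d * B"
  proof (cases "1 \<le> a + b")
    case True
    have "norm (((\<xi> $ 1) ^ a * (real b * v $ 2 * (\<xi> $ 2) ^ (b - 1))
      + real a * v $ 1 * (\<xi> $ 1) ^ (a - 1) * (\<xi> $ 2) ^ b) *\<^sub>R c a b) \<le> real (a + b) * B"
      by (rule norm_le_scaleR[OF c[OF True] 1]) (use ab in auto)
    also have "\<dots> \<le> real d * B" using ab assms(3) by (intro mult_right_mono) auto
    finally show ?thesis .
  next
    case False
    then have "a = 0" "b = 0" by simp_all
    then show ?thesis using assms(3) by simp
  qed
qed (use assms(3) in auto)

lemma norm_matrix_le: "norm (A :: real^'n^'m) \<le> (\<Sum>i\<in>UNIV. \<Sum>j\<in>UNIV. \<bar>A $ i $ j\<bar>)"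
proof -
  have "norm A \<le> (\<Sum>i\<in>UNIV. norm (A $ i))"
    unfolding norm_vec_def[of A] by (rule L2_set_le_sum) simp
  also have "\<dots> \<le> (\<Sum>i\<in>UNIV. \<Sum>j\<in>UNIV. \<bar>A $ i $ j\<bar>)" by (intro sum_mono norm_le_l1_cart)
  finally show ?thesis .
qed

lemma norm_diagm_le: "norm (diagm d) \<le> (\<Sum>i\<in>UNIV. \<bar>d i\<bar>)"
  using norm_matrix_le[of "diagm d"] by (simp add: diagm_def if_distrib cong: if_cong)

lemma norm_vec_le_card:
  assumes "\<And>i. \<bar>x $ i\<bar> \<le> B"
  shows "norm (x :: real^'n) \<le> real CARD('n) * B"
  using sum_bounded_above[of UNIV "\<lambda>i. \<bar>x $ i\<bar>" B] assms
  by (intro order.trans[OF norm_le_l1_cart]) simp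

section \<open>The reference triangle\<close>

lemma ref_vertex_simps: "ref_vertex 1 = 0" "ref_vertex 2 = axis 1 1" "ref_vertex 3 = axis 2 1"
  by (simp_all add: ref_vertex_def)

lemma ref_triangle_bounds:
  assumes "\<xi> \<in> ref_triangle"
  shows "0 \<le> \<xi> $ i" "\<xi> $ i \<le> 1" "\<bar>\<xi> $ i\<bar> \<le> 1"
proof -
  have "ref_triangle \<subseteq> cbox (vec 0) (vec 1)"
    unfolding ref_triangle_def
    by (rule hull_minimal) (auto simp: mem_box_cart ref_vertex_def axis_def)
  then show "0 \<le> \<xi> $ i" "\<xi> $ i \<le> 1" "\<bar>\<xi> $ i\<bar> \<le> 1"
    using assms by (auto simp: mem_box_cart)
qed

lemma ref_triangleI:
  assumes "\<And>i. 0 \<le> \<xi> $ i" "\<xi> $ 1 + \<xi> $ 2 \<le> 1"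
  shows "\<xi> \<in> ref_triangle"
proof -
  have e: "range ref_vertex = {0, axis 1 1, axis 2 1}" by (simp add: UNIV_3 ref_vertex_simps)
  have "\<xi> = (1 - \<xi> $ 1 - \<xi> $ 2) *\<^sub>R 0 + (\<xi> $ 1) *\<^sub>R axis 1 1 + (\<xi> $ 2) *\<^sub>R axis 2 1"
    by (simp add: vec_eq_iff forall_2 axis_def)
  then show ?thesis
    unfolding ref_triangle_def e convex_hull_3 using assms
    by (intro CollectI exI[of _ "1 - \<xi> $ 1 - \<xi> $ 2"] exI[of _ "\<xi> $ 1"] exI[of _ "\<xi> $ 2"]) auto
qed

lemma zero_in_ref_triangle: "0 \<in> ref_triangle"
  by (rule ref_triangleI) auto

lemma compact_ref_triangle: "compact ref_triangle"
  unfolding ref_triangle_def by (rule finite_imp_compact_convex_hull) simp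

lemma ref_facet_node_in:
  assumes "valid_ref_element E"
  shows "ref_facet_node E i r j \<in> ref_triangle"
proof -
  have "0 < fnode E j" "fnode E j < 1" using assms by (auto simp: valid_ref_element_def)
  then have "0 \<le> (if r then 1 - fnode E j else fnode E j)" "(if r then 1 - fnode E j else fnode E j) \<le> 1" by auto
  then show ?thesis
    unfolding ref_facet_node_def ref_edge_def ref_triangle_def
    by (intro convexD[OF convex_convex_hull] hull_inc) auto
qed

text \<open>Any box inside the reference triangle would do, since element areas are only bounded
  from below. Being open it has an open image, and its closure still lies in the triangle.\<close>

abbreviation test_box :: "(real^2) set" where
  "test_box \<equiv> box (vec (1/8)) (vec (3/8))"

lemma test_box_subset: "cbox (vec (1/8)) (vec (3/8)) \<subseteq> ref_triangle"
proof
  fix \<xi> :: "real^2" assume "\<xi> \<in> cbox (vec (1/8)) (vec (3/8))"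
  then have b: "1/8 \<le> \<xi> $ i" "\<xi> $ i \<le> 3/8" for i by (auto simp: mem_box_cart)
  show "\<xi> \<in> ref_triangle"
    using b(2)[of 1] b(2)[of 2] order.trans[OF _ b(1)] by (intro ref_triangleI) auto
qed

abbreviation test_area :: real where
  "test_area \<equiv> measure lborel (cbox (vec (1/8)) (vec (3/8)) :: (real^2) set)"

lemma test_area_pos: "0 < test_area"
  by (rule content_pos_lt) (auto simp: Basis_vec_def inner_axis)

context sbp_discretization
begin

section \<open>Element maps, element areas and the number of elements\<close>

lemma emap_derivative: "(emap M k has_derivative poly2_deriv (pdeg (refel M) + 1) (mcoef M k) \<xi>) (at \<xi>)"
  unfolding emap_def by (rule poly2_has_derivative)

lemma emap_frechet: "frechet_derivative (emap M k) (at \<xi>) = poly2_deriv (pdeg (refel M) + 1) (mcoef M k) \<xi>"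
  using frechet_derivative_at[OF emap_derivative] by simp

lemma jac_det_eq:
  "jac_det M k \<xi> = poly2_deriv (pdeg (refel M) + 1) (mcoef M k) \<xi> (axis 1 1) $ 1 * poly2_deriv (pdeg (refel M) + 1) (mcoef M k) \<xi> (axis 2 1) $ 2
    - poly2_deriv (pdeg (refel M) + 1) (mcoef M k) \<xi> (axis 2 1) $ 1 * poly2_deriv (pdeg (refel M) + 1) (mcoef M k) \<xi> (axis 1 1) $ 2"
  by (simp add: jac_det_def emap_frechet det_2 matrix_def)

lemma continuous_jac_det: "continuous_on S (jac_det M k)"
  unfolding jac_det_eq[abs_def] poly2_deriv_def by (intro continuous_intros)

lemma emap_in_element: "\<xi> \<in> ref_triangle \<Longrightarrow> emap M k \<xi> \<in> element M k"
  by (simp add: element_def)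

lemma emap_in_domain: "k \<in> elems M \<Longrightarrow> \<xi> \<in> ref_triangle \<Longrightarrow> emap M k \<xi> \<in> \<Omega>"
  using emap_in_element element_subset by blast

lemma compact_element: "compact (element M k)"
  unfolding element_def emap_def
  by (intro compact_continuous_image continuous_poly2 compact_ref_triangle)

lemma diameter_le_mesh_size: "k \<in> elems M \<Longrightarrow> diameter (element M k) \<le> mesh_size M"
  unfolding mesh_size_def by (intro Max_ge) (auto simp: finite_elems)

lemma dist_le_mesh_size:
  "k \<in> elems M \<Longrightarrow> x \<in> element M k \<Longrightarrow> y \<in> element M k \<Longrightarrow> dist x y \<le> mesh_size M"
  using diameter_le_mesh_size diameter_bounded_bound[OF compact_imp_bounded[OF compact_element]]
  by (meson order_trans)

lemma emap_inj: "k \<in> elems M \<Longrightarrow> inj_on (emap M k) ref_triangle"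
  using mesh by (simp add: valid_mesh_def)

lemma mesh_size_pos:
  assumes k: "k \<in> elems M"
  shows "0 < mesh_size M"
proof -
  have t: "axis 1 1 \<in> ref_triangle" by (rule ref_triangleI) (auto simp: axis_def)
  have "axis 1 1 \<noteq> (0 :: real^2)" by simp
  then have "emap M k (axis 1 1) \<noteq> emap M k 0"
    using inj_onD[OF emap_inj[OF k] _ t zero_in_ref_triangle] by blast
  then have "0 < dist (emap M k (axis 1 1)) (emap M k 0)" by simp
  also have "\<dots> \<le> mesh_size M"
    by (intro dist_le_mesh_size[OF k] emap_in_element t zero_in_ref_triangle)
  finally show ?thesis .
qed

text \<open>Change of variables: the area of the image is the integral of the modulus of the
  Jacobian determinant.\<close>

lemma element_area_bound:
  assumes k: "k \<in> elems M" and c: "\<And>\<xi>. \<xi> \<in> ref_triangle \<Longrightarrow> m \<le> \<bar>jac_det M k \<xi>\<bar>"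
  shows "m * test_area \<le> measure lebesgue (emap M k ` test_box)"
proof -
  let ?C = "cbox (vec (1/8)) (vec (3/8)) :: (real^2) set"
  have sub: "test_box \<subseteq> ref_triangle" using box_subset_cbox test_box_subset by blast
  have i: "(\<lambda>\<xi>. \<bar>jac_det M k \<xi>\<bar>) integrable_on ?C"
    by (intro integrable_continuous continuous_on_rabs continuous_jac_det)
  have "m * test_area = integral ?C (\<lambda>_. m)" by simp
  also have "\<dots> \<le> integral ?C (\<lambda>\<xi>. \<bar>jac_det M k \<xi>\<bar>)"
    by (intro integral_le i integrable_const) (use c test_box_subset in auto)
  also have "\<dots> = integral test_box (\<lambda>\<xi>. \<bar>jac_det M k \<xi>\<bar>)"
    by (simp add: integral_open_interval)
  also have "\<dots> = measure lebesgue (emap M k ` test_box)"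
    unfolding jac_det_def emap_frechet
  proof (rule measure_differentiable_image_eq[symmetric])
    show "inj_on (emap M k) test_box" using emap_inj[OF k] sub by (rule inj_on_subset)
    show "(\<lambda>x. \<bar>det (matrix (poly2_deriv (pdeg (refel M) + 1) (mcoef M k) x))\<bar>) integrable_on test_box"
      using i by (simp add: integrable_on_open_interval jac_det_def emap_frechet)
    show "(emap M k has_derivative poly2_deriv (pdeg (refel M) + 1) (mcoef M k) x) (at x within test_box)" for x
      by (rule has_derivative_at_withinI[OF emap_derivative])
  qed simp
  finally show ?thesis .
qed

lemma card_elems_bound:
  assumes c: "\<And>k \<xi>. k \<in> elems M \<Longrightarrow> \<xi> \<in> ref_triangle \<Longrightarrow> m \<le> \<bar>jac_det M k \<xi>\<bar>"
  shows "real (card (elems M)) * (m * test_area) \<le> measure lebesgue \<Omega>"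
proof -
  let ?A = "\<lambda>k. emap M k ` test_box"
  have sub: "test_box \<subseteq> ref_triangle" using box_subset_cbox test_box_subset by blast
  \<comment> \<open>Invariance of domain. Only the interiors of elements are known to be disjoint,
    and an open image is contained in the interior.\<close>
  have op: "open (?A k)" if "k \<in> elems M" for k
    unfolding emap_def
    by (intro invariance_of_domain continuous_poly2 open_box)
      (use inj_on_subset[OF emap_inj[OF that] sub] in \<open>simp add: emap_def\<close>)
  have int: "?A k \<subseteq> interior (element M k)" if "k \<in> elems M" for k
    using op[OF that] sub by (intro interior_maximal) (auto simp: element_def)
  have dis: "disjoint_family_on ?A (elems M)"
    unfolding disjoint_family_on_def
  proof (intro ballI impI)
    fix k v assume "k \<in> elems M" "v \<in> elems M" "k \<noteq> v"
    then have "interior (element M k) \<inter> interior (element M v) = {}"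
      using mesh unfolding valid_mesh_def by blast
    then show "?A k \<inter> ?A v = {}" using int \<open>k \<in> elems M\<close> \<open>v \<in> elems M\<close> by blast
  qed
  have c\<Omega>: "compact \<Omega>" using dom by (simp add: diffusion_domain_def)
  have A\<Omega>: "?A k \<subseteq> \<Omega>" if "k \<in> elems M" for k
    using int[OF that] interior_subset element_subset[OF that] by blast
  have lm: "?A k \<in> lmeasurable" if "k \<in> elems M" for k
    using bounded_subset[OF compact_imp_bounded[OF c\<Omega>] A\<Omega>[OF that]] op[OF that]
    by (intro lmeasurable_open) auto
  have "real (card (elems M)) * (m * test_area) = (\<Sum>k\<in>elems M. m * test_area)" by simp
  also have "\<dots> \<le> (\<Sum>k\<in>elems M. measure lebesgue (?A k))"
    by (intro sum_mono element_area_bound c)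
  also have "\<dots> = measure lebesgue (\<Union>k\<in>elems M. ?A k)"
    by (rule measure_finite_Union[symmetric, OF finite_elems _ dis])
      (use fmeasurableD[OF lm] fmeasurableD2[OF lm] in \<open>blast, metis infinity_ennreal_def\<close>)
  also have "\<dots> \<le> measure lebesgue \<Omega>"
    using A\<Omega> sets.finite_UN[OF finite_elems fmeasurableD[OF lm]]
    by (intro measure_mono_fmeasurable lmeasurable_compact c\<Omega>) auto
  finally show ?thesis .
qed

lemma local_node_in: "local_node M \<gamma> k j \<in> ref_triangle"
  unfolding local_node_def by (rule ref_facet_node_in[OF ref])

lemma Hnorm_le:
  assumes "norm (Hm M k) \<le> B\<^sup>2" "0 \<le> B"
  shows "Hnorm M k v \<le> B * norm v"
proof -
  have "v \<bullet> (Hm M k *v v) \<le> norm v * norm (Hm M k *v v)"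
    using Cauchy_Schwarz_ineq2 abs_le_D1 by blast
  also have "\<dots> \<le> norm v * (B\<^sup>2 * norm v)"
    by (intro mult_left_mono norm_le_mv assms) auto
  also have "\<dots> = (B * norm v)\<^sup>2" by (simp add: power2_eq_square mult_ac)
  finally show ?thesis
    unfolding Hnorm_def using assms(2) by (intro real_le_lsqrt) auto
qed

end

text \<open>
  Based at the node where the derivative is taken, the quadratic Taylor polynomial is differentiated
  as accurately as the monomials in global coordinates.
\<close>

lemma quadratic_derivative_error:
  fixes d :: "'n::finite \<Rightarrow> real" and x :: "'n \<Rightarrow> real^2" and x0 :: "real^2"
  assumes d0: "(\<Sum>j\<in>UNIV. d j) = 0"
    and d1: "\<And>b. \<bar>(\<Sum>j\<in>UNIV. d j * x j $ b) - (if a = b then 1 else 0)\<bar> \<le> \<epsilon>"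
    and d2: "\<And>b c. \<bar>(\<Sum>j\<in>UNIV. d j * (x j $ b * x j $ c))
        - (x0 $ b * (if a = c then 1 else 0) + (if a = b then 1 else 0) * x0 $ c)\<bar> \<le> \<epsilon>"
    and X: "\<And>b. \<bar>x0 $ b\<bar> \<le> X" and g: "\<And>b. \<bar>g b\<bar> \<le> B" and H: "\<And>b c. \<bar>H b c\<bar> \<le> B"
  shows "\<bar>(\<Sum>j\<in>UNIV. d j * (f0 + (\<Sum>b\<in>UNIV. (x j - x0) $ b * g b)
      + (\<Sum>b\<in>UNIV. (x j - x0) $ b * (\<Sum>c\<in>UNIV. (x j - x0) $ c * H b c)) / 2)) - g a\<bar>
    \<le> (4 + 4 * X) * B * \<epsilon>"
proof -
  \<comment> \<open>The errors on linear and quadratic monomials centred at \<open>x0\<close>; the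
    exact derivative of the latter at \<open>x0\<close> is 0.\<close>
  define e1 where "e1 b = (\<Sum>j\<in>UNIV. d j * (x j - x0) $ b) - (if a = b then 1 else 0)" for b
  define e2 where "e2 b c = (\<Sum>j\<in>UNIV. d j * ((x j - x0) $ b * (x j - x0) $ c))" for b c
  have eps: "0 \<le> \<epsilon>" using d1[of a] by linarith
  have m0: "(\<Sum>j\<in>UNIV. d j * r) = 0" for r using d0 by (simp flip: sum_distrib_right)
  have e1: "e1 b = (\<Sum>j\<in>UNIV. d j * x j $ b) - (if a = b then 1 else 0)" for b
    by (simp add: e1_def right_diff_distrib sum_subtractf m0)
  have b1: "\<bar>e1 b\<bar> \<le> \<epsilon>" for b unfolding e1 by (rule d1)
  \<comment> \<open>Recentring a product of coordinates: the exact derivatives cancel, leaving the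
    error on the global product and two linear errors multiplied by coordinates of
    \<open>x0\<close>.\<close>
  have b2: "\<bar>e2 b c\<bar> \<le> (1 + 2 * X) * \<epsilon>" for b c
  proof -
    have "e2 b c = (\<Sum>j\<in>UNIV. d j * (x j $ b * x j $ c) - (d j * x j $ b) * x0 $ c
        - (d j * x j $ c) * x0 $ b + d j * (x0 $ b * x0 $ c))"
      unfolding e2_def by (intro sum.cong refl) (simp add: algebra_simps)
    also have "\<dots> = (\<Sum>j\<in>UNIV. d j * (x j $ b * x j $ c)) - (\<Sum>j\<in>UNIV. d j * x j $ b) * x0 $ c
        - (\<Sum>j\<in>UNIV. d j * x j $ c) * x0 $ b"
      by (simp only: sum.distrib sum_subtractf m0 sum_distrib_right)
    also have "\<dots> = ((\<Sum>j\<in>UNIV. d j * (x j $ b * x j $ c))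
        - (x0 $ b * (if a = c then 1 else 0) + (if a = b then 1 else 0) * x0 $ c))
        - e1 b * x0 $ c - e1 c * x0 $ b"
      by (simp add: e1 algebra_simps)
    also have "\<bar>\<dots>\<bar> \<le> \<epsilon> + \<epsilon> * X + \<epsilon> * X"
    proof -
      have "\<bar>e1 b * x0 $ c\<bar> \<le> \<epsilon> * X" for b c
        unfolding abs_mult by (intro mult_mono b1 X eps) auto
      from d2[of b c] this[of b c] this[of c b] show ?thesis by linarith
    qed
    finally show ?thesis by (simp add: algebra_simps)
  qed
  have "(\<Sum>j\<in>UNIV. d j * (f0 + (\<Sum>b\<in>UNIV. (x j - x0) $ b * g b)
      + (\<Sum>b\<in>UNIV. (x j - x0) $ b * (\<Sum>c\<in>UNIV. (x j - x0) $ c * H b c)) / 2))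
    = (\<Sum>j\<in>UNIV. d j * f0 + (\<Sum>b\<in>UNIV. d j * (x j - x0) $ b * g b)
      + (\<Sum>b\<in>UNIV. \<Sum>c\<in>UNIV. d j * ((x j - x0) $ b * (x j - x0) $ c) * (H b c / 2)))"
    by (intro sum.cong refl) (simp add: sum_2 field_simps)
  also have "\<dots> = (\<Sum>b\<in>UNIV. (e1 b + (if a = b then 1 else 0)) * g b) + (\<Sum>b\<in>UNIV. \<Sum>c\<in>UNIV. e2 b c * (H b c / 2))"
    by (simp add: sum.distrib m0 e1_def e2_def sum_2 sum_distrib_right sum_divide_distrib)
  also have "\<dots> - g a = (\<Sum>b\<in>UNIV. e1 b * g b) + (\<Sum>b\<in>UNIV. \<Sum>c\<in>UNIV. e2 b c * (H b c / 2))"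
    by (simp add: distrib_right sum.distrib if_distrib[of "\<lambda>z. z * _"] cong: if_cong)
  finally have eq: "(\<Sum>j\<in>UNIV. d j * (f0 + (\<Sum>b\<in>UNIV. (x j - x0) $ b * g b)
      + (\<Sum>b\<in>UNIV. (x j - x0) $ b * (\<Sum>c\<in>UNIV. (x j - x0) $ c * H b c)) / 2)) - g a = \<dots>" .
  have "\<bar>\<Sum>b\<in>UNIV. e1 b * g b\<bar> \<le> (\<Sum>b\<in>(UNIV::2 set). \<epsilon> * B)"
    by (intro order.trans[OF sum_abs] sum_mono) (auto simp: abs_mult intro!: mult_mono b1 g eps)
  moreover have "\<bar>\<Sum>b\<in>UNIV. \<Sum>c\<in>UNIV. e2 b c * (H b c / 2)\<bar> \<le> (\<Sum>b\<in>(UNIV::2 set). \<Sum>c\<in>(UNIV::2 set). ((1 + 2 * X) * \<epsilon>) * (B / 2))"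
  proof (intro order.trans[OF sum_abs] sum_mono)
    fix b c
    have "0 \<le> (1 + 2 * X) * \<epsilon>" using b2[of b c] by linarith
    then show "\<bar>e2 b c * (H b c / 2)\<bar> \<le> ((1 + 2 * X) * \<epsilon>) * (B / 2)"
      unfolding abs_mult using H[of b c] by (intro mult_mono b2) auto
  qed
  ultimately have "\<bar>(\<Sum>b\<in>UNIV. e1 b * g b) + (\<Sum>b\<in>UNIV. \<Sum>c\<in>UNIV. e2 b c * (H b c / 2))\<bar>
    \<le> (\<Sum>b\<in>(UNIV::2 set). \<epsilon> * B) + (\<Sum>b\<in>(UNIV::2 set). \<Sum>c\<in>(UNIV::2 set). ((1 + 2 * X) * \<epsilon>) * (B / 2))"
    by linarith
  \<comment> \<open>Two linear terms and four quadratic ones with a factor 1/2, hence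
    \<open>2 + 2 * (1 + 2 * X)\<close>.\<close>
  also have "\<dots> = (4 + 4 * X) * B * \<epsilon>" by (simp add: field_simps)
  finally show ?thesis unfolding eq .
qed

section \<open>Consistency\<close>

locale sbp_family =
  fixes \<Omega> \<Gamma>D \<Gamma>N :: "(real^2) set"
    and lam :: "real^2 \<Rightarrow> real^2^2"
    and E :: "('np::finite, 'nf::finite) ref_element"
    and M :: "nat \<Rightarrow> ('k, 'g, 'np, 'nf) sbp_mesh"
    and p :: nat and c C :: real
  assumes disc: "\<And>n. sbp_discretization \<Omega> \<Gamma>D \<Gamma>N lam (M n)"
    and E: "\<And>n. refel (M n) = E" and p: "pdeg E = p" "3 \<le> p"
    and lamC: "\<And>a b. Ck p (\<lambda>x. lam x $ a $ b) \<Omega>"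
    and c: "0 < c" and C: "0 \<le> C"
    and mc: "\<And>n k a b. k \<in> elems (M n) \<Longrightarrow> 1 \<le> a + b \<Longrightarrow> a + b \<le> p + 1 \<Longrightarrow>
      norm (mcoef (M n) k a b) \<le> C * mesh_size (M n) ^ (a + b)"
    and jc: "\<And>n k \<xi>. k \<in> elems (M n) \<Longrightarrow> \<xi> \<in> ref_triangle \<Longrightarrow> c * (mesh_size (M n))\<^sup>2 \<le> \<bar>jac_det (M n) k \<xi>\<bar>"
    and dc: "\<And>n k a i j. k \<in> elems (M n) \<Longrightarrow> \<bar>dmat (M n) k a $ i $ j\<bar> \<le> C / mesh_size (M n)"
    and ac: "\<And>n k \<gamma>. k \<in> elems (M n) \<Longrightarrow> \<gamma> \<in> facets (M n) k \<Longrightarrow> c \<le> alpha (M n) \<gamma> k"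
    and acc: "order_accurate \<Omega> p M"
    and h0: "(\<lambda>n. mesh_size (M n)) \<longlonglongrightarrow> 0"
begin

abbreviation h :: "nat \<Rightarrow> real" where "h n \<equiv> mesh_size (M n)"

section \<open>Bounds that are uniform over the family of meshes\<close>

lemma compact_domain: "compact \<Omega>"
  using sbp_discretization.dom[OF disc] by (simp add: diffusion_domain_def)

lemma ref_E: "valid_ref_element E"
  using sbp_discretization.ref[OF disc] by (simp add: E)

lemma h_pos: "k \<in> elems (M n) \<Longrightarrow> 0 < h n"
  by (rule sbp_discretization.mesh_size_pos[OF disc])

text \<open>The constant of \<open>norm_poly2_deriv_le\<close> for degree \<open>p + 1\<close> and
  coefficients bounded by \<open>C * h n\<close>.\<close>

definition CE :: real where
  "CE = real (p + 2) * (real (p + 2) * (real (p + 1) * C))"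

lemma CE_nonneg: "0 \<le> CE" using C by (simp add: CE_def)

lemma emap_deriv_le:
  assumes k: "k \<in> elems (M n)" and h1: "h n \<le> 1" and \<xi>: "\<xi> \<in> ref_triangle" and v: "\<And>i. \<bar>v $ i\<bar> \<le> 1"
  shows "norm (poly2_deriv (p + 1) (mcoef (M n) k) \<xi> v) \<le> CE * h n"
proof -
  have "norm (poly2_deriv (p + 1) (mcoef (M n) k) \<xi> v)
    \<le> real (Suc (p + 1)) * (real (Suc (p + 1)) * (real (p + 1) * (C * h n)))"
  proof (rule norm_poly2_deriv_le[OF ref_triangle_bounds(3)[OF \<xi>] v])
    show "0 \<le> C * h n" using C h_pos[OF k] by simp
    fix a b :: nat assume ab: "1 \<le> a + b" "a + b \<le> p + 1"
    have "norm (mcoef (M n) k a b) \<le> C * h n ^ (a + b)" by (rule mc[OF k ab])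
    also have "\<dots> \<le> C * h n ^ 1"
      using ab C h_pos[OF k] h1 by (intro mult_left_mono power_decreasing) auto
    finally show "norm (mcoef (M n) k a b) \<le> C * h n" by simp
  qed
  then show ?thesis by (simp add: CE_def mult_ac)
qed

lemma jac_det_le:
  assumes k: "k \<in> elems (M n)" and h1: "h n \<le> 1" and \<xi>: "\<xi> \<in> ref_triangle"
  shows "\<bar>jac_det (M n) k \<xi>\<bar> \<le> 2 * CE\<^sup>2 * (h n)\<^sup>2"
proof -
  let ?d = "\<lambda>i j. poly2_deriv (p + 1) (mcoef (M n) k) \<xi> (axis j 1) $ i"
  have d: "\<bar>?d i j\<bar> \<le> CE * h n" for i j
    by (rule order.trans[OF component_le_norm_cart emap_deriv_le[OF k h1 \<xi>]]) (simp add: axis_def)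
  have "\<bar>?d i j * ?d i' j'\<bar> \<le> (CE * h n) * (CE * h n)" for i j i' j'
    unfolding abs_mult using CE_nonneg h_pos[OF k] by (intro mult_mono d) auto
  from this[of 1 1 2 2] this[of 1 2 2 1] show ?thesis
    unfolding sbp_discretization.jac_det_eq[OF disc] E p(1) by (simp add: power2_eq_square algebra_simps)
qed

lemma Ck_bounded:
  assumes "Ck m f \<Omega>"
  shows "\<exists>B\<ge>0. \<forall>x\<in>\<Omega>. \<bar>f x\<bar> \<le> B"
proof -
  obtain S where "\<Omega> \<subseteq> S" "Ck_on m f S" using assms by (auto simp: Ck_def)
  then show ?thesis
    using dird_bounded[OF compact_domain Ck_on_le[of m f S 0]] by auto
qed

lemma bounded_mesh_ex:
  "\<exists>K0\<ge>1. \<forall>n k. k \<in> elems (M n) \<and> h n \<le> 1 \<longrightarrow>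
     (\<forall>K\<ge>K0. bounded_mesh \<Omega> \<Gamma>D \<Gamma>N lam (M n) (h n) K) \<and> norm (Hm (M n) k) \<le> K0 * (h n)\<^sup>2"
proof -
  have "\<forall>a b. \<exists>B\<ge>0. \<forall>x\<in>\<Omega>. \<bar>lam x $ a $ b\<bar> \<le> B" using Ck_bounded[OF lamC] by blast
  then obtain L where L: "\<And>a b. 0 \<le> L a b" "\<And>a b x. x \<in> \<Omega> \<Longrightarrow> \<bar>lam x $ a $ b\<bar> \<le> L a b" by metis
  have w: "0 < rweight E i" and fw: "0 < fweight E j" for i j
    using ref_E by (auto simp: valid_ref_element_def)
  define KD where "KD = real CARD('np) * (real CARD('np) * C)"
  define KR where "KR = (\<Sum>i\<in>UNIV. \<Sum>r\<in>UNIV. norm (rextrap E i r))"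
  define KH where "KH = (\<Sum>i\<in>UNIV. inverse (rweight E i * c))"
  define KB where "KB = (\<Sum>j\<in>UNIV. fweight E j) * CE"
  define KN where "KN = real CARD('nf)"
  define KL where "KL = real CARD('np) * (\<Sum>a\<in>UNIV. \<Sum>b\<in>UNIV. L a b)"
  define KHm where "KHm = (\<Sum>i\<in>UNIV. rweight E i) * (2 * CE\<^sup>2)"
  define K0 where "K0 = 1 + KD + KR + KH + KB + KN + KL + 1 / c + KHm"
  have nn: "0 \<le> KD" "0 \<le> KR" "0 \<le> KH" "0 \<le> KB" "0 \<le> KN" "0 \<le> KL" "0 \<le> 1 / c" "0 \<le> KHm"
    using C c less_imp_le[OF w] less_imp_le[OF fw] L(1) CE_nonneg
    by (auto simp: KD_def KR_def KH_def KB_def KN_def KL_def KHm_def intro!: sum_nonneg mult_nonneg_nonneg)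
  have K0: "1 \<le> K0" "KD \<le> K0" "KR \<le> K0" "KH \<le> K0" "KB \<le> K0" "KN \<le> K0" "KL \<le> K0" "1 / c \<le> K0" "KHm \<le> K0"
    using nn by (simp_all add: K0_def)
  have "bounded_mesh \<Omega> \<Gamma>D \<Gamma>N lam (M n) (h n) K"
    if k0: "k0 \<in> elems (M n)" and h1: "h n \<le> 1" and K: "K0 \<le> K" for n k0 K
  proof -
    interpret sbp_discretization \<Omega> \<Gamma>D \<Gamma>N lam "M n" by (rule disc)
    have hp: "0 < h n" by (rule h_pos[OF k0])
    show ?thesis
    proof unfold_locales
      show "0 < h n" by (rule hp)
      show "1 \<le> K" using K0(1) K by linarith
    next
      fix k a assume k: "k \<in> elems (M n)"
      have "norm (dmat (M n) k a) \<le> (\<Sum>i\<in>(UNIV::'np set). \<Sum>j\<in>(UNIV::'np set). C / h n)"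
        by (rule order.trans[OF norm_matrix_le]) (intro sum_mono dc k)
      also have "\<dots> = KD / h n" by (simp add: KD_def)
      also have "\<dots> \<le> K / h n" using K0(2) K hp by (intro divide_right_mono) auto
      finally show "norm (dmat (M n) k a) \<le> K / h n" .
    next
      fix \<gamma> k
      have "norm (rextrap E i r) \<le> (\<Sum>r\<in>UNIV. norm (rextrap E i r))" for i r
        by (rule member_le_sum) auto
      also have "\<dots> i \<le> KR" for i
        unfolding KR_def by (rule member_le_sum[of i UNIV "\<lambda>i. \<Sum>r\<in>UNIV. norm (rextrap E i r)"]) (auto intro: sum_nonneg)
      finally have "norm (Rm (M n) \<gamma> k) \<le> KR" by (simp add: Rm_def E)
      then show "norm (Rm (M n) \<gamma> k) \<le> K" using K0(3) K by linarith
    next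
      fix k assume k: "k \<in> elems (M n)"
      have "inverse (hw k i) \<le> inverse (rweight E i * c) / (h n)\<^sup>2" for i
      proof -
        have "rweight E i * (c * (h n)\<^sup>2) \<le> hw k i"
          unfolding hw_def E using w[of i] rnode_in[of i] by (intro mult_left_mono jc[OF k]) (auto simp: E)
        moreover have "0 < rweight E i * (c * (h n)\<^sup>2)" using w c hp by simp
        ultimately have "inverse (hw k i) \<le> inverse (rweight E i * (c * (h n)\<^sup>2))"
          by (rule le_imp_inverse_le)
        then show ?thesis by (simp add: field_simps)
      qed
      then have "(\<Sum>i\<in>UNIV. \<bar>inverse (hw k i)\<bar>) \<le> KH / (h n)\<^sup>2"
        unfolding KH_def sum_divide_distrib using hw_pos[OF k] by (intro sum_mono) (simp add: less_imp_le)
      then have "norm (matrix_inv (Hm (M n) k)) \<le> KH / (h n)\<^sup>2"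
        unfolding Hinv_eq[OF k] by (rule order.trans[OF norm_diagm_le])
      also have "\<dots> \<le> K / (h n)\<^sup>2" using K0(4) K by (intro divide_right_mono) auto
      finally show "norm (matrix_inv (Hm (M n) k)) \<le> K / (h n)\<^sup>2" .
    next
      fix k \<gamma> assume k: "k \<in> elems (M n)" and g: "\<gamma> \<in> facets (M n) k"
      have "\<bar>bweight (M n) \<gamma> j\<bar> \<le> fweight E j * (CE * h n)" for j
      proof -
        have "\<bar>(ref_vertex i - ref_vertex l) $ m\<bar> \<le> 1" for i l m
          by (simp add: ref_vertex_def axis_def)
        then have "norm (poly2_deriv (p + 1) (mcoef (M n) k) (local_node (M n) \<gamma> k j)
            (ref_vertex (local_edge (M n) \<gamma> k + 1) - ref_vertex (local_edge (M n) \<gamma> k))) \<le> CE * h n"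
          by (intro emap_deriv_le[OF k h1 local_node_in])
        then show ?thesis
          unfolding facet_data(2)[OF k g] emap_frechet E p(1) using fw[of j]
          by (simp add: abs_mult mult_left_mono)
      qed
      then have "norm (Bm (M n) \<gamma>) \<le> (\<Sum>j\<in>UNIV. fweight E j * (CE * h n))"
        unfolding Bm_def by (intro order.trans[OF norm_diagm_le] sum_mono)
      also have "\<dots> = KB * h n" by (simp add: KB_def flip: sum_distrib_right)
      also have "\<dots> \<le> K * h n" using K0(5) K hp by (intro mult_right_mono) auto
      finally show "norm (Bm (M n) \<gamma>) \<le> K * h n" .
    next
      fix k \<gamma> a assume k: "k \<in> elems (M n)" and g: "\<gamma> \<in> facets (M n) k"
      have "\<bar>normal (M n) \<gamma> k j $ a\<bar> \<le> 1" for j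
        using component_le_norm_cart[of "normal (M n) \<gamma> k j" a] norm_normal[OF k g] by simp
      then have "norm (Nm (M n) \<gamma> k a) \<le> (\<Sum>j\<in>(UNIV::'nf set). 1)"
        unfolding Nm_def by (intro order.trans[OF norm_diagm_le] sum_mono)
      then show "norm (Nm (M n) \<gamma> k a) \<le> K" using K0(6) K by (simp add: KN_def)
      have "1 / alpha (M n) \<gamma> k \<le> 1 / c" using ac[OF k g] c by (intro divide_left_mono) auto
      then show "1 / alpha (M n) \<gamma> k \<le> K" using K0(8) K by linarith
    next
      fix k a b assume k: "k \<in> elems (M n)"
      have "L a b \<le> (\<Sum>b\<in>UNIV. L a b)" by (rule member_le_sum) (auto simp: L(1))
      also have "\<dots> \<le> (\<Sum>a\<in>UNIV. \<Sum>b\<in>UNIV. L a b)"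
        by (rule member_le_sum[of a UNIV "\<lambda>a. \<Sum>b\<in>UNIV. L a b"]) (auto simp: L(1) sum_nonneg)
      finally have "\<bar>lam (xnode (M n) k i) $ a $ b\<bar> \<le> (\<Sum>a\<in>UNIV. \<Sum>b\<in>UNIV. L a b)" for i
        using L(2)[of "xnode (M n) k i" a b] xnode_in_element[of k i] element_subset[OF k] by force
      then have "norm (Lamm lam (M n) k a b) \<le> (\<Sum>i\<in>(UNIV::'np set). \<Sum>a\<in>UNIV. \<Sum>b\<in>UNIV. L a b)"
        unfolding Lamm_def by (intro order.trans[OF norm_diagm_le] sum_mono)
      then show "norm (Lamm lam (M n) k a b) \<le> K" using K0(7) K by (simp add: KL_def)
    qed
  qed
  moreover have "norm (Hm (M n) k) \<le> K0 * (h n)\<^sup>2" if k: "k \<in> elems (M n)" and h1: "h n \<le> 1" for n k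
  proof -
    interpret sbp_discretization \<Omega> \<Gamma>D \<Gamma>N lam "M n" by (rule disc)
    have "\<bar>hw k i\<bar> \<le> rweight E i * (2 * CE\<^sup>2 * (h n)\<^sup>2)" for i
      unfolding hw_def E using w[of i] jac_det_le[OF k h1 rnode_in[of i]]
      by (simp add: abs_mult mult_left_mono E)
    then have "norm (Hm (M n) k) \<le> (\<Sum>i\<in>UNIV. rweight E i * (2 * CE\<^sup>2 * (h n)\<^sup>2))"
      unfolding Hm_eq by (intro order.trans[OF norm_diagm_le] sum_mono)
    also have "\<dots> = KHm * (h n)\<^sup>2" by (simp add: KHm_def flip: sum_distrib_right)
    also have "\<dots> \<le> K0 * (h n)\<^sup>2" using K0(9) by (intro mult_right_mono) auto
    finally show ?thesis .
  qed
  ultimately show ?thesis using K0(1) by (intro exI[of _ K0]) blast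
qed

section \<open>Errors of extrapolation and of differentiation\<close>

lemma emap_increment:
  "emap (M n) k \<xi> - emap (M n) k 0
    = (\<Sum>a\<le>p + 1. \<Sum>b\<le>p + 1 - a. if a + b = 0 then 0 else ((\<xi> $ 1) ^ a * (\<xi> $ 2) ^ b) *\<^sub>R mcoef (M n) k a b)"
proof -
  let ?c = "mcoef (M n) k"
  have z: "poly2 d f 0 = (\<Sum>a\<le>d. \<Sum>b\<le>d - a. if a + b = 0 then f 0 0 else 0)" for d and f :: "nat \<Rightarrow> nat \<Rightarrow> real^2"
    unfolding poly2_def by (intro sum.cong refl) (auto simp: power_0_left)
  show ?thesis
    unfolding emap_def E p(1) z unfolding poly2_def sum_subtractf[symmetric]
    by (intro sum.cong refl) auto
qed

text \<open>The regularity of the family is precisely a bound on the weight: a coefficient of degree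
  m is of order h^m. Subtracting the value at 0 removes the one coefficient that is not
  small.\<close>

lemma wpoly_emap_increment:
  assumes k: "k \<in> elems (M n)"
  shows "wpoly (h n) (\<Sum>a\<le>p + 1. \<Sum>b\<le>p + 1 - a. C) (\<lambda>\<xi>. (emap (M n) k \<xi> - emap (M n) k 0) $ i)"
proof -
  have hp: "0 < h n" by (rule h_pos[OF k])
  have "wpoly (h n) C (\<lambda>\<xi>. if a + b = 0 then 0 else mcoef (M n) k a b $ i * ((\<xi> $ 1) ^ a * (\<xi> $ 2) ^ b))"
    if ab: "a \<le> p + 1" "b \<le> p + 1 - a" for a b
  proof (cases "a + b = 0")
    case True
    then show ?thesis using wpoly_mono[OF wpoly_const[of "h n" 0]] C by simp
  next
    case False
    have "\<bar>mcoef (M n) k a b $ i\<bar> \<le> C * h n ^ (a + b)"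
      by (rule order.trans[OF component_le_norm_cart mc[OF k]]) (use ab False in auto)
    then have "\<bar>mcoef (M n) k a b $ i\<bar> / h n ^ (a + b) \<le> C" using hp by (simp add: divide_le_eq)
    from wpoly_mono[OF wpoly_monomial this] show ?thesis using False by (simp only: if_False)
  qed
  then have "wpoly (h n) (\<Sum>a\<le>p + 1. \<Sum>b\<le>p + 1 - a. C) (\<lambda>\<xi>. \<Sum>a\<le>p + 1. \<Sum>b\<le>p + 1 - a.
      if a + b = 0 then 0 else mcoef (M n) k a b $ i * ((\<xi> $ 1) ^ a * (\<xi> $ 2) ^ b))"
    by (intro wpoly_sum) auto
  moreover have "(emap (M n) k \<xi> - emap (M n) k 0) $ i = (\<Sum>a\<le>p + 1. \<Sum>b\<le>p + 1 - a.
      if a + b = 0 then 0 else mcoef (M n) k a b $ i * ((\<xi> $ 1) ^ a * (\<xi> $ 2) ^ b))" for \<xi>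
    unfolding emap_increment sum_component by (intro sum.cong refl) (simp add: mult_ac)
  ultimately show ?thesis by simp
qed

lemma Taylor_domain:
  assumes "open S" "\<Omega> \<subseteq> S" "Ck_on q V S" "0 < q"
  shows "\<exists>B\<ge>0. \<exists>\<rho>>0. \<forall>x\<in>\<Omega>. \<forall>y. norm (y - x) \<le> \<rho> \<longrightarrow>
    \<bar>V y - (\<Sum>m<q. dird m (y - x) V x / fact m)\<bar> \<le> B * norm (y - x) ^ q"
proof -
  obtain \<rho> K where K: "\<rho> > 0" "compact K" "K \<subseteq> S" "\<And>x. x \<in> \<Omega> \<Longrightarrow> cball x \<rho> \<subseteq> K"
    using compact_neighbourhood[OF compact_domain assms(1,2)] by blast
  obtain B where B: "B \<ge> 0" "\<And>x0 w. (\<forall>t\<in>{0..1}. x0 + t *\<^sub>R w \<in> K) \<Longrightarrow>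
    \<bar>V (x0 + w) - (\<Sum>m<q. dird m w V x0 / fact m)\<bar> \<le> B * norm w ^ q"
    using Taylor_bound[OF K(2,3) assms(3,4)] by blast
  have "\<bar>V y - (\<Sum>m<q. dird m (y - x) V x / fact m)\<bar> \<le> B * norm (y - x) ^ q"
    if x: "x \<in> \<Omega>" and y: "norm (y - x) \<le> \<rho>" for x y
  proof -
    have "x + t *\<^sub>R (y - x) \<in> K" if t: "t \<in> {0..1}" for t
    proof -
      have "norm (t *\<^sub>R (y - x)) \<le> 1 * \<rho>" using t y by (intro norm_le_scaleR) auto
      then have "x + t *\<^sub>R (y - x) \<in> cball x \<rho>" by (simp add: dist_norm)
      then show ?thesis using K(4)[OF x] by blast
    qed
    then show ?thesis using B(2)[of x "y - x"] by simp
  qed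
  then show ?thesis using B(1) K(1) by blast
qed

text \<open>Split \<open>V\<close> on the element into a pulled-back Taylor polynomial and a
  remainder. The former is a matter of \<open>extrapolation_wpoly\<close>; the latter is of order
  h^q at volume and facet nodes alike and is amplified only by bounded row sums of
  \<open>Rm\<close>.\<close>

lemma extrapolation_error:
  assumes S: "open S" "\<Omega> \<subseteq> S" "Ck_on q V S" and q: "0 < q" "q \<le> p + 1"
  shows "\<exists>B\<ge>0. \<exists>\<rho>>0. \<forall>n k \<gamma>. h n \<le> \<rho> \<and> k \<in> elems (M n) \<and> \<gamma> \<in> facets (M n) k \<longrightarrow>
    norm (Rm (M n) \<gamma> k *v nodal (M n) V k - facet_nodal (M n) V \<gamma> k) \<le> B * h n ^ q"
proof -
  obtain B \<rho> where B: "B \<ge> 0" "\<rho> > 0" "\<And>x y. x \<in> \<Omega> \<Longrightarrow> norm (y - x) \<le> \<rho> \<Longrightarrow>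
    \<bar>V y - (\<Sum>m<q. dird m (y - x) V x / fact m)\<bar> \<le> B * norm (y - x) ^ q"
    using Taylor_domain[OF S q(1)] by blast
  obtain K0 where K0: "1 \<le> K0" "\<And>n k. k \<in> elems (M n) \<Longrightarrow> h n \<le> 1 \<Longrightarrow>
     bounded_mesh \<Omega> \<Gamma>D \<Gamma>N lam (M n) (h n) K0" using bounded_mesh_ex by blast
  have "\<exists>A\<ge>0. \<forall>x0\<in>\<Omega>. \<forall>h>0. \<forall>W w. (\<forall>a. wpoly h W (\<lambda>\<xi>. w \<xi> $ a)) \<longrightarrow>
    wpoly h (A * W ^ m) (\<lambda>\<xi>. dird m (w \<xi>) V x0)" if "m < q" for m
    using wpoly_dird[OF compact_domain Ck_on_le[OF S(3)] S(2)] that by simp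
  then obtain A where A: "\<And>m x0 h W w. m < q \<Longrightarrow> x0 \<in> \<Omega> \<Longrightarrow> h > 0 \<Longrightarrow> (\<And>a. wpoly h W (\<lambda>\<xi>. w \<xi> $ a)) \<Longrightarrow>
    wpoly h (A m * W ^ m) (\<lambda>\<xi>. dird m (w \<xi>) V x0)" by metis
  define W where "W = (\<Sum>a\<le>p + 1. \<Sum>b\<le>p + 1 - a. C)"
  define BP where "BP = (\<Sum>m<q. \<bar>1 / fact m\<bar> * (A m * W ^ m))"
  define B' where "B' = (real CARD('np) * K0 + 1) * (\<bar>BP\<bar> + B)"
  have R1: "0 \<le> real CARD('np) * K0 + 1" using K0(1) by simp
  have B': "0 \<le> B'" using B(1) R1 by (simp add: B'_def)
  have "norm (Rm (M n) \<gamma> k *v nodal (M n) V k - facet_nodal (M n) V \<gamma> k) \<le> real CARD('nf) * B' * h n ^ q"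
    if hn: "h n \<le> min \<rho> 1" and k: "k \<in> elems (M n)" and g: "\<gamma> \<in> facets (M n) k" for n k \<gamma>
  proof -
    have hp: "0 < h n" by (rule h_pos[OF k])
    interpret bounded_mesh \<Omega> \<Gamma>D \<Gamma>N lam "M n" "h n" K0 by (rule K0(2)[OF k]) (use hn in simp)
    let ?e = "emap (M n) k" and ?R = "\<lambda>j l. Rm (M n) \<gamma> k $ j $ l" and ?y = "local_node (M n) \<gamma> k"
    \<comment> \<open>The base point is the image of the reference vertex 0, so the argument of the
      Taylor polynomial is the increment of the element map.\<close>
    define P where "P \<xi> = (\<Sum>m<q. (1 / fact m) * dird m (?e \<xi> - ?e 0) V (?e 0))" for \<xi>
    have x0: "?e 0 \<in> \<Omega>" by (rule emap_in_domain[OF k zero_in_ref_triangle])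
    have "wpoly (h n) BP P"
      unfolding BP_def P_def[abs_def] W_def
      by (intro wpoly_sum wpoly_mult[OF hp] wpoly_const A x0 hp wpoly_emap_increment k) auto
    then have P: "wpoly (h n) \<bar>BP\<bar> P" by (rule wpoly_mono) simp
    have e: "\<bar>V (?e \<xi>) - P \<xi>\<bar> \<le> B * h n ^ q" if "\<xi> \<in> ref_triangle" for \<xi>
    proof -
      have d: "norm (?e \<xi> - ?e 0) \<le> h n"
        using dist_le_mesh_size[OF k emap_in_element[OF that] emap_in_element[OF zero_in_ref_triangle]]
        by (simp add: dist_norm)
      then have "\<bar>V (?e \<xi>) - P \<xi>\<bar> \<le> B * norm (?e \<xi> - ?e 0) ^ q"
        using B(3)[OF x0, of "?e \<xi>"] hn by (simp add: P_def)
      also have "\<dots> \<le> B * h n ^ q" using d B(1) by (intro mult_left_mono power_mono) auto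
      finally show ?thesis .
    qed
    have "\<bar>(Rm (M n) \<gamma> k *v nodal (M n) V k - facet_nodal (M n) V \<gamma> k) $ j\<bar> \<le> B' * h n ^ q" for j
    proof -
      have Rs: "(\<Sum>l\<in>UNIV. \<bar>?R j l\<bar>) \<le> real CARD('np) * K0"
      proof -
        have "\<bar>?R j l\<bar> \<le> K0" for l
          using component_le_norm_cart[of "Rm (M n) \<gamma> k $ j" l] Finite_Cartesian_Product.norm_nth_le[of "Rm (M n) \<gamma> k" j] bR[of \<gamma> k]
          by linarith
        then show ?thesis using sum_bounded_above[of UNIV "\<lambda>l. \<bar>?R j l\<bar>" K0] by simp
      qed
      have exact: "(\<Sum>l\<in>UNIV. ?R j l * ((rnode E l $ 1) ^ a * (rnode E l $ 2) ^ b)) = (?y j $ 1) ^ a * (?y j $ 2) ^ b"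
        if "a + b < q" for a b
        using Rm_monomial[of a b \<gamma> k j] that q p(1) by (simp add: E matrix_vector_mult_def)
      have "\<bar>(\<Sum>l\<in>UNIV. ?R j l * P (rnode E l)) - P (?y j)\<bar> \<le> ((\<Sum>l\<in>UNIV. \<bar>?R j l\<bar>) + 1) * \<bar>BP\<bar> * h n ^ q"
        using hn by (intro extrapolation_wpoly[OF hp _ P exact] ref_triangle_bounds(3) local_node_in
            rnode_in[unfolded E]) auto
      also have "\<dots> \<le> (real CARD('np) * K0 + 1) * \<bar>BP\<bar> * h n ^ q"
        using Rs hp by (intro mult_right_mono) auto
      finally have 1: "\<bar>(\<Sum>l\<in>UNIV. ?R j l * P (rnode E l)) - P (?y j)\<bar> \<le> \<dots>" .
      have "\<bar>\<Sum>l\<in>UNIV. ?R j l * (V (?e (rnode E l)) - P (rnode E l))\<bar> \<le> (\<Sum>l\<in>UNIV. \<bar>?R j l\<bar> * (B * h n ^ q))"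
        by (intro order.trans[OF sum_abs] sum_mono) (auto simp: abs_mult intro!: mult_left_mono e rnode_in[unfolded E])
      also have "\<dots> \<le> real CARD('np) * K0 * (B * h n ^ q)"
        unfolding sum_distrib_right[symmetric] using Rs B(1) hp by (intro mult_right_mono) auto
      finally have 2: "\<bar>\<Sum>l\<in>UNIV. ?R j l * (V (?e (rnode E l)) - P (rnode E l))\<bar> \<le> \<dots>" .
      have "(Rm (M n) \<gamma> k *v nodal (M n) V k - facet_nodal (M n) V \<gamma> k) $ j
        = (\<Sum>l\<in>UNIV. ?R j l * V (?e (rnode E l))) - V (?e (?y j))"
        by (simp add: matrix_vector_mult_def nodal_def xnode_def facet_nodal_def facet_data(1)[OF k g] E)
      also have "\<dots> = ((\<Sum>l\<in>UNIV. ?R j l * P (rnode E l)) - P (?y j))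
          + (\<Sum>l\<in>UNIV. ?R j l * (V (?e (rnode E l)) - P (rnode E l))) - (V (?e (?y j)) - P (?y j))"
        by (simp add: right_diff_distrib sum_subtractf)
      also have "\<bar>\<dots>\<bar> \<le> (real CARD('np) * K0 + 1) * \<bar>BP\<bar> * h n ^ q + real CARD('np) * K0 * (B * h n ^ q) + B * h n ^ q"
        using 1 2 e[OF local_node_in[of \<gamma> k j]] by linarith
      also have "\<dots> = B' * h n ^ q" by (simp add: B'_def algebra_simps)
      finally show ?thesis .
    qed
    from norm_vec_le_card[OF this] show ?thesis by (simp add: mult.assoc)
  qed
  then show ?thesis
    using B' B(2) by (intro exI[of _ "real CARD('nf) * B'"] conjI exI[of _ "min \<rho> 1"]) auto
qed

text \<open>Meant for the flux, which may lack the regularity that \<open>order_accurate\<close>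
  asks for. The constant in \<open>order_accurate\<close> depends on the function, so a Taylor
  polynomial whose base point changes with the node is no suitable input either; only the fixed
  functions \<open>x $ b\<close> and \<open>x $ b * x $ c\<close> are used, and
  \<open>quadratic_derivative_error\<close> assembles the rest.\<close>

lemma derivative_error:
  assumes S: "open S" "\<Omega> \<subseteq> S" "Ck_on 3 f S"
  shows "\<exists>B\<ge>0. \<exists>\<rho>>0. \<forall>n k a. h n \<le> \<rho> \<and> k \<in> elems (M n) \<longrightarrow>
    norm (dmat (M n) k a *v nodal (M n) f k - nodal (M n) (pd a f) k) \<le> B * (h n)\<^sup>2"
proof -
  obtain B \<rho> where B: "B \<ge> 0" "\<rho> > 0" "\<And>x y. x \<in> \<Omega> \<Longrightarrow> norm (y - x) \<le> \<rho> \<Longrightarrow>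
    \<bar>f y - (\<Sum>m<3. dird m (y - x) f x / fact m)\<bar> \<le> B * norm (y - x) ^ 3"
    using Taylor_domain[OF S zero_less_numeral] by blast
  have coordC: "Ck (p + 1) (\<lambda>x. x $ b) \<Omega>" "Ck (p + 1) (\<lambda>x. x $ b * x $ c) \<Omega>" for b c
    unfolding Ck_def by (intro exI[of _ UNIV] conjI open_UNIV subset_UNIV Ck_on_mult Ck_on_coord)+
  define err where "err \<phi> K \<longleftrightarrow> (\<forall>n. \<forall>k\<in>elems (M n). \<forall>a i.
      \<bar>(dmat (M n) k a *v nodal (M n) \<phi> k) $ i - pd a \<phi> (xnode (M n) k i)\<bar> \<le> K * h n ^ p)" for \<phi> K
  have err: "\<exists>K. err \<phi> K" if "Ck (p + 1) \<phi> \<Omega>" for \<phi>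
    using acc that unfolding order_accurate_def err_def by simp
  have "\<forall>b. \<exists>K. err (\<lambda>x. x $ b) K" by (intro allI err coordC)
  then obtain C1 where "\<forall>b. err (\<lambda>x. x $ b) (C1 b)" by (rule choice[THEN exE])
  then have C1: "\<bar>(dmat (M n) k a *v nodal (M n) (\<lambda>x. x $ b) k) $ i - pd a (\<lambda>x. x $ b) (xnode (M n) k i)\<bar> \<le> C1 b * h n ^ p"
    if "k \<in> elems (M n)" for b n k a i
    using that unfolding err_def by simp
  have "\<forall>bc. \<exists>K. err (\<lambda>x. x $ fst bc * x $ snd bc) K" by (intro allI err coordC)
  then obtain C2' where C2': "\<forall>bc. err (\<lambda>x. x $ fst bc * x $ snd bc) (C2' bc)" by (rule choice[THEN exE])
  define C2 where "C2 b c = C2' (b, c)" for b c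
  have C2: "\<bar>(dmat (M n) k a *v nodal (M n) (\<lambda>x. x $ b * x $ c) k) $ i - pd a (\<lambda>x. x $ b * x $ c) (xnode (M n) k i)\<bar> \<le> C2 b c * h n ^ p"
    if "k \<in> elems (M n)" for b c n k a i
    using spec[OF C2', of "(b, c)"] that unfolding err_def C2_def by simp
  define C12 where "C12 = (\<Sum>b\<in>UNIV. \<bar>C1 b\<bar>) + (\<Sum>b\<in>UNIV. \<Sum>c\<in>UNIV. \<bar>C2 b c\<bar>)"
  have C12: "C1 b \<le> C12" "C2 b c \<le> C12" for b c
  proof -
    have "\<bar>C1 b\<bar> \<le> (\<Sum>b\<in>UNIV. \<bar>C1 b\<bar>)" by (rule member_le_sum) auto
    moreover have "\<bar>C2 b c\<bar> \<le> (\<Sum>c\<in>UNIV. \<bar>C2 b c\<bar>)" by (rule member_le_sum) auto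
    moreover have "(\<Sum>c\<in>UNIV. \<bar>C2 b c\<bar>) \<le> (\<Sum>b\<in>UNIV. \<Sum>c\<in>UNIV. \<bar>C2 b c\<bar>)"
      by (rule member_le_sum[of b UNIV "\<lambda>b. \<Sum>c\<in>UNIV. \<bar>C2 b c\<bar>"]) (auto simp: sum_nonneg)
    moreover have "0 \<le> (\<Sum>b\<in>UNIV. \<bar>C1 b\<bar>)" "0 \<le> (\<Sum>b\<in>UNIV. \<Sum>c\<in>UNIV. \<bar>C2 b c\<bar>)"
      by (simp_all add: sum_nonneg)
    ultimately show "C1 b \<le> C12" "C2 b c \<le> C12" unfolding C12_def by linarith+
  qed
  have C12_0: "0 \<le> C12" by (simp add: C12_def sum_nonneg)
  obtain X where X: "0 \<le> X" "\<And>x. x \<in> \<Omega> \<Longrightarrow> norm x \<le> X"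
    using compact_imp_bounded[OF compact_domain] unfolding bounded_pos by (meson less_imp_le)
  have "\<forall>b. \<exists>D\<ge>0. \<forall>x\<in>\<Omega>. \<bar>pd b f x\<bar> \<le> D"
    by (intro allI Ck_bounded[where m = 2])
      (use S in \<open>auto simp: Ck_def numeral_3_eq_3 numeral_2_eq_2 intro!: exI[of _ S]\<close>)
  then obtain D1 where D1: "\<And>b. 0 \<le> D1 b" "\<And>b x. x \<in> \<Omega> \<Longrightarrow> \<bar>pd b f x\<bar> \<le> D1 b" by metis
  have "\<forall>b c. \<exists>D\<ge>0. \<forall>x\<in>\<Omega>. \<bar>pd c (pd b f) x\<bar> \<le> D"
    by (intro allI Ck_bounded[where m = 1])
      (use S in \<open>auto simp: Ck_def numeral_3_eq_3 numeral_2_eq_2 intro!: exI[of _ S]\<close>)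
  then obtain D2 where D2: "\<And>b c. 0 \<le> D2 b c" "\<And>b c x. x \<in> \<Omega> \<Longrightarrow> \<bar>pd c (pd b f) x\<bar> \<le> D2 b c" by metis
  define D where "D = (\<Sum>b\<in>UNIV. D1 b) + (\<Sum>b\<in>UNIV. \<Sum>c\<in>UNIV. D2 b c)"
  have D: "D1 b \<le> D" "D2 b c \<le> D" for b c
  proof -
    have "D1 b \<le> (\<Sum>b\<in>UNIV. D1 b)" by (rule member_le_sum) (auto simp: D1)
    moreover have "D2 b c \<le> (\<Sum>c\<in>UNIV. D2 b c)" by (rule member_le_sum) (auto simp: D2)
    moreover have "(\<Sum>c\<in>UNIV. D2 b c) \<le> (\<Sum>b\<in>UNIV. \<Sum>c\<in>UNIV. D2 b c)"
      by (rule member_le_sum[of b UNIV "\<lambda>b. \<Sum>c\<in>UNIV. D2 b c"]) (auto simp: sum_nonneg D2)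
    moreover have "0 \<le> (\<Sum>b\<in>UNIV. D1 b)" "0 \<le> (\<Sum>b\<in>UNIV. \<Sum>c\<in>UNIV. D2 b c)"
      by (simp_all add: sum_nonneg D1 D2)
    ultimately show "D1 b \<le> D" "D2 b c \<le> D" unfolding D_def by linarith+
  qed
  have D0: "0 \<le> D" using D(1)[of 1] D1(1)[of 1] by linarith
  \<comment> \<open>First the error on the quadratic polynomial; then the Taylor remainder of order
    h^3 multiplied by matrix entries of order 1/h.\<close>
  define B' where "B' = (4 + 4 * X) * D * C12 + real CARD('np) * (C * B)"
  have B'0: "0 \<le> B'" using X(1) D0 C12_0 C B(1) by (simp add: B'_def)
  have "norm (dmat (M n) k a *v nodal (M n) f k - nodal (M n) (pd a f) k) \<le> real CARD('np) * B' * (h n)\<^sup>2"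
    if hn: "h n \<le> min \<rho> 1" and k: "k \<in> elems (M n)" for n k a
  proof -
    have hp: "0 < h n" by (rule h_pos[OF k])
    interpret sbp_discretization \<Omega> \<Gamma>D \<Gamma>N lam "M n" by (rule disc)
    let ?x = "xnode (M n) k"
    have x\<Omega>: "?x i \<in> \<Omega>" for i using element_subset[OF k] xnode_in_element by blast
    have dist: "norm (?x j - ?x i) \<le> h n" for i j
      using dist_le_mesh_size[OF k xnode_in_element xnode_in_element, of j i] by (simp add: dist_norm)
    have "\<bar>(dmat (M n) k a *v nodal (M n) f k - nodal (M n) (pd a f) k) $ i\<bar> \<le> B' * (h n)\<^sup>2" for i
    proof -
      let ?d = "\<lambda>j. dmat (M n) k a $ i $ j"
      define P where "P j = f (?x i) + (\<Sum>b\<in>UNIV. (?x j - ?x i) $ b * pd b f (?x i))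
        + (\<Sum>b\<in>UNIV. (?x j - ?x i) $ b * (\<Sum>c\<in>UNIV. (?x j - ?x i) $ c * pd c (pd b f) (?x i))) / 2" for j
      have P: "\<bar>f (?x j) - P j\<bar> \<le> B * h n ^ 3" for j
      proof -
        have "P j = (\<Sum>m<3. dird m (?x j - ?x i) f (?x i) / fact m)"
          by (simp add: P_def numeral_3_eq_3)
        then have "\<bar>f (?x j) - P j\<bar> \<le> B * norm (?x j - ?x i) ^ 3"
          using B(3)[OF x\<Omega>, of "?x j" i] dist[of j i] hn by simp
        also have "\<dots> \<le> B * h n ^ 3" using dist B(1) by (intro mult_left_mono power_mono) auto
        finally show ?thesis .
      qed
      have "h n ^ p \<le> (h n)\<^sup>2" using p(2) hp hn by (intro power_decreasing) auto
      then have e: "C' * h n ^ p \<le> C12 * (h n)\<^sup>2" if "C' \<le> C12" for C'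
        using that hp C12_0 by (intro mult_mono) auto
      have 1: "\<bar>(\<Sum>j\<in>UNIV. ?d j * P j) - pd a f (?x i)\<bar> \<le> (4 + 4 * X) * D * (C12 * (h n)\<^sup>2)"
        unfolding P_def
      proof (rule quadratic_derivative_error)
        show "(\<Sum>j\<in>UNIV. ?d j) = 0"
          using arg_cong[OF dmat_one[OF k, of a], of "\<lambda>v. v $ i"] by (simp add: matrix_vector_mult_def)
        show "\<bar>(\<Sum>j\<in>UNIV. ?d j * ?x j $ b) - (if a = b then 1 else 0)\<bar> \<le> C12 * (h n)\<^sup>2" for b
          using order.trans[OF C1[OF k, of a b i] e[OF C12(1)]]
          by (simp add: matrix_vector_mult_def nodal_def pd_coord)
        show "\<bar>(\<Sum>j\<in>UNIV. ?d j * (?x j $ b * ?x j $ c))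
          - (?x i $ b * (if a = c then 1 else 0) + (if a = b then 1 else 0) * ?x i $ c)\<bar> \<le> C12 * (h n)\<^sup>2" for b c
        proof -
          have "pd a (\<lambda>x. x $ b * x $ c) y = y $ b * (if a = c then 1 else 0) + (if a = b then 1 else 0) * y $ c" for y
            by (subst pd_mult) (auto simp: pd_coord differentiable_def intro!: exI has_derivative_nth)
          then show ?thesis
            using order.trans[OF C2[OF k, of a b c i] e[OF C12(2)]]
            by (simp add: matrix_vector_mult_def nodal_def)
        qed
        show "\<bar>?x i $ b\<bar> \<le> X" for b using component_le_norm_cart X(2)[OF x\<Omega>] order.trans by blast
        show "\<bar>pd b f (?x i)\<bar> \<le> D" for b using D1(2)[OF x\<Omega>] D(1) order.trans by blast
        show "\<bar>pd c (pd b f) (?x i)\<bar> \<le> D" for b c using D2(2)[OF x\<Omega>] D(2) order.trans by blast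
      qed
      have "\<bar>\<Sum>j\<in>UNIV. ?d j * (f (?x j) - P j)\<bar> \<le> (\<Sum>j\<in>(UNIV::'np set). (C / h n) * (B * h n ^ 3))"
        using C hp by (intro order.trans[OF sum_abs] sum_mono) (auto simp only: abs_mult intro!: mult_mono P dc[OF k] divide_nonneg_pos)
      also have "\<dots> = real CARD('np) * (C * B) * (h n)\<^sup>2"
        using hp by (simp add: eval_nat_numeral field_simps)
      finally have 2: "\<bar>\<Sum>j\<in>UNIV. ?d j * (f (?x j) - P j)\<bar> \<le> \<dots>" .
      have "(dmat (M n) k a *v nodal (M n) f k - nodal (M n) (pd a f) k) $ i
        = ((\<Sum>j\<in>UNIV. ?d j * P j) - pd a f (?x i)) + (\<Sum>j\<in>UNIV. ?d j * (f (?x j) - P j))"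
        by (simp add: matrix_vector_mult_def nodal_def right_diff_distrib sum_subtractf)
      then have "\<bar>(dmat (M n) k a *v nodal (M n) f k - nodal (M n) (pd a f) k) $ i\<bar>
        \<le> (4 + 4 * X) * D * (C12 * (h n)\<^sup>2) + real CARD('np) * (C * B) * (h n)\<^sup>2"
        using 1 2 by linarith
      also have "\<dots> = B' * (h n)\<^sup>2" by (simp add: B'_def algebra_simps)
      finally show ?thesis .
    qed
    from norm_vec_le_card[OF this] show ?thesis by (simp add: mult.assoc)
  qed
  then show ?thesis
    using B'0 B(2) by (intro exI[of _ "real CARD('np) * B'"] conjI exI[of _ "min \<rho> 1"]) auto
qed

section \<open>The limit h -> 0\<close>

lemma consistent_BR1: "consistent \<Omega> \<Gamma>D \<Gamma>N lam p M (\<lambda>n. BR1_sat lam (M n))"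
  unfolding consistent_def
proof (intro allI impI)
  fix F Udir Uneu U
  assume "steady_solution \<Omega> \<Gamma>D \<Gamma>N lam F Udir Uneu U \<and> Ck (p + 1) U \<Omega>"
  then have sol: "steady_solution \<Omega> \<Gamma>D \<Gamma>N lam F Udir Uneu U" and UC: "Ck (p + 1) U \<Omega>" by auto
  let ?f = "\<lambda>a x. flux lam U x $ a"
  obtain S1 where S1: "open S1" "\<Omega> \<subseteq> S1" "Ck_on (p + 1) U S1" using UC by (auto simp: Ck_def)
  have "\<forall>a b. \<exists>S. open S \<and> \<Omega> \<subseteq> S \<and> Ck_on p (\<lambda>x. lam x $ a $ b) S" using lamC by (auto simp: Ck_def)
  then obtain Sl where Sl: "\<And>a b. open (Sl a b)" "\<And>a b. \<Omega> \<subseteq> Sl a b" "\<And>a b. Ck_on p (\<lambda>x. lam x $ a $ b) (Sl a b)"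
    by metis
  define S where "S = S1 \<inter> (\<Inter>a. \<Inter>b. Sl a b)"
  have S: "open S" "\<Omega> \<subseteq> S"
    unfolding S_def using S1(1) Sl(1) by (auto intro!: open_INT) (use S1(2) Sl(2) in blast)+
  have US: "Ck_on (p + 1) U S" by (rule Ck_on_subset[OF S1(3)]) (auto simp: S_def)
  have lS: "Ck_on p (\<lambda>x. lam x $ a $ b) S" for a b by (rule Ck_on_subset[OF Sl(3)]) (auto simp: S_def)
  have dS: "Ck_on p (pd b U) S" for b using US by simp
  have fS: "Ck_on p (?f a) S" for a
  proof -
    have "?f a = (\<lambda>x. lam x $ a $ 1 * pd 1 U x + lam x $ a $ 2 * pd 2 U x)"
      by (simp add: flux_def matrix_vector_mult_def sum_2 fun_eq_iff)
    then show ?thesis by (simp only:) (intro Ck_on_add Ck_on_mult S lS dS)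
  qed
  \<comment> \<open>The solution has p + 1 derivatives and is extrapolated to order 4, the flux
    below has only p and is extrapolated to order 3; both orders are available since
    \<open>3 \<le> p\<close>.\<close>
  obtain BJ \<rho>J where J: "BJ \<ge> 0" "\<rho>J > 0" "\<And>n k \<gamma>. h n \<le> \<rho>J \<Longrightarrow> k \<in> elems (M n) \<Longrightarrow> \<gamma> \<in> facets (M n) k \<Longrightarrow>
    norm (Rm (M n) \<gamma> k *v nodal (M n) U k - facet_nodal (M n) U \<gamma> k) \<le> BJ * h n ^ 4"
    using extrapolation_error[OF S Ck_on_le[OF US, of 4]] p(2) by auto
  have "\<forall>a. \<exists>B\<ge>0. \<exists>\<rho>>0. \<forall>n k \<gamma>. h n \<le> \<rho> \<and> k \<in> elems (M n) \<and> \<gamma> \<in> facets (M n) k \<longrightarrow>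
    norm (Rm (M n) \<gamma> k *v nodal (M n) (?f a) k - facet_nodal (M n) (?f a) \<gamma> k) \<le> B * h n ^ 3"
    using extrapolation_error[OF S Ck_on_le[OF fS, of 3]] p(2) by auto
  then obtain BF \<rho>F where F: "\<And>a. BF a \<ge> 0" "\<And>a. \<rho>F a > 0" "\<And>a n k \<gamma>. h n \<le> \<rho>F a \<Longrightarrow> k \<in> elems (M n) \<Longrightarrow> \<gamma> \<in> facets (M n) k \<Longrightarrow>
    norm (Rm (M n) \<gamma> k *v nodal (M n) (?f a) k - facet_nodal (M n) (?f a) \<gamma> k) \<le> BF a * h n ^ 3"
    by metis
  have "\<forall>a. \<exists>B\<ge>0. \<exists>\<rho>>0. \<forall>n k b. h n \<le> \<rho> \<and> k \<in> elems (M n) \<longrightarrow>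
    norm (dmat (M n) k b *v nodal (M n) (?f a) k - nodal (M n) (pd b (?f a)) k) \<le> B * (h n)\<^sup>2"
    using derivative_error[OF S Ck_on_le[OF fS p(2)]] by blast
  then obtain BG \<rho>G where G: "\<And>a. BG a \<ge> 0" "\<And>a. \<rho>G a > 0" "\<And>a n k b. h n \<le> \<rho>G a \<Longrightarrow> k \<in> elems (M n) \<Longrightarrow>
    norm (dmat (M n) k b *v nodal (M n) (?f a) k - nodal (M n) (pd b (?f a)) k) \<le> BG a * (h n)\<^sup>2"
    by metis
  obtain BD where BD: "\<And>n k a i. k \<in> elems (M n) \<Longrightarrow>
      \<bar>(dmat (M n) k a *v nodal (M n) U k) $ i - pd a U (xnode (M n) k i)\<bar> \<le> BD * h n ^ p"
    using acc UC unfolding order_accurate_def by meson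
  obtain K0 where K0: "1 \<le> K0" "\<And>n k K. k \<in> elems (M n) \<Longrightarrow> h n \<le> 1 \<Longrightarrow> K0 \<le> K \<Longrightarrow>
     bounded_mesh \<Omega> \<Gamma>D \<Gamma>N lam (M n) (h n) K" "\<And>n k. k \<in> elems (M n) \<Longrightarrow> h n \<le> 1 \<Longrightarrow> norm (Hm (M n) k) \<le> K0 * (h n)\<^sup>2"
    using bounded_mesh_ex by meson
  \<comment> \<open>One constant for the scalings of the operators and for all approximation errors,
    as \<open>bound_residual\<close> requires.\<close>
  define K where "K = K0 + BJ + BF 1 + BF 2 + BG 1 + BG 2 + real CARD('np) * \<bar>BD\<bar>"
  define \<rho> where "\<rho> = Min {1, \<rho>J, \<rho>F 1, \<rho>F 2, \<rho>G 1, \<rho>G 2}"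
  have Dp: "0 \<le> real CARD('np) * \<bar>BD\<bar>" by simp
  have K: "K0 \<le> K" "BJ \<le> K" "BF a \<le> K" "BG a \<le> K" "real CARD('np) * \<bar>BD\<bar> \<le> K" for a
    using K0(1) J(1) F(1)[of 1] F(1)[of 2] G(1)[of 1] G(1)[of 2] Dp exhaust_2[of a] unfolding K_def by auto
  have \<rho>: "0 < \<rho>" "\<rho> \<le> 1" "\<rho> \<le> \<rho>J" "\<rho> \<le> \<rho>F a" "\<rho> \<le> \<rho>G a" for a
    using J(2) F(2) G(2) exhaust_2[of a] unfolding \<rho>_def by auto
  \<comment> \<open>The number of elements times h^2, the square root from passing to the weighted
    norm, and the constant of the nodal residual.\<close>
  define Q where "Q = measure lebesgue \<Omega> / (c * test_area) * (sqrt K0 * (150 * K ^ 12))"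
  let ?r = "\<lambda>n k. Lh lam (M n) (BR1_sat lam (M n)) (facet_nodal (M n) U) (facet_flux lam (M n) U) (nodal (M n) U) k - nodal (M n) F k"
  have bound: "\<bar>\<Sum>k\<in>elems (M n). Hnorm (M n) k (?r n k)\<bar> \<le> Q * \<bar>h n\<bar>" if hn: "h n \<le> \<rho>" for n
  proof -
    interpret sbp_discretization \<Omega> \<Gamma>D \<Gamma>N lam "M n" by (rule disc)
    have h1: "h n \<le> 1" using hn \<rho>(2) by linarith
    have r: "Hnorm (M n) k (?r n k) \<le> sqrt K0 * (150 * K ^ 12) * h n ^ 3" if k: "k \<in> elems (M n)" for k
    proof -
      have hp: "0 < h n" by (rule h_pos[OF k])
      have BDn: "norm (dmat (M n) k' a *v nodal (M n) U k' - nodal (M n) (pd a U) k') \<le> K * h n ^ 3"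
        if k': "k' \<in> elems (M n)" for k' a
      proof -
        have "norm (dmat (M n) k' a *v nodal (M n) U k' - nodal (M n) (pd a U) k') \<le> real CARD('np) * (\<bar>BD\<bar> * h n ^ 3)"
        proof (rule norm_vec_le_card)
          fix i
          have "\<bar>(dmat (M n) k' a *v nodal (M n) U k' - nodal (M n) (pd a U) k') $ i\<bar> \<le> BD * h n ^ p"
            using BD[OF k', of a i] by (simp add: nodal_def)
          also have "\<dots> \<le> \<bar>BD\<bar> * h n ^ 3"
            using hp h1 p(2) by (intro mult_mono power_decreasing) auto
          finally show "\<bar>(dmat (M n) k' a *v nodal (M n) U k' - nodal (M n) (pd a U) k') $ i\<bar> \<le> \<bar>BD\<bar> * h n ^ 3" .
        qed
        also have "\<dots> \<le> K * h n ^ 3"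
          unfolding mult.assoc[symmetric] using K(5) hp by (intro mult_right_mono) auto
        finally show ?thesis .
      qed
      have up: "x \<le> K * h n ^ m" if "x \<le> B * h n ^ m" "B \<le> K" for x B m
        using that hp by (meson mult_right_mono order_trans zero_le_power less_imp_le)
      have "norm (?r n k) \<le> 150 * K ^ 12 * (h n)\<^sup>2"
        by (rule bounded_mesh.bound_residual[OF K0(2)[OF k h1 K(1)] sol _ _ BDn _ k])
          (use hn \<rho> up[OF J(3) K(2)] up[OF F(3) K(3)] up[OF G(3) K(4)] in \<open>meson order_trans\<close>)+
      moreover have "Hnorm (M n) k (?r n k) \<le> sqrt K0 * h n * norm (?r n k)"
        using K0(1) hp by (intro Hnorm_le) (auto simp: power_mult_distrib intro!: K0(3) k h1)
      moreover have "0 \<le> sqrt K0 * h n" using K0(1) hp by simp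
      ultimately have "Hnorm (M n) k (?r n k) \<le> sqrt K0 * h n * (150 * K ^ 12 * (h n)\<^sup>2)"
        by (meson mult_left_mono order_trans)
      then show ?thesis by (simp add: eval_nat_numeral mult_ac)
    qed
    show ?thesis
    \<comment> \<open>In the empty case the sum vanishes, but \<open>mesh_size\<close> is a maximum
      over the empty set, of unknown sign; hence the modulus of \<open>h n\<close> in
      \<open>bound\<close>.\<close>
    proof (cases "elems (M n) = {}")
      case True
      have "0 \<le> Q" using c test_area_pos K0(1) K(1) by (simp add: Q_def)
      then show ?thesis using True by simp
    next
      case False
      then obtain k where "k \<in> elems (M n)" by blast
      then have hp: "0 < h n" by (rule h_pos)
      have "real (card (elems (M n))) * (c * (h n)\<^sup>2 * test_area) \<le> measure lebesgue \<Omega>"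
        by (rule card_elems_bound[OF jc])
      then have card: "real (card (elems (M n))) * (h n)\<^sup>2 \<le> measure lebesgue \<Omega> / (c * test_area)"
        using c test_area_pos by (simp add: field_simps)
      have "(\<Sum>k\<in>elems (M n). Hnorm (M n) k (?r n k)) \<le> real (card (elems (M n))) * (sqrt K0 * (150 * K ^ 12) * h n ^ 3)"
        by (intro sum_bounded_above r)
      also have "\<dots> = (real (card (elems (M n))) * (h n)\<^sup>2) * (sqrt K0 * (150 * K ^ 12) * h n)"
        by (simp add: eval_nat_numeral mult_ac)
      also have "\<dots> \<le> measure lebesgue \<Omega> / (c * test_area) * (sqrt K0 * (150 * K ^ 12) * h n)"
        using K0(1) K(1) hp by (intro mult_right_mono card) auto
      also have "\<dots> = Q * h n" by (simp add: Q_def)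
      finally have "(\<Sum>k\<in>elems (M n). Hnorm (M n) k (?r n k)) \<le> Q * h n" .
      moreover have "0 \<le> (\<Sum>k\<in>elems (M n). Hnorm (M n) k (?r n k))"
      proof (rule sum_nonneg)
        fix k assume k: "k \<in> elems (M n)"
        have "v \<bullet> (Hm (M n) k *v v) = (\<Sum>i\<in>UNIV. hw k i * (v $ i)\<^sup>2)" for v
          by (simp add: Hm_eq inner_vec_def power2_eq_square mult_ac)
        then have "0 \<le> v \<bullet> (Hm (M n) k *v v)" for v
          using hw_pos[OF k] by (simp add: sum_nonneg less_imp_le)
        then show "0 \<le> Hnorm (M n) k (?r n k)" unfolding Hnorm_def by simp
      qed
      ultimately show ?thesis using hp by simp
    qed
  qed
  have "\<forall>\<^sub>F n in sequentially. h n \<le> \<rho>"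
    using order_tendstoD(2)[OF h0 \<rho>(1)] by (rule eventually_mono) simp
  then have "\<forall>\<^sub>F n in sequentially. norm (\<Sum>k\<in>elems (M n). Hnorm (M n) k (?r n k)) \<le> Q * \<bar>h n\<bar>"
    by (rule eventually_mono) (simp only: real_norm_def bound)
  moreover have "(\<lambda>n. Q * \<bar>h n\<bar>) \<longlonglongrightarrow> 0"
    using tendsto_mult_left[OF tendsto_rabs[OF h0], of Q] by simp
  ultimately show "(\<lambda>n. \<Sum>k\<in>elems (M n). Hnorm (M n) k (?r n k)) \<longlonglongrightarrow> 0"
    by (rule Lim_null_comparison)
qed

lemma adjoint_consistent_BR1: "adjoint_consistent \<Omega> \<Gamma>D \<Gamma>N lam p M (\<lambda>n. BR1_sat lam (M n))"
  using consistent_BR1 unfolding adjoint_consistent_def consistent_def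
  by (simp add: sbp_discretization.Lh_adj_BR1[OF disc])

end

theorem proposition2:
  fixes \<Omega> \<Gamma>D \<Gamma>N :: "(real^2) set"
    and lam :: "real^2 \<Rightarrow> real^2^2"
    and E :: "('np::finite, 'nf::finite) ref_element"
    and M :: "nat \<Rightarrow> ('k, 'g, 'np, 'nf) sbp_mesh"
    and p :: nat
  assumes "diffusion_domain \<Omega> \<Gamma>D \<Gamma>N lam"
    and "valid_ref_element E" and "pdeg E = p"
    and "\<And>n. refel (M n) = E"
    and "\<And>n. valid_mesh \<Omega> \<Gamma>D \<Gamma>N (M n)"
    and "\<And>n. sbp_operators (M n)"
  shows "(\<forall>n. stabilized_BR1 lam (M n) (BR1_sat lam (M n)))
       \<and> (\<forall>n. conservative lam (M n) (BR1_sat lam (M n)))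
       \<and> (3 \<le> p \<and> (\<forall>a b. Ck p (\<lambda>x. lam x $ a $ b) \<Omega>) \<and>
          regular_family M \<and> order_accurate \<Omega> p M \<and> (\<lambda>n. mesh_size (M n)) \<longlonglongrightarrow> 0
          \<longrightarrow> consistent \<Omega> \<Gamma>D \<Gamma>N lam p M (\<lambda>n. BR1_sat lam (M n))
            \<and> adjoint_consistent \<Omega> \<Gamma>D \<Gamma>N lam p M (\<lambda>n. BR1_sat lam (M n)))"
proof -
  have disc: "sbp_discretization \<Omega> \<Gamma>D \<Gamma>N lam (M n)" for n
    by unfold_locales (use assms in auto)
  have "consistent \<Omega> \<Gamma>D \<Gamma>N lam p M (\<lambda>n. BR1_sat lam (M n))
      \<and> adjoint_consistent \<Omega> \<Gamma>D \<Gamma>N lam p M (\<lambda>n. BR1_sat lam (M n))"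
    if a: "3 \<le> p" "\<forall>a b. Ck p (\<lambda>x. lam x $ a $ b) \<Omega>" "regular_family M" "order_accurate \<Omega> p M"
      "(\<lambda>n. mesh_size (M n)) \<longlonglongrightarrow> 0"
  proof -
    obtain c C where c: "c > 0" and r: "\<And>n k. k \<in> elems (M n) \<Longrightarrow>
     (\<forall>a b. 1 \<le> a + b \<and> a + b \<le> p + 1 \<longrightarrow> norm (mcoef (M n) k a b) \<le> C * mesh_size (M n) ^ (a + b)) \<and>
     (\<forall>\<xi>\<in>ref_triangle. c * (mesh_size (M n))\<^sup>2 \<le> \<bar>jac_det (M n) k \<xi>\<bar>) \<and>
     (\<forall>a i j. \<bar>dmat (M n) k a $ i $ j\<bar> \<le> C / mesh_size (M n)) \<and>
     (\<forall>\<gamma>\<in>facets (M n) k. c \<le> alpha (M n) \<gamma> k)"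
      using a(3) unfolding regular_family_def assms(3,4) by metis
    have hp: "0 < mesh_size (M n)" if "k \<in> elems (M n)" for n k
      using sbp_discretization.mesh_size_pos[OF disc that] .
    \<comment> \<open>\<open>regular_family\<close> does not fix the sign of its upper constant;
      passing to the modulus keeps the bounds because mesh sizes are positive.\<close>
    interpret sbp_family \<Omega> \<Gamma>D \<Gamma>N lam E M p c "\<bar>C\<bar>"
    proof
      fix n k assume k: "k \<in> elems (M n)"
      have le: "C * x \<le> \<bar>C\<bar> * x" if "0 \<le> x" for x using that by (simp add: mult_right_mono)
      show "norm (mcoef (M n) k a b) \<le> \<bar>C\<bar> * mesh_size (M n) ^ (a + b)"
        if "1 \<le> a + b" "a + b \<le> p + 1" for a b
        using r[OF k] that le[of "mesh_size (M n) ^ (a + b)"] hp[OF k] by (meson order_trans zero_le_power less_imp_le)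
      show "\<bar>dmat (M n) k a $ i $ j\<bar> \<le> \<bar>C\<bar> / mesh_size (M n)" for a i j
        using r[OF k] hp[OF k] by (meson abs_ge_self divide_right_mono order_trans less_imp_le)
    qed (use assms a c r disc in auto)
    show ?thesis using consistent_BR1 adjoint_consistent_BR1 by blast
  qed
  then show ?thesis
    using sbp_discretization.stabilized_BR1_sat[OF disc] sbp_discretization.conservative_BR1[OF disc] by blast
qed

end
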